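(* Let $G$ be a compact connected metric graph, and let $\mathcal{C}\subset L^\infty(G)$ be a class of real-valued potentials. Given a potential $q\in\mathcal{C}$, suppose that $P$ is a perturbation such that $q+tP\in\mathcal{C}$ for each $t\ge 0$, respectively each $t\le 0$, sufficiently small (in absolute value). If there exist normalized eigenfunctions $u_1$ associated with $\lambda_1(q)$ and $u_2$ associated with $\lambda_2(q)$ such that $$\int_G P(x)\,[u_2^2(x)-u_1^2(x)]\,dx<0,\quad\text{respectively, } >0,$$ then $q$ does not minimize the fundamental gap $\Gamma[q]=\lambda_2(q)-\lambda_1(q)$ in $\mathcal{C}$.
   Context: A compact metric graph $G$ consists of finitely many edges, each identified with a compact interval $[0,|e|]$, $|e|>0$, whose endpoints are partitioned into finitely many classes (vertices) and glued accordingly. For a real potential $q$ on $G$, $H u=-u''+qu$ is the self-adjoint Schrödinger operator on $L^2(G)$ with standard (Kirchhoff) vertex conditions: continuity at each vertex and, at each vertex, the sum of the normal derivatives along all incident edge ends equals $0$. Its spectrum is discrete; eigenvalues counted with multiplicity are $\lambda_1(q)<\lambda_2(q)\le\dots$ (the first is always simple; $\lambda_2(q)$ need not be). Eigenfunctions and perturbations are taken real-valued; normalized means $L^2$-norm equal to $1$. *)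

theory Defs
  imports "HOL-Analysis.Analysis" "HOL-Library.Function_Algebras"
begin

text \<open>
  Edge \<open>e\<close> is a copy of the interval \<open>{0..len G e}\<close>. Its two ends are \<open>(e, False)\<close>, at \<open>0\<close>, and
  \<open>(e, True)\<close>, at \<open>len G e\<close>. The partition of the edge ends into vertices is given by the map
  \<open>vert G\<close>: two ends are glued iff they have the same image. Loops and parallel edges are allowed,
  and there are no vertices without incident edges.
\<close>

record ('e, 'v) metric_graph =
  edges :: "'e set"
  len :: "'e \<Rightarrow> real"
  vert :: "'e \<times> bool \<Rightarrow> 'v"

definition compact_metric_graph :: "('e, 'v) metric_graph \<Rightarrow> bool" where
  "compact_metric_graph G \<longleftrightarrow> finite (edges G) \<and> (\<forall>e\<in>edges G. 0 < len G e)"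

definition ends :: "('e, 'v) metric_graph \<Rightarrow> ('e \<times> bool) set" where
  "ends G = edges G \<times> UNIV"

definition vertices :: "('e, 'v) metric_graph \<Rightarrow> 'v set" where
  "vertices G = vert G ` ends G"

definition adjacency :: "('e, 'v) metric_graph \<Rightarrow> ('v \<times> 'v) set" where
  "adjacency G = {(vert G (e, a), vert G (e, b)) | e a b. e \<in> edges G}"

definition connected_graph :: "('e, 'v) metric_graph \<Rightarrow> bool" where
  "connected_graph G \<longleftrightarrow> (\<forall>x\<in>vertices G. \<forall>y\<in>vertices G. (x, y) \<in> (adjacency G)\<^sup>*)"

definition end_pos :: "('e, 'v) metric_graph \<Rightarrow> 'e \<times> bool \<Rightarrow> real" where
  "end_pos G d = (if snd d then len G (fst d) else 0)"

text \<open>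
  A function on \<open>G\<close> is a map \<open>f\<close> of type \<open>'e \<Rightarrow> real \<Rightarrow> real\<close>, where \<open>f e x\<close> is its value at the
  point \<open>x\<close> of the edge \<open>e\<close>; only the values for \<open>e \<in> edges G\<close> and \<open>x \<in> {0..len G e}\<close> matter.
  Elements of \<open>L\<^sup>\<infinity>(G)\<close> and \<open>L\<^sup>2(G)\<close> are represented by such functions, not by classes modulo
  equality almost everywhere.
\<close>

definition edge_measure :: "('e, 'v) metric_graph \<Rightarrow> 'e \<Rightarrow> real measure" where
  "edge_measure G e = lebesgue_on {0..len G e}"

definition graph_integral :: "('e, 'v) metric_graph \<Rightarrow> ('e \<Rightarrow> real \<Rightarrow> real) \<Rightarrow> real" where
  "graph_integral G f = (\<Sum>e\<in>edges G. integral\<^sup>L (edge_measure G e) (f e))"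

definition L2_norm_graph :: "('e, 'v) metric_graph \<Rightarrow> ('e \<Rightarrow> real \<Rightarrow> real) \<Rightarrow> real" where
  "L2_norm_graph G f = sqrt (graph_integral G (\<lambda>e x. (f e x)\<^sup>2))"

definition Linf :: "('e, 'v) metric_graph \<Rightarrow> ('e \<Rightarrow> real \<Rightarrow> real) set" where
  "Linf G = {f. \<forall>e\<in>edges G. f e \<in> borel_measurable (edge_measure G e) \<and>
                 (\<exists>B. AE x in edge_measure G e. \<bar>f e x\<bar> \<le> B)}"

text \<open>
  \<open>H2_on_interval l u v w\<close>: \<open>u\<close> lies in the Sobolev space \<open>H\<^sup>2(0,l)\<close> (taken as its \<open>C\<^sup>1\<close>
  representative on \<open>{0..l}\<close>), with derivative \<open>v\<close>, which is absolutely continuous, and weak second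
  derivative \<open>w \<in> L\<^sup>2(0,l)\<close>, which is determined up to a null set.
\<close>

definition H2_on_interval ::
    "real \<Rightarrow> (real \<Rightarrow> real) \<Rightarrow> (real \<Rightarrow> real) \<Rightarrow> (real \<Rightarrow> real) \<Rightarrow> bool" where
  "H2_on_interval l u v w \<longleftrightarrow>
     (\<forall>x\<in>{0..l}. (u has_real_derivative v x) (at x within {0..l})) \<and>
     w \<in> borel_measurable (lebesgue_on {0..l}) \<and>
     integrable (lebesgue_on {0..l}) (\<lambda>x. (w x)\<^sup>2) \<and>
     (\<forall>x\<in>{0..l}. v x = v 0 + integral\<^sup>L (lebesgue_on {0..x}) w)"

definition continuous_at_vertices ::
    "('e, 'v) metric_graph \<Rightarrow> ('e \<Rightarrow> real \<Rightarrow> real) \<Rightarrow> bool" where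
  "continuous_at_vertices G u \<longleftrightarrow>
     (\<forall>d\<in>ends G. \<forall>d'\<in>ends G. vert G d = vert G d' \<longrightarrow>
        u (fst d) (end_pos G d) = u (fst d') (end_pos G d'))"

text \<open>The derivative at the edge end \<open>d\<close> in the direction pointing into the edge, \<open>v\<close> being the
  derivative in the coordinate \<open>x\<close>.\<close>

definition normal_derivative ::
    "('e, 'v) metric_graph \<Rightarrow> ('e \<Rightarrow> real \<Rightarrow> real) \<Rightarrow> 'e \<times> bool \<Rightarrow> real" where
  "normal_derivative G v d =
     (if snd d then - v (fst d) (end_pos G d) else v (fst d) (end_pos G d))"

definition kirchhoff :: "('e, 'v) metric_graph \<Rightarrow> ('e \<Rightarrow> real \<Rightarrow> real) \<Rightarrow> bool" where
  "kirchhoff G v \<longleftrightarrow>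
     (\<forall>z\<in>vertices G. (\<Sum>d | d \<in> ends G \<and> vert G d = z. normal_derivative G v d) = 0)"

text \<open>
  The Schroedinger operator \<open>H\<close> with standard vertex conditions, as a relation:
  \<open>schroedinger G q u f\<close> means that \<open>u\<close> is in the domain of \<open>H\<close> and \<open>H u = f\<close> almost everywhere.
\<close>

definition schroedinger ::
    "('e, 'v) metric_graph \<Rightarrow> ('e \<Rightarrow> real \<Rightarrow> real) \<Rightarrow>
     ('e \<Rightarrow> real \<Rightarrow> real) \<Rightarrow> ('e \<Rightarrow> real \<Rightarrow> real) \<Rightarrow> bool" where
  "schroedinger G q u f \<longleftrightarrow>
     (\<exists>v w. (\<forall>e\<in>edges G. H2_on_interval (len G e) (u e) (v e) (w e)) \<and>
            continuous_at_vertices G u \<and> kirchhoff G v \<and>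
            (\<forall>e\<in>edges G. AE x in edge_measure G e. f e x = - w e x + q e x * u e x))"

text \<open>Members of the eigenspace are extended by zero off the graph, so that equality of functions
  is equality on \<open>G\<close> and the dimension of the eigenspace is the multiplicity.\<close>

definition eigenspace ::
    "('e, 'v) metric_graph \<Rightarrow> ('e \<Rightarrow> real \<Rightarrow> real) \<Rightarrow> real \<Rightarrow> ('e \<Rightarrow> real \<Rightarrow> real) set" where
  "eigenspace G q \<mu> =
     {u. (\<forall>e x. e \<notin> edges G \<or> x \<notin> {0..len G e} \<longrightarrow> u e x = 0) \<and>
         schroedinger G q u (\<lambda>e x. \<mu> * u e x)}"

definition is_eigenvalue ::
    "('e, 'v) metric_graph \<Rightarrow> ('e \<Rightarrow> real \<Rightarrow> real) \<Rightarrow> real \<Rightarrow> bool" where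
  "is_eigenvalue G q \<mu> \<longleftrightarrow> (\<exists>u\<in>eigenspace G q \<mu>. u \<noteq> 0)"

definition is_eigenfunction ::
    "('e, 'v) metric_graph \<Rightarrow> ('e \<Rightarrow> real \<Rightarrow> real) \<Rightarrow> real \<Rightarrow> ('e \<Rightarrow> real \<Rightarrow> real) \<Rightarrow> bool" where
  "is_eigenfunction G q \<mu> u \<longleftrightarrow> u \<in> eigenspace G q \<mu> \<and> u \<noteq> 0"

definition scale_fun :: "real \<Rightarrow> ('e \<Rightarrow> real \<Rightarrow> real) \<Rightarrow> ('e \<Rightarrow> real \<Rightarrow> real)" where
  "scale_fun c f = (\<lambda>e x. c * f e x)"

lemma vector_space_scale_fun: "vector_space scale_fun"
  by unfold_locales (auto simp: scale_fun_def fun_eq_iff algebra_simps)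

definition eigenvalue_mult ::
    "('e, 'v) metric_graph \<Rightarrow> ('e \<Rightarrow> real \<Rightarrow> real) \<Rightarrow> real \<Rightarrow> nat" where
  "eigenvalue_mult G q \<mu> = vector_space.dim scale_fun (eigenspace G q \<mu>)"

text \<open>The number of eigenvalues \<open>\<le> t\<close>, counted with multiplicity. Since the spectrum is discrete and
  bounded below, this is a finite sum.\<close>

definition eigenvalue_count ::
    "('e, 'v) metric_graph \<Rightarrow> ('e \<Rightarrow> real \<Rightarrow> real) \<Rightarrow> real \<Rightarrow> nat" where
  "eigenvalue_count G q t = (\<Sum>\<mu> | is_eigenvalue G q \<mu> \<and> \<mu> \<le> t. eigenvalue_mult G q \<mu>)"

text \<open>The \<open>k\<close>-th eigenvalue (\<open>k = 1, 2, \<dots>\<close>) in increasing order, counted with multiplicity; the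
  infimum is attained.\<close>

definition eigenvalue_nth ::
    "('e, 'v) metric_graph \<Rightarrow> nat \<Rightarrow> ('e \<Rightarrow> real \<Rightarrow> real) \<Rightarrow> real" where
  "eigenvalue_nth G k q = Inf {t. k \<le> eigenvalue_count G q t}"

definition fundamental_gap ::
    "('e, 'v) metric_graph \<Rightarrow> ('e \<Rightarrow> real \<Rightarrow> real) \<Rightarrow> real" where
  "fundamental_gap G q = eigenvalue_nth G 2 q - eigenvalue_nth G 1 q"

end

theory Submission
  imports Defs "HOL-Complex_Analysis.Great_Picard"
begin

text \<open>
The gap decreases to first order in the direction in question, and the first-order term dominates:
with \<open>\<Gamma>\<close> the fundamental gap, for all small \<open>t\<close>,
\<open>\<Gamma>[q + t P] \<le> \<Gamma>[q] + t \<integral> P (u2\<^sup>2 - u1\<^sup>2) + C t\<^sup>2\<close>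
(\<open>fundamental_gap_perturbation_upper\<close>). For small admissible \<open>t\<close> of the given sign the linear term is
negative and outweighs \<open>C t\<^sup>2\<close>.

The estimate is the difference of two one-sided bounds, so that a multiple second eigenvalue, which
need not depend differentiably on \<open>t\<close>, does no harm.
For the upper bound on \<open>\<lambda>\<^sub>2(q + t P)\<close>, the span of \<open>u1\<close> and \<open>u2\<close> contains a unit vector orthogonal to
the ground state of \<open>q + t P\<close>. Its energy is at most \<open>\<lambda>\<^sub>2(q) + t \<integral> P u2\<^sup>2 + C t\<^sup>2\<close>: a component \<open>c\<close> along
\<open>u1\<close> lowers it by \<open>(\<lambda>\<^sub>2 - \<lambda>\<^sub>1) c\<^sup>2\<close>, which pays for the cross term of order \<open>t c\<close>.
For the lower bound on \<open>\<lambda>\<^sub>1(q + t P)\<close>, the ground state of \<open>q + t P\<close> is split into a multiple of \<open>u1\<close>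
and a remainder orthogonal to \<open>u1\<close>; the \<open>q\<close>-energy of the remainder is at least \<open>\<lambda>\<^sub>2(q)\<close> times its
squared norm, and again the gap pays for the cross term. Both bounds need \<open>\<lambda>\<^sub>1 < \<lambda>\<^sub>2\<close> and the
variational description of the two lowest eigenvalues, which is built from the equation as follows.

The energy form is considered on functions with an essentially bounded derivative, a class that
contains all eigenfunctions and all test functions used. It suffices because minimisers are only
approached, never sought, inside it. A minimising sequence has bounded energy, hence is
equicontinuous and converges uniformly along a subsequence. It solves the weak eigenvalue equation
up to an error tending to zero (Cauchy-Schwarz for the nonnegative form). The main lemma,
\<open>weak_limit_in_eigenspace\<close>, says that a uniform limit of such approximate solutions is an
eigenfunction: tested with a piecewise linear function, the derivative enters only through
differences of function values, which converge; hats on an edge then give the differential equation,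
and hats at a vertex give the Kirchhoff condition. This yields minimisers of the energy over all unit
vectors and over the unit vectors orthogonal to the first minimiser (\<open>constrained_minimiser\<close>).

The same lemma applied to \<open>sqrt (u\<^sup>2 + \<epsilon>)\<close> shows that \<open>\<bar>u\<bar>\<close> is a ground state if \<open>u\<close> is one. If
\<open>\<bar>u\<bar>\<close> vanishes at a vertex, its normal derivatives there are nonnegative with sum zero, so it
vanishes on all incident edges by uniqueness for the initial value problem, and then everywhere by
connectedness. Hence of two ground states a combination vanishing at some vertex is zero: the ground
state is simple and \<open>\<lambda>\<^sub>1 < \<lambda>\<^sub>2\<close>. The eigenvalues not exceeding \<open>\<lambda>\<^sub>2\<close> are just \<open>\<lambda>\<^sub>1\<close> and \<open>\<lambda>\<^sub>2\<close>, which
identifies the minima with the values obtained by counting (\<open>eigenvalue_nth_low\<close>).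
\<close>

section \<open>Primitives of essentially bounded functions\<close>

definition ess_bounded :: "real \<Rightarrow> (real \<Rightarrow> real) \<Rightarrow> bool" where
  "ess_bounded l g \<longleftrightarrow> g \<in> borel_measurable (lebesgue_on {0..l}) \<and>
     (\<exists>B. AE x in lebesgue_on {0..l}. \<bar>g x\<bar> \<le> B)"

definition primitive_on :: "real \<Rightarrow> (real \<Rightarrow> real) \<Rightarrow> (real \<Rightarrow> real) \<Rightarrow> bool" where
  "primitive_on l u g \<longleftrightarrow> (\<forall>x\<in>{0..l}. u x = u 0 + integral\<^sup>L (lebesgue_on {0..x}) g)"

lemma primitive_onD:
  "primitive_on l u g \<Longrightarrow> 0 \<le> x \<Longrightarrow> x \<le> l \<Longrightarrow> u x = u 0 + integral\<^sup>L (lebesgue_on {0..x}) g"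
  unfolding primitive_on_def by (metis atLeastAtMost_iff)

lemma AE_lebesgue_on_subset:
  assumes "AE x in lebesgue_on S. Q x" "T \<subseteq> S" "S \<in> sets lebesgue" "T \<in> sets lebesgue"
  shows "AE x in lebesgue_on T. Q x"
proof -
  have "AE x in lebesgue. x \<in> S \<longrightarrow> Q x"
    using assms by (simp add: AE_restrict_space_iff)
  then have "AE x in lebesgue. x \<in> T \<longrightarrow> Q x"
    by eventually_elim (use assms in auto)
  then show ?thesis using assms by (simp add: AE_restrict_space_iff)
qed

lemma finite_measure_lebesgue_on_Icc: "finite_measure (lebesgue_on {a..b::real})"
  by (intro finite_measure_lebesgue_on lmeasurable_interval)

lemma ess_bounded_bound:
  assumes "ess_bounded l g"
  obtains B where "B > 0" "AE x in lebesgue_on {0..l}. \<bar>g x\<bar> \<le> B"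
proof -
  obtain B where "AE x in lebesgue_on {0..l}. \<bar>g x\<bar> \<le> B"
    using assms by (auto simp: ess_bounded_def)
  then have "AE x in lebesgue_on {0..l}. \<bar>g x\<bar> \<le> max B 1" by eventually_elim auto
  then show ?thesis by (intro that[of "max B 1"]) auto
qed

lemma ess_bounded_integrable:
  assumes "ess_bounded l g" shows "integrable (lebesgue_on {0..l}) g"
proof -
  interpret finite_measure "lebesgue_on {0..l}" by (rule finite_measure_lebesgue_on_Icc)
  obtain B where "AE x in lebesgue_on {0..l}. \<bar>g x\<bar> \<le> B" "g \<in> borel_measurable (lebesgue_on {0..l})"
    using assms by (auto simp: ess_bounded_def)
  then show ?thesis by (intro integrable_const_bound[where B=B]) auto
qed

lemma ess_bounded_integrable_sub:
  assumes "ess_bounded l g" "{x..y} \<subseteq> {0..l}" shows "integrable (lebesgue_on {x..y}) g"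
  by (rule integrable_subinterval[OF ess_bounded_integrable[OF assms(1)] assms(2)])

lemma ess_bounded_sum: 
  assumes "ess_bounded l f" "ess_bounded l g" shows "ess_bounded l (\<lambda>x. f x + g x)"
proof -
  obtain A B where A: "AE x in lebesgue_on {0..l}. \<bar>f x\<bar> \<le> A" and B: "AE x in lebesgue_on {0..l}. \<bar>g x\<bar> \<le> B"
    using assms by (auto simp: ess_bounded_def)
  have "AE x in lebesgue_on {0..l}. \<bar>f x + g x\<bar> \<le> A + B"
    using A B by eventually_elim linarith
  then show ?thesis using assms by (auto simp: ess_bounded_def)
qed

lemma ess_bounded_mult: 
  assumes "ess_bounded l f" "ess_bounded l g" shows "ess_bounded l (\<lambda>x. f x * g x)"
proof -
  obtain A where A: "AE x in lebesgue_on {0..l}. \<bar>f x\<bar> \<le> A" "A > 0" using ess_bounded_bound[OF assms(1)] by metis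
  obtain B where B: "AE x in lebesgue_on {0..l}. \<bar>g x\<bar> \<le> B" "B > 0" using ess_bounded_bound[OF assms(2)] by metis
  have "AE x in lebesgue_on {0..l}. \<bar>f x * g x\<bar> \<le> A * B"
    using A(1) B(1) by eventually_elim (use A B in \<open>auto simp: abs_mult intro!: mult_mono\<close>)
  then show ?thesis using assms by (auto simp: ess_bounded_def)
qed

lemma ess_bounded_const: "ess_bounded l (\<lambda>x. c)"
  by (auto simp: ess_bounded_def intro!: exI[of _ "\<bar>c\<bar>"])

lemma ess_bounded_continuous:
  assumes "continuous_on {0..l} f" shows "ess_bounded l f"
proof -
  have "bounded (f ` {0..l})" using assms by (intro compact_imp_bounded compact_continuous_image) auto
  then obtain B where "\<forall>x\<in>{0..l}. \<bar>f x\<bar> \<le> B" by (auto simp: bounded_iff)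
  then show ?thesis using assms 
    by (auto simp: ess_bounded_def intro!: exI[of _ B] AE_I2 continuous_imp_measurable_on_sets_lebesgue)
qed

lemma lebesgue_on_integral_singleton [simp]: "integral\<^sup>L (lebesgue_on {a::real}) f = (0::real)"
proof (rule integral_eq_zero_AE)
  have "AE x in lebesgue. x \<noteq> a" by (intro AE_completion AE_lborel_singleton)
  then show "AE x in lebesgue_on {a}. f x = 0" 
    by (subst AE_restrict_space_iff) (simp, erule AE_mp, auto)
qed

lemma lebesgue_on_integral_combine:
  fixes f :: "real \<Rightarrow> real"
  assumes "integrable (lebesgue_on {a..c}) f" "a \<le> b" "b \<le> c"
  shows "integral\<^sup>L (lebesgue_on {a..c}) f = integral\<^sup>L (lebesgue_on {a..b}) f + integral\<^sup>L (lebesgue_on {b..c}) f"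
proof -
  have "integrable (lebesgue_on {a..b}) f" "integrable (lebesgue_on {b..c}) f"
    using assms by (auto intro!: integrable_subinterval[OF assms(1)])
  then show ?thesis using assms
    by (simp add: lebesgue_integral_eq_integral integrable_on_lebesgue_on
        Henstock_Kurzweil_Integration.integral_combine)
qed

lemma lebesgue_on_integral_bound:
  fixes f :: "real \<Rightarrow> real"
  assumes "f \<in> borel_measurable (lebesgue_on {a..b})" "AE x in lebesgue_on {a..b}. \<bar>f x\<bar> \<le> B" "a \<le> b"
  shows "\<bar>integral\<^sup>L (lebesgue_on {a..b}) f\<bar> \<le> B * (b - a)"
proof -
  interpret finite_measure "lebesgue_on {a..b}" by (rule finite_measure_lebesgue_on_Icc)
  have i: "integrable (lebesgue_on {a..b}) f" using assms by (intro integrable_const_bound[where B=B]) auto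
  have "\<bar>integral\<^sup>L (lebesgue_on {a..b}) f\<bar> \<le> integral\<^sup>L (lebesgue_on {a..b}) (\<lambda>x. \<bar>f x\<bar>)"
    using integral_norm_bound[of "lebesgue_on {a..b}" f] by simp
  also have "\<dots> \<le> integral\<^sup>L (lebesgue_on {a..b}) (\<lambda>x. B)"
    using assms i by (intro integral_mono_AE) auto
  also have "\<dots> = B * (b - a)" using assms(3) by (simp add: measure_restrict_space)
  finally show ?thesis .
qed

lemma primitive_on_diff:
  assumes "primitive_on l u g" "ess_bounded l g" "0 \<le> x" "x \<le> y" "y \<le> l"
  shows "u y - u x = integral\<^sup>L (lebesgue_on {x..y}) g"
proof -
  have "u x = u 0 + integral\<^sup>L (lebesgue_on {0..x}) g" "u y = u 0 + integral\<^sup>L (lebesgue_on {0..y}) g"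
    using assms by (metis primitive_onD order.trans)+
  moreover have "integral\<^sup>L (lebesgue_on {0..y}) g = integral\<^sup>L (lebesgue_on {0..x}) g + integral\<^sup>L (lebesgue_on {x..y}) g"
    using assms by (intro lebesgue_on_integral_combine ess_bounded_integrable_sub[OF assms(2)]) auto
  ultimately show ?thesis by simp
qed

text \<open>
The bound on \<open>g\<close> is asked only between \<open>x\<close> and \<open>y\<close>; the uniqueness argument for the
differential equation depends on this localisation.
\<close>

lemma primitive_on_local_bound:
  assumes "primitive_on l u g" "ess_bounded l g" "x \<in> {0..l}" "y \<in> {0..l}"
    and B: "AE t in lebesgue_on {0..l}. min x y \<le> t \<and> t \<le> max x y \<longrightarrow> \<bar>g t\<bar> \<le> B"
  shows "\<bar>u y - u x\<bar> \<le> B * \<bar>y - x\<bar>"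
proof -
  have *: "\<bar>u b - u a\<bar> \<le> B * (b - a)" if ab: "0 \<le> a" "a \<le> b" "b \<le> l" 
    "AE t in lebesgue_on {0..l}. a \<le> t \<and> t \<le> b \<longrightarrow> \<bar>g t\<bar> \<le> B" for a b
    unfolding primitive_on_diff[OF assms(1,2) ab(1-3)]
  proof (rule lebesgue_on_integral_bound)
    have sub: "{a..b} \<subseteq> {0..l}" using ab by auto
    show "g \<in> borel_measurable (lebesgue_on {a..b})"
      by (rule borel_measurable_integrable[OF ess_bounded_integrable_sub[OF assms(2) sub]])
    have "AE t in lebesgue_on {a..b}. a \<le> t \<and> t \<le> b \<longrightarrow> \<bar>g t\<bar> \<le> B"
      by (rule AE_lebesgue_on_subset[OF ab(4) sub]) auto
    moreover have "AE t in lebesgue_on {a..b}. a \<le> t \<and> t \<le> b" by (rule AE_I2) simp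
    ultimately show "AE t in lebesgue_on {a..b}. \<bar>g t\<bar> \<le> B" by eventually_elim blast
  qed (use ab in auto)
  show ?thesis
  proof (cases "x \<le> y")
    case True
    then show ?thesis using *[of x y] assms(3-5) by auto
  next
    case False
    then show ?thesis using *[of y x] assms(3-5) by (auto simp: abs_minus_commute)
  qed
qed

lemma primitive_on_lipschitz:
  assumes "primitive_on l u g" "ess_bounded l g" "AE x in lebesgue_on {0..l}. \<bar>g x\<bar> \<le> B" "x \<in> {0..l}" "y \<in> {0..l}"
  shows "\<bar>u y - u x\<bar> \<le> B * \<bar>y - x\<bar>"
  by (rule primitive_on_local_bound[OF assms(1,2,4,5)]) (use assms(3) in \<open>auto elim: eventually_mono\<close>)

lemma primitive_on_continuous:
  assumes "primitive_on l u g" "ess_bounded l g"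
  shows "continuous_on {0..l} u"
proof -
  obtain B where B: "B > 0" "AE x in lebesgue_on {0..l}. \<bar>g x\<bar> \<le> B" using ess_bounded_bound[OF assms(2)] .
  have "B-lipschitz_on {0..l} u"
    using primitive_on_lipschitz[OF assms B(2)] B(1)
    by (intro lipschitz_onI) (auto simp: dist_real_def)
  then show ?thesis by (rule lipschitz_on_continuous_on)
qed

text \<open>
Such a function has derivative zero everywhere.
\<close>

lemma quadratic_increments_imp_constant:
  fixes F :: "real \<Rightarrow> real"
  assumes "\<And>x y. 0 \<le> x \<Longrightarrow> x \<le> y \<Longrightarrow> y \<le> l \<Longrightarrow> \<bar>F y - F x\<bar> \<le> C * (y - x)\<^sup>2" "0 \<le> l"
  shows "F l = F 0"
proof -
  have "\<exists>c. \<forall>x\<in>{0..l}. F x = c"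
  proof (rule has_field_derivative_zero_constant)
    fix x assume x: "x \<in> {0..l}"
    have "((\<lambda>y. (F y - F x) / (y - x)) \<longlongrightarrow> 0) (at x within {0..l})"
    proof (rule Lim_null_comparison)
      show "\<forall>\<^sub>F y in at x within {0..l}. norm ((F y - F x) / (y - x)) \<le> C * \<bar>y - x\<bar>"
        unfolding eventually_at
      proof (intro exI[of _ 1] conjI ballI impI)
        fix y assume y: "y \<in> {0..l}" "y \<noteq> x \<and> dist y x < 1"
        have "\<bar>F y - F x\<bar> \<le> C * (y - x)\<^sup>2"
        proof (cases "x \<le> y")
          case True
          then show ?thesis using assms(1)[of x y] x y(1) by simp
        next
          case False
          then have "\<bar>F x - F y\<bar> \<le> C * (x - y)\<^sup>2" using assms(1)[of y x] x y(1) by simp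
          then show ?thesis by (metis abs_minus_commute power2_commute)
        qed
        then show "norm ((F y - F x) / (y - x)) \<le> C * \<bar>y - x\<bar>"
          using y by (simp add: pos_divide_le_eq) (simp add: power2_eq_square mult.assoc)
      qed simp
      show "((\<lambda>y. C * \<bar>y - x\<bar>) \<longlongrightarrow> 0) (at x within {0..l})"
        by (auto intro!: tendsto_eq_intros)
    qed
    then show "(F has_field_derivative 0) (at x within {0..l})"
      by (simp add: has_field_derivative_iff)
  qed auto
  then show ?thesis using assms(2) by auto
qed

text \<open>
The function \<open>x \<mapsto> v x * h x\<close> minus the integral of \<open>v * g + w * h\<close> over \<open>{0..x}\<close> has quadratic
increments, because \<open>v\<close> and \<open>h\<close> are Lipschitz; hence it is constant. The derivatives \<open>w\<close> and \<open>g\<close>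
exist only almost everywhere, so the classical rule does not apply.
\<close>

lemma integral_by_parts_primitive:
  assumes "primitive_on l v w" "ess_bounded l w" "primitive_on l h g" "ess_bounded l g" "0 \<le> l"
  shows "integral\<^sup>L (lebesgue_on {0..l}) (\<lambda>x. v x * g x) + integral\<^sup>L (lebesgue_on {0..l}) (\<lambda>x. w x * h x)
           = v l * h l - v 0 * h 0"
proof -
  obtain A where A: "A > 0" "AE x in lebesgue_on {0..l}. \<bar>w x\<bar> \<le> A" using ess_bounded_bound[OF assms(2)] .
  obtain B where B: "B > 0" "AE x in lebesgue_on {0..l}. \<bar>g x\<bar> \<le> B" using ess_bounded_bound[OF assms(4)] .
  have ev: "ess_bounded l v" and eh: "ess_bounded l h"
    using primitive_on_continuous[OF assms(1,2)] primitive_on_continuous[OF assms(3,4)]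
    by (simp_all add: ess_bounded_continuous)
  define k where "k = (\<lambda>x. v x * g x + w x * h x)"
  have ek: "ess_bounded l k" unfolding k_def
    by (intro ess_bounded_sum ess_bounded_mult ev eh assms)
  define F where "F = (\<lambda>x. v x * h x - integral\<^sup>L (lebesgue_on {0..x}) k)"
  have "F l = F 0"
  proof (rule quadratic_increments_imp_constant)
    fix x y assume xy: "0 \<le> x" "x \<le> y" "y \<le> l"
    then have sub: "{x..y} \<subseteq> {0..l}" by auto
    let ?M = "lebesgue_on {x..y}"
    have "integral\<^sup>L (lebesgue_on {0..y}) k - integral\<^sup>L (lebesgue_on {0..x}) k = integral\<^sup>L ?M k"
      using xy by (subst lebesgue_on_integral_combine[where b=x and c=y and a=0])
         (auto intro!: ess_bounded_integrable_sub[OF ek])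
    then have 1: "F y - F x = v y * h y - v x * h x - integral\<^sup>L ?M k" by (simp add: F_def)
    have "v y * h y - v x * h x = (v y - v x) * h y + v x * (h y - h x)" by (simp add: algebra_simps)
    also have "\<dots> = integral\<^sup>L ?M (\<lambda>s. w s * h y) + integral\<^sup>L ?M (\<lambda>s. v x * g s)"
      using xy primitive_on_diff[OF assms(1,2), of x y] primitive_on_diff[OF assms(3,4), of x y] by simp
    also have "\<dots> = integral\<^sup>L ?M (\<lambda>s. w s * h y + v x * g s)"
      by (intro Bochner_Integration.integral_add[symmetric] ess_bounded_integrable_sub[OF _ sub]
        ess_bounded_mult ess_bounded_const assms)
    finally have "F y - F x = integral\<^sup>L ?M (\<lambda>s. w s * h y + v x * g s) - integral\<^sup>L ?M k"
      using 1 by simp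
    also have "\<dots> = integral\<^sup>L ?M (\<lambda>s. (w s * h y + v x * g s) - k s)"
      by (intro Bochner_Integration.integral_diff[symmetric] ess_bounded_integrable_sub[OF _ sub]
        ess_bounded_sum ess_bounded_mult ess_bounded_const assms ek)
    finally have 2: "F y - F x = integral\<^sup>L ?M (\<lambda>s. (w s * h y + v x * g s) - k s)" .
    have "\<bar>F y - F x\<bar> \<le> (2 * A * B * (y - x)) * (y - x)" unfolding 2
    proof (rule lebesgue_on_integral_bound)
      have "integrable ?M (\<lambda>s. (w s * h y + v x * g s) - k s)"
        by (intro Bochner_Integration.integrable_diff ess_bounded_integrable_sub[OF _ sub]
          ess_bounded_sum ess_bounded_mult ess_bounded_const assms ek)
      then show "(\<lambda>s. (w s * h y + v x * g s) - k s) \<in> borel_measurable ?M" by simp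
      have "AE s in ?M. \<bar>w s\<bar> \<le> A" "AE s in ?M. \<bar>g s\<bar> \<le> B" 
        using A(2) B(2) sub by (auto elim!: AE_lebesgue_on_subset)
      moreover have "AE s in ?M. s \<in> {x..y}" by (rule AE_I2) auto
      ultimately show "AE s in ?M. \<bar>(w s * h y + v x * g s) - k s\<bar> \<le> 2 * A * B * (y - x)"
      proof eventually_elim
        case (elim s)
        have "\<bar>h y - h s\<bar> \<le> B * \<bar>y - s\<bar>" "\<bar>v s - v x\<bar> \<le> A * \<bar>s - x\<bar>"
          using primitive_on_lipschitz[OF assms(3,4) B(2), of s y] 
            primitive_on_lipschitz[OF assms(1,2) A(2), of x s] elim xy by auto
        moreover have "B * \<bar>y - s\<bar> \<le> B * (y - x)" "A * \<bar>s - x\<bar> \<le> A * (y - x)"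
          using elim A B by auto
        ultimately have h: "\<bar>h y - h s\<bar> \<le> B * (y - x)" "\<bar>v x - v s\<bar> \<le> A * (y - x)" by auto
        have "(w s * h y + v x * g s) - k s = w s * (h y - h s) + (v x - v s) * g s"
          by (simp add: k_def algebra_simps)
        also have "\<bar>\<dots>\<bar> \<le> \<bar>w s\<bar> * \<bar>h y - h s\<bar> + \<bar>v x - v s\<bar> * \<bar>g s\<bar>"
          by (metis abs_mult abs_triangle_ineq)
        also have "\<dots> \<le> A * (B * (y - x)) + (A * (y - x)) * B"
          using h elim A B xy by (intro add_mono mult_mono) auto
        finally show ?case by (simp add: algebra_simps)
      qed
    qed (use xy in auto)
    then show "\<bar>F y - F x\<bar> \<le> (2 * A * B) * (y - x)\<^sup>2" by (simp add: power2_eq_square algebra_simps)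
  qed (use assms in auto)
  moreover have "integral\<^sup>L (lebesgue_on {0..l}) k = 
     integral\<^sup>L (lebesgue_on {0..l}) (\<lambda>x. v x * g x) + integral\<^sup>L (lebesgue_on {0..l}) (\<lambda>x. w x * h x)"
    unfolding k_def by (intro Bochner_Integration.integral_add ess_bounded_integrable ess_bounded_mult ev eh assms)
  ultimately show ?thesis by (simp add: F_def)
qed

lemma primitive_on_C1:
  assumes "\<And>x. x \<in> {0..l} \<Longrightarrow> (u has_real_derivative v x) (at x within {0..l})" "continuous_on {0..l} v"
  shows "primitive_on l u v"
  unfolding primitive_on_def
proof
  fix x assume x: "x \<in> {0..l}"
  have "(v has_integral u x - u 0) {0..x}"
    using x by (intro fundamental_theorem_of_calculus)
      (auto simp flip: has_real_derivative_iff_has_vector_derivative intro: has_field_derivative_subset[OF assms(1)])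
  moreover have "integrable (lebesgue_on {0..x}) v"
    using x by (intro ess_bounded_integrable_sub[OF ess_bounded_continuous[OF assms(2)]]) auto
  ultimately show "u x = u 0 + integral\<^sup>L (lebesgue_on {0..x}) v"
    by (simp add: lebesgue_integral_eq_integral integral_unique)
qed

lemma primitive_on_has_derivative:
  assumes "primitive_on l u v" "continuous_on {0..l} v" "x \<in> {0..l}"
  shows "(u has_real_derivative v x) (at x within {0..l})"
proof -
  have "((\<lambda>x. u 0 + integral {0..x} v) has_real_derivative v x) (at x within {0..l})"
    using integral_has_real_derivative[OF assms(2,3)] by (auto intro!: derivative_eq_intros)
  then show ?thesis
  proof (rule has_field_derivative_transform_within[where d=1])
    fix y assume "y \<in> {0..l}"
    then have "u y = u 0 + integral\<^sup>L (lebesgue_on {0..y}) v" "integrable (lebesgue_on {0..y}) v"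
      using assms primitive_onD[OF assms(1), of y]
        ess_bounded_integrable_sub[OF ess_bounded_continuous[OF assms(2)], of 0 y] by auto
    then show "u 0 + integral {0..y} v = u y"
      by (simp add: lebesgue_integral_eq_integral)
  qed (use assms in auto)
qed

lemma ess_bounded_integral_primitive: 
  assumes "ess_bounded l g" "0 \<le> l"
  shows "primitive_on l (\<lambda>x. c + integral\<^sup>L (lebesgue_on {0..x}) g) g"
proof -
  show ?thesis by (simp add: primitive_on_def)
qed

section \<open>The energy form on the graph\<close>

definition lincomb :: "real \<Rightarrow> ('e \<Rightarrow> real \<Rightarrow> real) \<Rightarrow> real \<Rightarrow> ('e \<Rightarrow> real \<Rightarrow> real) \<Rightarrow> 'e \<Rightarrow> real \<Rightarrow> real" where
  "lincomb c f d g = (\<lambda>e x. c * f e x + d * g e x)"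

definition inner_L2 :: "('e, 'v) metric_graph \<Rightarrow> ('e \<Rightarrow> real \<Rightarrow> real) \<Rightarrow> ('e \<Rightarrow> real \<Rightarrow> real) \<Rightarrow> real" where
  "inner_L2 G f h = graph_integral G (\<lambda>e x. f e x * h e x)"

text \<open>
The pair \<open>u\<close>, \<open>g\<close> consists of a function continuous on \<open>G\<close> that is in \<open>W\<^sup>1\<^sup>,\<^sup>\<infinity>\<close> on each edge, and a
representative of its weak derivative.
\<close>

definition W1inf :: "('e, 'v) metric_graph \<Rightarrow> ('e \<Rightarrow> real \<Rightarrow> real) \<Rightarrow> ('e \<Rightarrow> real \<Rightarrow> real) \<Rightarrow> bool" where
  "W1inf G u g \<longleftrightarrow> u \<in> Linf G \<and> g \<in> Linf G \<and> (\<forall>e\<in>edges G. primitive_on (len G e) (u e) (g e)) \<and>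
     continuous_at_vertices G u"

definition energy ::
    "('e, 'v) metric_graph \<Rightarrow> ('e \<Rightarrow> real \<Rightarrow> real) \<Rightarrow> ('e \<Rightarrow> real \<Rightarrow> real) \<Rightarrow> ('e \<Rightarrow> real \<Rightarrow> real) \<Rightarrow>
     ('e \<Rightarrow> real \<Rightarrow> real) \<Rightarrow> ('e \<Rightarrow> real \<Rightarrow> real) \<Rightarrow> real" where
  "energy G q u g \<eta> h = inner_L2 G g h + inner_L2 G (\<lambda>e x. q e x * u e x) \<eta>"

lemma Linf_iff: "f \<in> Linf G \<longleftrightarrow> (\<forall>e\<in>edges G. ess_bounded (len G e) (f e))"
  unfolding Linf_def ess_bounded_def edge_measure_def by simp

lemma Linf_lincomb: "f \<in> Linf G \<Longrightarrow> g \<in> Linf G \<Longrightarrow> lincomb c f d g \<in> Linf G"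
  by (auto simp: Linf_iff lincomb_def intro!: ess_bounded_sum ess_bounded_mult ess_bounded_const)

lemma Linf_mult: "f \<in> Linf G \<Longrightarrow> g \<in> Linf G \<Longrightarrow> (\<lambda>e x. f e x * g e x) \<in> Linf G"
  by (auto simp: Linf_iff intro!: ess_bounded_mult)

lemma inner_L2_commute: "inner_L2 G f h = inner_L2 G h f"
  by (simp add: inner_L2_def mult.commute)

lemma inner_L2_mult_shift: "inner_L2 G (\<lambda>e x. q e x * f e x) h = inner_L2 G f (\<lambda>e x. q e x * h e x)"
  by (simp add: inner_L2_def mult_ac)

lemma inner_L2_nonneg: "0 \<le> inner_L2 G f f"
  by (auto simp: inner_L2_def graph_integral_def intro!: sum_nonneg integral_nonneg_AE)

lemma L2_norm_graph_eq_1_iff: "L2_norm_graph G f = 1 \<longleftrightarrow> inner_L2 G f f = 1"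
  by (simp add: L2_norm_graph_def inner_L2_def power2_eq_square)

lemma inner_L2_lincomb_left:
  assumes "f \<in> Linf G" "g \<in> Linf G" "h \<in> Linf G"
  shows "inner_L2 G (lincomb c f d g) h = c * inner_L2 G f h + d * inner_L2 G g h"
proof -
  have "integral\<^sup>L (lebesgue_on {0..len G e}) (\<lambda>x. lincomb c f d g e x * h e x) =
     c * integral\<^sup>L (lebesgue_on {0..len G e}) (\<lambda>x. f e x * h e x)
     + d * integral\<^sup>L (lebesgue_on {0..len G e}) (\<lambda>x. g e x * h e x)" if "e \<in> edges G" for e
  proof -
    have "integrable (lebesgue_on {0..len G e}) (\<lambda>x. f e x * h e x)"
      "integrable (lebesgue_on {0..len G e}) (\<lambda>x. g e x * h e x)"
      using assms that by (auto simp: Linf_iff intro!: ess_bounded_integrable ess_bounded_mult)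
    moreover have "(\<lambda>x. lincomb c f d g e x * h e x) = (\<lambda>x. c * (f e x * h e x) + d * (g e x * h e x))"
      by (simp add: lincomb_def algebra_simps)
    ultimately show ?thesis by simp
  qed
  then show ?thesis
    by (simp add: inner_L2_def graph_integral_def edge_measure_def sum.distrib sum_distrib_left)
qed

lemma inner_L2_lincomb_right:
  assumes "f \<in> Linf G" "g \<in> Linf G" "h \<in> Linf G"
  shows "inner_L2 G h (lincomb c f d g) = c * inner_L2 G h f + d * inner_L2 G h g"
  using inner_L2_lincomb_left[OF assms] by (simp add: inner_L2_commute)

lemma primitive_on_lincomb:
  assumes "primitive_on l u g" "primitive_on l v h" "ess_bounded l g" "ess_bounded l h"
  shows "primitive_on l (\<lambda>x. c * u x + d * v x) (\<lambda>x. c * g x + d * h x)"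
  unfolding primitive_on_def
proof
  fix x assume x: "x \<in> {0..l}"
  then have "integrable (lebesgue_on {0..x}) g" "integrable (lebesgue_on {0..x}) h"
    by (auto intro: ess_bounded_integrable_sub[OF assms(3)] ess_bounded_integrable_sub[OF assms(4)])
  moreover have "u x = u 0 + integral\<^sup>L (lebesgue_on {0..x}) g" "v x = v 0 + integral\<^sup>L (lebesgue_on {0..x}) h"
    using x by (auto intro: primitive_onD[OF assms(1)] primitive_onD[OF assms(2)])
  ultimately show "c * u x + d * v x =
     c * u 0 + d * v 0 + integral\<^sup>L (lebesgue_on {0..x}) (\<lambda>x. c * g x + d * h x)"
    by (simp add: algebra_simps)
qed

lemma W1inf_lincomb:
  assumes "W1inf G u g" "W1inf G v h" shows "W1inf G (lincomb c u d v) (lincomb c g d h)"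
  unfolding W1inf_def
proof (intro conjI ballI)
  show "lincomb c u d v \<in> Linf G" "lincomb c g d h \<in> Linf G"
    using assms by (auto simp: W1inf_def intro!: Linf_lincomb)
  show "primitive_on (len G e) (lincomb c u d v e) (lincomb c g d h e)" if "e \<in> edges G" for e
    using assms that unfolding lincomb_def W1inf_def Linf_iff by (intro primitive_on_lincomb) auto
  have "u (fst d) (end_pos G d) = u (fst d') (end_pos G d')" "v (fst d) (end_pos G d) = v (fst d') (end_pos G d')"
    if "d \<in> ends G" "d' \<in> ends G" "vert G d = vert G d'" for d d'
    using assms that unfolding W1inf_def continuous_at_vertices_def by blast+
  then show "continuous_at_vertices G (lincomb c u d v)"
    unfolding continuous_at_vertices_def lincomb_def by metis
qed

lemma energy_commute: "energy G q u g \<eta> h = energy G q \<eta> h u g"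
  by (simp add: energy_def inner_L2_commute[of G g h] inner_L2_mult_shift inner_L2_commute[of G u])

lemma W1inf_Linf: "W1inf G u g \<Longrightarrow> u \<in> Linf G" "W1inf G u g \<Longrightarrow> g \<in> Linf G"
  by (auto simp: W1inf_def)

lemma energy_lincomb_left:
  assumes "q \<in> Linf G" "W1inf G u g" "W1inf G v k" "W1inf G \<eta> h"
  shows "energy G q (lincomb c u d v) (lincomb c g d k) \<eta> h = c * energy G q u g \<eta> h + d * energy G q v k \<eta> h"
proof -
  have "(\<lambda>e x. q e x * lincomb c u d v e x) = lincomb c (\<lambda>e x. q e x * u e x) d (\<lambda>e x. q e x * v e x)"
    by (simp add: lincomb_def algebra_simps)
  then show ?thesis using assms
    by (simp add: energy_def inner_L2_lincomb_left W1inf_Linf Linf_mult algebra_simps)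
qed

lemma energy_lincomb_right:
  assumes "q \<in> Linf G" "W1inf G u g" "W1inf G v k" "W1inf G \<eta> h"
  shows "energy G q \<eta> h (lincomb c u d v) (lincomb c g d k) = c * energy G q \<eta> h u g + d * energy G q \<eta> h v k"
  using energy_lincomb_left[OF assms] by (simp add: energy_commute)

lemma inner_L2_lincomb_square:
  assumes "f \<in> Linf G" "g \<in> Linf G"
  shows "inner_L2 G (lincomb c f d g) (lincomb c f d g)
           = c\<^sup>2 * inner_L2 G f f + 2 * c * d * inner_L2 G f g + d\<^sup>2 * inner_L2 G g g"
  using assms by (simp add: inner_L2_lincomb_left inner_L2_lincomb_right Linf_lincomb
      inner_L2_commute[of G g f] power2_eq_square algebra_simps)

lemma energy_lincomb_square:
  assumes "q \<in> Linf G" "W1inf G u g" "W1inf G v k"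
  shows "energy G q (lincomb c u d v) (lincomb c g d k) (lincomb c u d v) (lincomb c g d k)
           = c\<^sup>2 * energy G q u g u g + 2 * c * d * energy G q u g v k + d\<^sup>2 * energy G q v k v k"
  using assms by (simp add: energy_lincomb_left energy_lincomb_right W1inf_lincomb
      energy_commute[of G q v k u g] power2_eq_square algebra_simps)

lemma inner_L2_shifted_potential:
  assumes "q \<in> Linf G" "f \<in> Linf G" "g \<in> Linf G"
  shows "inner_L2 G (\<lambda>e x. (q e x - \<mu>) * f e x) g = inner_L2 G (\<lambda>e x. q e x * f e x) g - \<mu> * inner_L2 G f g"
proof -
  have "(\<lambda>e x. (q e x - \<mu>) * f e x) = lincomb 1 (\<lambda>e x. q e x * f e x) (-\<mu>) f"
    by (simp add: lincomb_def algebra_simps)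
  then show ?thesis using assms by (simp add: inner_L2_lincomb_left Linf_mult)
qed

section \<open>Eigenfunctions and the weak eigenvalue equation\<close>

lemma boundary_sum:
  assumes "compact_metric_graph G"
  shows "(\<Sum>e\<in>edges G. v e (len G e) * h e (len G e) - v e 0 * h e 0)
           = - (\<Sum>d\<in>ends G. normal_derivative G v d * h (fst d) (end_pos G d))"
proof -
  have fin: "finite (edges G)" using assms by (simp add: compact_metric_graph_def)
  have "(\<Sum>d\<in>ends G. normal_derivative G v d * h (fst d) (end_pos G d)) =
     (\<Sum>e\<in>edges G. \<Sum>b\<in>UNIV. normal_derivative G v (e, b) * h e (end_pos G (e, b)))"
    unfolding ends_def using fin by (subst sum.cartesian_product) (auto intro!: sum.cong)
  also have "\<dots> = (\<Sum>e\<in>edges G. v e 0 * h e 0 - v e (len G e) * h e (len G e))"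
    by (simp add: UNIV_bool normal_derivative_def end_pos_def)
  finally show ?thesis by (simp add: sum_negf[symmetric])
qed

text \<open>
The boundary terms of integration by parts on all edges, regrouped by vertices: for continuous \<open>h\<close>
the value at the vertex factors out and leaves the sum in the Kirchhoff condition.
\<close>

lemma boundary_sum_vertices:
  assumes "compact_metric_graph G"
    and "\<And>d. d \<in> ends G \<Longrightarrow> h (fst d) (end_pos G d) = f (vert G d)"
  shows "(\<Sum>e\<in>edges G. v e (len G e) * h e (len G e) - v e 0 * h e 0)
           = - (\<Sum>z\<in>vertices G. f z * (\<Sum>d | d \<in> ends G \<and> vert G d = z. normal_derivative G v d))"
proof -
  have fin: "finite (ends G)" using assms by (simp add: compact_metric_graph_def ends_def)
  have "(\<Sum>d\<in>ends G. normal_derivative G v d * h (fst d) (end_pos G d)) =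
     (\<Sum>d\<in>ends G. f (vert G d) * normal_derivative G v d)"
    using assms(2) by (intro sum.cong) auto
  also have "\<dots> = (\<Sum>z\<in>vertices G. \<Sum>d | d \<in> ends G \<and> vert G d = z. f (vert G d) * normal_derivative G v d)"
    unfolding vertices_def by (intro sum.group[symmetric]) (use fin in auto)
  also have "\<dots> = (\<Sum>z\<in>vertices G. f z * (\<Sum>d | d \<in> ends G \<and> vert G d = z. normal_derivative G v d))"
    by (auto simp: sum_distrib_left intro!: sum.cong)
  finally show ?thesis using boundary_sum[OF assms(1), of v h] by simp
qed

lemma continuous_at_vertices_iff:
  "continuous_at_vertices G u \<longleftrightarrow> (\<exists>f. \<forall>d\<in>ends G. u (fst d) (end_pos G d) = f (vert G d))"
proof
  assume u: "continuous_at_vertices G u"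
  show "\<exists>f. \<forall>d\<in>ends G. u (fst d) (end_pos G d) = f (vert G d)"
  proof (intro exI ballI)
    fix d assume d: "d \<in> ends G"
    define s where "s z = (SOME d'. d' \<in> ends G \<and> vert G d' = z)" for z
    have "s (vert G d) \<in> ends G \<and> vert G (s (vert G d)) = vert G d"
      unfolding s_def using d by (intro someI[of "\<lambda>d'. d' \<in> ends G \<and> vert G d' = vert G d" d]) auto
    then have "u (fst d) (end_pos G d) = u (fst (s (vert G d))) (end_pos G (s (vert G d)))"
      using u[unfolded continuous_at_vertices_def, rule_format, of d "s (vert G d)"] d by simp
    then show "u (fst d) (end_pos G d) = (\<lambda>z. let d' = (SOME d'. d' \<in> ends G \<and> vert G d' = z)
        in u (fst d') (end_pos G d')) (vert G d)" by (simp add: s_def Let_def)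
  qed
next
  assume "\<exists>f. \<forall>d\<in>ends G. u (fst d) (end_pos G d) = f (vert G d)"
  then show "continuous_at_vertices G u" unfolding continuous_at_vertices_def by metis
qed

lemma kirchhoff_boundary:
  assumes "compact_metric_graph G" "kirchhoff G v" "continuous_at_vertices G h"
  shows "(\<Sum>e\<in>edges G. v e (len G e) * h e (len G e) - v e 0 * h e 0) = 0"
proof -
  obtain f where "\<forall>d\<in>ends G. h (fst d) (end_pos G d) = f (vert G d)"
    using assms(3) by (auto simp: continuous_at_vertices_iff)
  then show ?thesis using assms(2)
    by (subst boundary_sum_vertices[OF assms(1), of h f]) (auto simp: kirchhoff_def intro!: sum.neutral)
qed

text \<open>
The equation \<open>u'' = (q - \<mu>) u\<close> as a first-order system, with \<open>v = u'\<close> and the exact function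
\<open>(q - \<mu>) u\<close> in place of some representative of \<open>u''\<close>, which is essentially bounded for bounded \<open>q\<close>.
\<close>

definition solves_on_edges ::
    "('e, 'v) metric_graph \<Rightarrow> ('e \<Rightarrow> real \<Rightarrow> real) \<Rightarrow> real \<Rightarrow> ('e \<Rightarrow> real \<Rightarrow> real) \<Rightarrow> ('e \<Rightarrow> real \<Rightarrow> real) \<Rightarrow> bool" where
  "solves_on_edges G q \<mu> u v \<longleftrightarrow> (\<forall>e\<in>edges G. continuous_on {0..len G e} (v e) \<and>
      (\<forall>x\<in>{0..len G e}. (u e has_real_derivative v e x) (at x within {0..len G e})) \<and>
      primitive_on (len G e) (v e) (\<lambda>x. (q e x - \<mu>) * u e x))"

definition supported_on :: "('e, 'v) metric_graph \<Rightarrow> ('e \<Rightarrow> real \<Rightarrow> real) \<Rightarrow> bool" where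
  "supported_on G u \<longleftrightarrow> (\<forall>e x. e \<notin> edges G \<or> x \<notin> {0..len G e} \<longrightarrow> u e x = 0)"

lemma eigenspaceD:
  assumes "compact_metric_graph G" "q \<in> Linf G" "u \<in> eigenspace G q \<mu>"
  obtains v where "solves_on_edges G q \<mu> u v" "W1inf G u v" "kirchhoff G v"
proof -
  obtain v w where vw: "\<And>e. e \<in> edges G \<Longrightarrow> H2_on_interval (len G e) (u e) (v e) (w e)"
    "continuous_at_vertices G u" "kirchhoff G v"
    "\<And>e. e \<in> edges G \<Longrightarrow> AE x in edge_measure G e. \<mu> * u e x = - w e x + q e x * u e x"
    using assms(3) unfolding eigenspace_def schroedinger_def by blast
  have edge: "continuous_on {0..len G e} (v e) \<and> continuous_on {0..len G e} (u e) \<and>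
      (\<forall>x\<in>{0..len G e}. (u e has_real_derivative v e x) (at x within {0..len G e})) \<and>
      primitive_on (len G e) (v e) (\<lambda>x. (q e x - \<mu>) * u e x)" if e: "e \<in> edges G" for e
  proof -
    let ?l = "len G e" and ?F = "\<lambda>x. (q e x - \<mu>) * u e x"
    have l: "0 < ?l" using assms(1) e by (simp add: compact_metric_graph_def)
    note H2 = vw(1)[OF e, unfolded H2_on_interval_def]
    have du: "\<forall>x\<in>{0..?l}. (u e has_real_derivative v e x) (at x within {0..?l})" by (rule H2[THEN conjunct1])
    have vx: "\<forall>x\<in>{0..?l}. v e x = v e 0 + integral\<^sup>L (lebesgue_on {0..x}) (w e)" by (rule H2[THEN conjunct2, THEN conjunct2, THEN conjunct2])
    have wm: "w e \<in> borel_measurable (lebesgue_on {0..?l})" by (rule H2[THEN conjunct2, THEN conjunct1])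
    have cu: "continuous_on {0..?l} (u e)" using du by (intro DERIV_continuous_on) auto
    have ae: "AE x in lebesgue_on {0..?l}. w e x = ?F x"
      using vw(4)[OF e] unfolding edge_measure_def by eventually_elim (simp add: algebra_simps)
    have bF: "ess_bounded ?l ?F"
    proof -
      have "ess_bounded ?l (\<lambda>x. (q e x + (-\<mu>)) * u e x)"
        using assms(2) e by (intro ess_bounded_mult ess_bounded_sum ess_bounded_const ess_bounded_continuous[OF cu])
           (simp add: Linf_iff)
      then show ?thesis by simp
    qed
    have prim: "primitive_on ?l (v e) ?F" unfolding primitive_on_def
    proof
      fix x assume x: "x \<in> {0..?l}"
      have "integral\<^sup>L (lebesgue_on {0..x}) (w e) = integral\<^sup>L (lebesgue_on {0..x}) ?F"
      proof (rule integral_cong_AE)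
        show "w e \<in> borel_measurable (lebesgue_on {0..x})"
          by (rule measurable_restrict_mono[OF wm]) (use x in simp)
        show "?F \<in> borel_measurable (lebesgue_on {0..x})"
          by (rule borel_measurable_integrable, rule ess_bounded_integrable_sub[OF bF]) (use x in simp)
        show "AE x in lebesgue_on {0..x}. w e x = ?F x"
          by (rule AE_lebesgue_on_subset[OF ae]) (use x in simp_all)
      qed
      moreover have "v e x = v e 0 + integral\<^sup>L (lebesgue_on {0..x}) (w e)" by (rule bspec[OF vx x])
      ultimately show "v e x = v e 0 + integral\<^sup>L (lebesgue_on {0..x}) ?F" by metis
    qed
    show ?thesis using primitive_on_continuous[OF prim bF] du cu prim by blast
  qed
  have "solves_on_edges G q \<mu> u v" using edge by (auto simp: solves_on_edges_def)
  moreover have "W1inf G u v" unfolding W1inf_def Linf_iff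
    using edge vw(2) by (auto intro!: ess_bounded_continuous primitive_on_C1)
  ultimately show ?thesis using that vw(3) by blast
qed

lemma eigenspaceI:
  assumes "compact_metric_graph G" "q \<in> Linf G" "solves_on_edges G q \<mu> u v" "kirchhoff G v"
    "continuous_at_vertices G u" "supported_on G u"
  shows "u \<in> eigenspace G q \<mu>"
proof -
  have "H2_on_interval (len G e) (u e) (v e) (\<lambda>x. (q e x - \<mu>) * u e x)" if e: "e \<in> edges G" for e
  proof -
    let ?l = "len G e" and ?F = "\<lambda>x. (q e x - \<mu>) * u e x"
    have du: "\<forall>x\<in>{0..?l}. (u e has_real_derivative v e x) (at x within {0..?l})" and p: "primitive_on ?l (v e) ?F"
       using assms(3) e by (auto simp: solves_on_edges_def)
    have cu: "continuous_on {0..?l} (u e)" using du by (intro DERIV_continuous_on) auto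
    have bF: "ess_bounded ?l ?F"
    proof -
      have "ess_bounded ?l (\<lambda>x. (q e x + (-\<mu>)) * u e x)"
        using assms(2) e by (intro ess_bounded_mult ess_bounded_sum ess_bounded_const ess_bounded_continuous[OF cu])
           (simp add: Linf_iff)
      then show ?thesis by simp
    qed
    have "integrable (lebesgue_on {0..?l}) (\<lambda>x. (?F x)\<^sup>2)"
      using ess_bounded_integrable[OF ess_bounded_mult[OF bF bF]] by (simp add: power2_eq_square)
    moreover have "?F \<in> borel_measurable (lebesgue_on {0..?l})" using bF by (simp add: ess_bounded_def)
    ultimately show ?thesis using du p unfolding H2_on_interval_def primitive_on_def by blast
  qed
  then have "schroedinger G q u (\<lambda>e x. \<mu> * u e x)"
    unfolding schroedinger_def using assms(4,5)
    by (intro exI[of _ v] exI[of _ "\<lambda>e x. (q e x - \<mu>) * u e x"]) (auto simp: algebra_simps)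
  then show ?thesis using assms(6) by (auto simp: eigenspace_def supported_on_def)
qed

text \<open>
Integration by parts on each edge; the boundary terms cancel by continuity and the Kirchhoff
condition.
\<close>

lemma weak_equation:
  assumes "compact_metric_graph G" "q \<in> Linf G" "solves_on_edges G q \<mu> u v" "W1inf G u v" "kirchhoff G v" "W1inf G \<eta> h"
  shows "energy G q u v \<eta> h = \<mu> * inner_L2 G u \<eta>"
proof -
  let ?F = "\<lambda>e x. (q e x - \<mu>) * u e x"
  have "inner_L2 G v h + inner_L2 G ?F \<eta> = (\<Sum>e\<in>edges G. v e (len G e) * \<eta> e (len G e) - v e 0 * \<eta> e 0)"
    unfolding inner_L2_def graph_integral_def edge_measure_def sum.distrib[symmetric]
  proof (rule sum.cong)
    fix e assume e: "e \<in> edges G"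
    have "?F \<in> Linf G"
    proof -
      have "(\<lambda>e x. lincomb 1 q (-\<mu>) (\<lambda>e x. 1) e x * u e x) \<in> Linf G"
        using assms(2) W1inf_Linf(1)[OF assms(4)]
        by (intro Linf_mult Linf_lincomb) (auto simp: Linf_iff ess_bounded_const)
      then show ?thesis by (simp add: lincomb_def)
    qed
    then show "integral\<^sup>L (lebesgue_on {0..len G e}) (\<lambda>x. v e x * h e x) 
        + integral\<^sup>L (lebesgue_on {0..len G e}) (\<lambda>x. ?F e x * \<eta> e x)
         = v e (len G e) * \<eta> e (len G e) - v e 0 * \<eta> e 0"
      using assms e by (intro integral_by_parts_primitive)
         (auto simp: solves_on_edges_def W1inf_def Linf_iff compact_metric_graph_def less_imp_le)
  qed simp
  also have "\<dots> = 0" using assms by (intro kirchhoff_boundary) (auto simp: W1inf_def)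
  finally show ?thesis using assms
    by (simp add: energy_def inner_L2_shifted_potential W1inf_Linf)
qed

lemma inner_L2_eigenfunctions_orthogonal:
  assumes "compact_metric_graph G" "q \<in> Linf G" "u \<in> eigenspace G q \<mu>" "v \<in> eigenspace G q \<nu>" "\<mu> \<noteq> \<nu>"
  shows "inner_L2 G u v = 0"
proof -
  obtain u' where u: "solves_on_edges G q \<mu> u u'" "W1inf G u u'" "kirchhoff G u'" using eigenspaceD[OF assms(1-3)] .
  obtain v' where v: "solves_on_edges G q \<nu> v v'" "W1inf G v v'" "kirchhoff G v'" using eigenspaceD[OF assms(1,2,4)] .
  have "\<mu> * inner_L2 G u v = \<nu> * inner_L2 G v u"
    using weak_equation[OF assms(1,2) u v(2)] weak_equation[OF assms(1,2) v u(2)] energy_commute[of G q u u' v v'] by simp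
  then show ?thesis using assms(5) by (simp add: inner_L2_commute)
qed

lemma inner_L2_eq_0_imp:
  assumes "compact_metric_graph G" "\<And>e. e \<in> edges G \<Longrightarrow> continuous_on {0..len G e} (u e)"
    and "inner_L2 G u u = 0" "e \<in> edges G" "x \<in> {0..len G e}"
  shows "u e x = 0"
proof -
  have fin: "finite (edges G)" "0 < len G e" using assms by (auto simp: compact_metric_graph_def)
  have "integral\<^sup>L (lebesgue_on {0..len G e}) (\<lambda>x. u e x * u e x) = 0"
    using assms(3,4) fin unfolding inner_L2_def graph_integral_def edge_measure_def
    by (subst (asm) sum_nonneg_eq_0_iff) (auto intro!: integral_nonneg_AE)
  then have "\<forall>x\<in>{0..len G e}. u e x * u e x = 0"
    using fin assms(2,4) by (subst (asm) integralL_eq_0_iff) (auto intro!: continuous_intros)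
  then show ?thesis using assms by auto
qed

section \<open>Uniform limits of approximate weak solutions\<close>

definition converges_uniformly ::
    "('e, 'v) metric_graph \<Rightarrow> (nat \<Rightarrow> 'e \<Rightarrow> real \<Rightarrow> real) \<Rightarrow> ('e \<Rightarrow> real \<Rightarrow> real) \<Rightarrow> bool" where
  "converges_uniformly G V U \<longleftrightarrow> (\<forall>e\<in>edges G. uniform_limit {0..len G e} (\<lambda>n. V n e) (U e) sequentially)"

lemma inner_L2_uniform_limit:
  assumes "compact_metric_graph G" "k \<in> Linf G" "\<And>n. V n \<in> Linf G" "U \<in> Linf G" "converges_uniformly G V U"
  shows "(\<lambda>n. inner_L2 G k (V n)) \<longlonglongrightarrow> inner_L2 G k U"
  unfolding inner_L2_def graph_integral_def edge_measure_def
proof (rule tendsto_sum)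
  fix e assume e: "e \<in> edges G"
  let ?l = "len G e" and ?M = "lebesgue_on {0..len G e}"
  have l: "0 < ?l" using assms(1) e by (simp add: compact_metric_graph_def)
  have bk: "ess_bounded ?l (k e)" and bV: "\<And>n. ess_bounded ?l (V n e)" and bU: "ess_bounded ?l (U e)"
    using assms(2-4) e by (auto simp: Linf_iff)
  obtain B where B: "B > 0" "AE x in ?M. \<bar>k e x\<bar> \<le> B" using ess_bounded_bound[OF bk] .
  show "(\<lambda>n. integral\<^sup>L ?M (\<lambda>x. k e x * V n e x)) \<longlonglongrightarrow> integral\<^sup>L ?M (\<lambda>x. k e x * U e x)"
  proof (rule tendstoI)
    fix \<epsilon> :: real assume \<epsilon>: "\<epsilon> > 0"
    define \<delta> where "\<delta> = \<epsilon> / (2 * B * ?l)"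
    have \<delta>: "\<delta> > 0" using \<epsilon> B l by (simp add: \<delta>_def)
    have "\<forall>\<^sub>F n in sequentially. \<forall>x\<in>{0..?l}. dist (V n e x) (U e x) < \<delta>"
      using assms(5) e \<delta> by (simp add: converges_uniformly_def uniform_limit_iff)
    then show "\<forall>\<^sub>F n in sequentially. dist (integral\<^sup>L ?M (\<lambda>x. k e x * V n e x)) (integral\<^sup>L ?M (\<lambda>x. k e x * U e x)) < \<epsilon>"
    proof eventually_elim
      case (elim n)
      have i: "integrable ?M (\<lambda>x. k e x * V n e x)" "integrable ?M (\<lambda>x. k e x * U e x)"
        by (intro ess_bounded_integrable ess_bounded_mult bk bV bU)+
      then have i': "integrable ?M (\<lambda>x. k e x * V n e x - k e x * U e x)" by simp
      have "\<bar>integral\<^sup>L ?M (\<lambda>x. k e x * V n e x - k e x * U e x)\<bar> \<le> (B * \<delta>) * (?l - 0)"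
      proof (rule lebesgue_on_integral_bound)
        show "(\<lambda>x. k e x * V n e x - k e x * U e x) \<in> borel_measurable ?M"
          by (rule borel_measurable_integrable[OF i'])
        have "AE x in ?M. x \<in> {0..?l}" by (rule AE_I2) simp
        with B(2) show "AE x in ?M. \<bar>k e x * V n e x - k e x * U e x\<bar> \<le> B * \<delta>"
        proof eventually_elim
          case (elim x)
          have "\<bar>k e x * V n e x - k e x * U e x\<bar> = \<bar>k e x\<bar> * \<bar>V n e x - U e x\<bar>"
            by (simp add: right_diff_distrib[symmetric] abs_mult)
          also have "\<dots> \<le> B * \<delta>"
            using elim B(1) \<open>\<forall>x\<in>{0..?l}. dist (V n e x) (U e x) < \<delta>\<close> \<delta>
            by (intro mult_mono) (auto simp: dist_real_def intro: less_imp_le)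
          finally show ?case .
        qed
      qed (use l in auto)
      also have "(B * \<delta>) * (?l - 0) < \<epsilon>" using \<epsilon> B l by (simp add: \<delta>_def)
      finally show ?case using i by (simp add: dist_real_def)
    qed
  qed
qed

lemma truncated_integral:
  fixes g :: "real \<Rightarrow> real"
  shows "integral\<^sup>L (lebesgue_on {0..y}) (\<lambda>t. if t \<le> a then g t else 0) = integral\<^sup>L (lebesgue_on {0..min y a}) g"
  by (auto simp: integral_restrict_space indicator_def intro!: Bochner_Integration.integral_cong)

lemma ess_bounded_step: "ess_bounded l (\<lambda>x. (if x \<le> a then 1 else 0) - c)"
proof -
  have "(\<lambda>x. (if x \<le> a then 1 else 0) - c) \<in> borel_measurable lborel" by measurable
  then show ?thesis unfolding ess_bounded_def
    by (auto intro!: exI[of _ "1 + \<bar>c\<bar>"] AE_I2 measurable_restrict_space1 measurable_completion)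
qed

lemma primitive_on_hat:
  assumes "0 \<le> a" shows "primitive_on l (\<lambda>x. min x a - c * x) (\<lambda>x. (if x \<le> a then 1 else 0) - c)"
  unfolding primitive_on_def
proof
  fix x assume x: "x \<in> {0..l}"
  have "integral\<^sup>L (lebesgue_on {0..x}) (\<lambda>t. if t \<le> a then 1 else 0) = min x a"
    unfolding truncated_integral using x assms by (simp add: measure_restrict_space)
  moreover have "integrable (lebesgue_on {0..x}) (\<lambda>t. (if t \<le> a then 1 else (0::real)))"
    using ess_bounded_integrable[OF ess_bounded_step[of x a 0]] by simp
  moreover have "integrable (lebesgue_on {0..x}) (\<lambda>t. c)"
    by (rule ess_bounded_integrable[OF ess_bounded_const])
  ultimately have "integral\<^sup>L (lebesgue_on {0..x}) (\<lambda>t. (if t \<le> a then 1 else 0) - c) = min x a - c * x"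
    using x by (simp add: measure_restrict_space)
  then show "min x a - c * x = min 0 a - c * 0 + integral\<^sup>L (lebesgue_on {0..x}) (\<lambda>t. (if t \<le> a then 1 else 0) - c)"
    using assms by simp
qed

lemma integral_primitive_step:
  assumes "primitive_on l u g" "ess_bounded l g" "0 \<le> a" "a \<le> l"
  shows "integral\<^sup>L (lebesgue_on {0..l}) (\<lambda>x. g x * ((if x \<le> a then 1 else 0) - c)) = u a - u 0 - c * (u l - u 0)"
proof -
  have "integrable (lebesgue_on {0..l}) (\<lambda>x. g x * ((if x \<le> a then 1 else 0) - 0))"
    by (rule ess_bounded_integrable[OF ess_bounded_mult[OF assms(2) ess_bounded_step]])
  moreover have "integrable (lebesgue_on {0..l}) g" by (rule ess_bounded_integrable[OF assms(2)])
  moreover have "(\<lambda>x. g x * ((if x \<le> a then 1 else 0) - c)) = (\<lambda>x. g x * ((if x \<le> a then 1 else 0) - 0) - c * g x)"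
    by (simp add: algebra_simps)
  ultimately have "integral\<^sup>L (lebesgue_on {0..l}) (\<lambda>x. g x * ((if x \<le> a then 1 else 0) - c))
    = integral\<^sup>L (lebesgue_on {0..l}) (\<lambda>x. g x * ((if x \<le> a then 1 else 0) - 0)) - c * integral\<^sup>L (lebesgue_on {0..l}) g"
    by simp
  also have "(\<lambda>x. g x * ((if x \<le> a then 1 else 0) - 0)) = (\<lambda>x. if x \<le> a then g x else 0)" by auto
  finally show ?thesis 
    using primitive_onD[OF assms(1), of a] primitive_onD[OF assms(1), of l] assms(3,4)
    by (simp add: truncated_integral min_absorb2)
qed

text \<open>
The hat on the edge \<open>e0\<close> with corner at \<open>a\<close>, linear on both sides of \<open>a\<close> and zero at both ends.
\<close>

definition edge_hat :: "('e, 'v) metric_graph \<Rightarrow> 'e \<Rightarrow> real \<Rightarrow> 'e \<Rightarrow> real \<Rightarrow> real" where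
  "edge_hat G e0 a = (\<lambda>e x. if e = e0 then min x a - a / len G e0 * x else 0)"
definition edge_hat_deriv :: "('e, 'v) metric_graph \<Rightarrow> 'e \<Rightarrow> real \<Rightarrow> 'e \<Rightarrow> real \<Rightarrow> real" where
  "edge_hat_deriv G e0 a = (\<lambda>e x. if e = e0 then (if x \<le> a then 1 else 0) - a / len G e0 else 0)"

definition vertex_interpolant :: "('e, 'v) metric_graph \<Rightarrow> ('v \<Rightarrow> real) \<Rightarrow> 'e \<Rightarrow> real \<Rightarrow> real" where
  "vertex_interpolant G f = (\<lambda>e x. f (vert G (e, False)) + x * ((f (vert G (e, True)) - f (vert G (e, False))) / len G e))"
definition vertex_slope :: "('e, 'v) metric_graph \<Rightarrow> ('v \<Rightarrow> real) \<Rightarrow> 'e \<Rightarrow> real \<Rightarrow> real" where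
  "vertex_slope G f = (\<lambda>e x. (f (vert G (e, True)) - f (vert G (e, False))) / len G e)"

lemma W1infI:
  assumes "\<And>e. e \<in> edges G \<Longrightarrow> ess_bounded (len G e) (g e)" "\<And>e. e \<in> edges G \<Longrightarrow> primitive_on (len G e) (u e) (g e)"
    "continuous_at_vertices G u"
  shows "W1inf G u g"
  using assms primitive_on_continuous unfolding W1inf_def Linf_iff by (metis ess_bounded_continuous)

lemma W1inf_continuous: "W1inf G u g \<Longrightarrow> e \<in> edges G \<Longrightarrow> continuous_on {0..len G e} (u e)"
  unfolding W1inf_def Linf_iff using primitive_on_continuous by metis

lemma W1inf_edge_hat:
  assumes "compact_metric_graph G" "e0 \<in> edges G" "0 \<le> a" "a \<le> len G e0"
  shows "W1inf G (edge_hat G e0 a) (edge_hat_deriv G e0 a)"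
proof (rule W1infI)
  fix e assume e: "e \<in> edges G"
  show "ess_bounded (len G e) (edge_hat_deriv G e0 a e)"
    using ess_bounded_step ess_bounded_const[of _ 0] by (cases "e = e0") (simp_all add: edge_hat_deriv_def)
  show "primitive_on (len G e) (edge_hat G e0 a e) (edge_hat_deriv G e0 a e)"
  proof (cases "e = e0")
    case True
    then show ?thesis using primitive_on_hat[OF assms(3), of "len G e0" "a / len G e0"] by (simp add: edge_hat_deriv_def edge_hat_def)
  next
    case False
    then show ?thesis by (simp add: edge_hat_deriv_def edge_hat_def primitive_on_def)
  qed
next
  have l: "0 < len G e0" using assms by (simp add: compact_metric_graph_def)
  have "edge_hat G e0 a (fst d) (end_pos G d) = 0" for d
    using assms l by (auto simp: edge_hat_def end_pos_def)
  then show "continuous_at_vertices G (edge_hat G e0 a)" by (simp add: continuous_at_vertices_def)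
qed

lemma vertex_interpolant_end:
  assumes "compact_metric_graph G" "d \<in> ends G"
  shows "vertex_interpolant G f (fst d) (end_pos G d) = f (vert G d)"
proof -
  obtain e b where d: "d = (e, b)" by (cases d)
  have "0 < len G e" using assms by (auto simp: compact_metric_graph_def ends_def d)
  then show ?thesis by (cases b) (simp_all add: d vertex_interpolant_def end_pos_def)
qed

lemma W1inf_vertex_interpolant:
  assumes "compact_metric_graph G"
  shows "W1inf G (vertex_interpolant G f) (vertex_slope G f)"
proof (rule W1infI)
  fix e assume e: "e \<in> edges G"
  show "ess_bounded (len G e) (vertex_slope G f e)"
    by (simp add: vertex_slope_def ess_bounded_const)
  show "primitive_on (len G e) (vertex_interpolant G f e) (vertex_slope G f e)"
    by (auto simp: primitive_on_def vertex_interpolant_def vertex_slope_def measure_restrict_space)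
next
  show "continuous_at_vertices G (vertex_interpolant G f)"
    unfolding continuous_at_vertices_iff using vertex_interpolant_end[OF assms] by blast
qed

lemma inner_L2_single_edge:
  assumes "finite (edges G)" "e0 \<in> edges G" "\<And>e x. e \<noteq> e0 \<Longrightarrow> h e x = 0"
  shows "inner_L2 G f h = integral\<^sup>L (lebesgue_on {0..len G e0}) (\<lambda>x. f e0 x * h e0 x)"
  unfolding inner_L2_def graph_integral_def edge_measure_def
  using assms by (subst sum.remove[OF assms(1,2)]) (auto intro!: sum.neutral)

lemma Linf_shift_mult:
  assumes "q \<in> Linf G" "u \<in> Linf G" shows "(\<lambda>e x. (q e x - \<mu>) * u e x) \<in> Linf G"
proof -
  have "(\<lambda>e x. lincomb 1 q (-\<mu>) (\<lambda>e x. 1) e x * u e x) \<in> Linf G"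
    using assms by (intro Linf_mult Linf_lincomb) (auto simp: Linf_iff ess_bounded_const)
  then show ?thesis by (simp add: lincomb_def)
qed

lemma W1inf_inner_slope:
  assumes "compact_metric_graph G" "W1inf G u g"
  shows "inner_L2 G g (vertex_slope G f) = 
    (\<Sum>e\<in>edges G. (u e (len G e) - u e 0) * ((f (vert G (e, True)) - f (vert G (e, False))) / len G e))"
  unfolding inner_L2_def graph_integral_def edge_measure_def
proof (rule sum.cong)
  fix e assume e: "e \<in> edges G"
  then have "u e (len G e) = u e 0 + integral\<^sup>L (lebesgue_on {0..len G e}) (g e)"
    using assms by (intro primitive_onD[where l="len G e"]) (auto simp: W1inf_def compact_metric_graph_def less_imp_le)
  then show "integral\<^sup>L (lebesgue_on {0..len G e}) (\<lambda>x. g e x * vertex_slope G f e x) =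
     (u e (len G e) - u e 0) * ((f (vert G (e, True)) - f (vert G (e, False))) / len G e)"
    by (simp add: vertex_slope_def)
qed simp

text \<open>
Against a test function with piecewise constant derivative, the inner product with the derivative of
\<open>V n\<close> is a combination of values of \<open>V n\<close>, so uniform convergence of \<open>V n\<close> is enough to pass to the
limit in the weak equation, without any convergence of \<open>D n\<close>.
For the hat at \<open>a\<close> the limit equation determines \<open>U e a\<close>: the twofold primitive \<open>Z\<close> of
\<open>K = (q - \<mu>) U\<close> satisfies the same equation, so \<open>U - Z\<close> is affine and \<open>U\<close> solves the differential
equation. For functions that are linear on each edge, one at one vertex and zero at the others,
the limit equation is the Kirchhoff condition.
\<close>

lemma weak_limit_in_eigenspace:
  assumes G: "compact_metric_graph G" and q: "q \<in> Linf G"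
    and V: "\<And>n. W1inf G (V n) (D n)" and lim: "converges_uniformly G V U" and supp: "supported_on G U"
    and weak: "\<And>\<eta> h. W1inf G \<eta> h \<Longrightarrow> (\<lambda>n. energy G q (V n) (D n) \<eta> h - \<mu> * inner_L2 G (V n) \<eta>) \<longlonglongrightarrow> 0"
  shows "U \<in> eigenspace G q \<mu>"
proof -
  have fin: "finite (edges G)" and len: "\<And>e. e \<in> edges G \<Longrightarrow> 0 < len G e"
    using G by (auto simp: compact_metric_graph_def)
  have cU: "continuous_on {0..len G e} (U e)" if "e \<in> edges G" for e
  proof (rule uniform_limit_theorem)
    show "\<forall>\<^sub>F n in sequentially. continuous_on {0..len G e} (V n e)"
      using that by (intro always_eventually allI W1inf_continuous[OF V])
    show "uniform_limit {0..len G e} (\<lambda>n. V n e) (U e) sequentially"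
      using lim that by (simp add: converges_uniformly_def)
  qed simp
  have UL: "U \<in> Linf G" using cU by (auto simp: Linf_iff intro: ess_bounded_continuous)
  have pt: "(\<lambda>n. V n e x) \<longlonglongrightarrow> U e x" if "e \<in> edges G" "x \<in> {0..len G e}" for e x
    using lim that by (auto simp: converges_uniformly_def intro: tendsto_uniform_limitI)
  have vU: "continuous_at_vertices G U" unfolding continuous_at_vertices_def
  proof (intro ballI impI)
    fix d d' assume d: "d \<in> ends G" "d' \<in> ends G" "vert G d = vert G d'"
    have end_in: "end_pos G d \<in> {0..len G (fst d)}" "fst d \<in> edges G" if "d \<in> ends G" for d
      using that len by (auto simp: ends_def end_pos_def less_imp_le)
    have "V n (fst d) (end_pos G d) = V n (fst d') (end_pos G d')" for n
      using V[of n] d unfolding W1inf_def continuous_at_vertices_def by blast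
    then have "(\<lambda>n. V n (fst d) (end_pos G d)) \<longlonglongrightarrow> U (fst d') (end_pos G d')"
      using pt[OF end_in(2,1), of d'] d by simp
    then show "U (fst d) (end_pos G d) = U (fst d') (end_pos G d')"
      using pt[OF end_in(2,1), of d] d LIMSEQ_unique by blast
  qed
  define K where "K = (\<lambda>e x. (q e x - \<mu>) * U e x)"
  have KL: "K \<in> Linf G" unfolding K_def by (rule Linf_shift_mult[OF q UL])
  have bK: "ess_bounded (len G e) (K e)" if "e \<in> edges G" for e using KL that by (simp add: Linf_iff)
  have eq: "L + inner_L2 G K \<eta> = 0" if H: "W1inf G \<eta> h" and L: "(\<lambda>n. inner_L2 G (D n) h) \<longlonglongrightarrow> L" for \<eta> h L
  proof -
    let ?k = "\<lambda>e x. (q e x - \<mu>) * \<eta> e x"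
    have "(\<lambda>n. inner_L2 G ?k (V n)) \<longlonglongrightarrow> inner_L2 G ?k U"
      using V by (intro inner_L2_uniform_limit G Linf_shift_mult q W1inf_Linf(1)[OF H] UL lim) (auto simp: W1inf_def)
    then have "(\<lambda>n. inner_L2 G (D n) h + inner_L2 G ?k (V n)) \<longlonglongrightarrow> L + inner_L2 G ?k U"
      using L by (intro tendsto_add)
    moreover have "inner_L2 G (D n) h + inner_L2 G ?k (V n) = energy G q (V n) (D n) \<eta> h - \<mu> * inner_L2 G (V n) \<eta>" for n
      using q W1inf_Linf(1)[OF H] W1inf_Linf(1)[OF V[of n]] inner_L2_mult_shift[of G q \<eta> "V n"]
      by (simp add: inner_L2_shifted_potential energy_def inner_L2_commute[of G \<eta>])
    ultimately have "L + inner_L2 G ?k U = 0"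
      using weak[OF H] LIMSEQ_unique by simp blast
    then show ?thesis by (simp add: K_def inner_L2_def mult_ac)
  qed
  define \<Phi> where "\<Phi> = (\<lambda>e x. integral\<^sup>L (lebesgue_on {0..x}) (K e))"
  define Z where "Z = (\<lambda>e x. integral\<^sup>L (lebesgue_on {0..x}) (\<Phi> e))"
  define c where "c = (\<lambda>e. (U e (len G e) - U e 0 - Z e (len G e)) / len G e)"
  define v where "v = (\<lambda>e x. c e + \<Phi> e x)"
  have p\<Phi>: "primitive_on (len G e) (\<Phi> e) (K e)" if "e \<in> edges G" for e
    using ess_bounded_integral_primitive[OF bK[OF that], of 0] len[OF that] by (simp add: \<Phi>_def)
  have c\<Phi>: "continuous_on {0..len G e} (\<Phi> e)" if "e \<in> edges G" for e
    by (rule primitive_on_continuous[OF p\<Phi> bK]) fact+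
  have pZ: "primitive_on (len G e) (Z e) (\<Phi> e)" if "e \<in> edges G" for e
    using ess_bounded_integral_primitive[OF ess_bounded_continuous[OF c\<Phi>[OF that]], of 0] len[OF that] by (simp add: Z_def)
  have Z0: "Z e 0 = 0" for e by (simp add: Z_def)
  \<comment> \<open>Testing with the hat at \<open>a\<close> determines the value at \<open>a\<close>; the constant \<open>c\<close> makes the formula hold at both ends.\<close>
  have Ueq: "U e a = U e 0 + c e * a + Z e a" if e: "e \<in> edges G" and a: "a \<in> {0..len G e}" for e a
  proof -
    let ?l = "len G e" and ?\<eta> = "edge_hat G e a" and ?h = "edge_hat_deriv G e a"
    have l: "0 < ?l" by (rule len[OF e])
    have h0: "?h e' x = 0" "?\<eta> e' x = 0" if "e' \<noteq> e" for e' x using that by (simp_all add: edge_hat_deriv_def edge_hat_def)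
    have "inner_L2 G (D n) ?h = V n e a - V n e 0 - a / ?l * (V n e ?l - V n e 0)" for n
    proof -
      have "inner_L2 G (D n) ?h = integral\<^sup>L (lebesgue_on {0..?l}) (\<lambda>x. D n e x * ?h e x)"
        by (rule inner_L2_single_edge[OF fin e h0(1)])
      also have "\<dots> = integral\<^sup>L (lebesgue_on {0..?l}) (\<lambda>x. D n e x * ((if x \<le> a then 1 else 0) - a / ?l))"
        by (simp add: edge_hat_deriv_def)
      also have "\<dots> = V n e a - V n e 0 - a / ?l * (V n e ?l - V n e 0)"
        using V[of n] e a by (intro integral_primitive_step) (auto simp: W1inf_def Linf_iff)
      finally show ?thesis .
    qed
    moreover have "(\<lambda>n. V n e a - V n e 0 - a / ?l * (V n e ?l - V n e 0)) \<longlonglongrightarrow> U e a - U e 0 - a / ?l * (U e ?l - U e 0)"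
      using e a l by (intro tendsto_intros pt) auto
    ultimately have "U e a - U e 0 - a / ?l * (U e ?l - U e 0) + inner_L2 G K ?\<eta> = 0"
      using a e by (intro eq[OF W1inf_edge_hat[OF G]]) auto
    moreover have "inner_L2 G K ?\<eta> = integral\<^sup>L (lebesgue_on {0..?l}) (\<lambda>x. K e x * ?\<eta> e x)"
      by (rule inner_L2_single_edge[OF fin e h0(2)])
    moreover have "integral\<^sup>L (lebesgue_on {0..?l}) (\<lambda>x. \<Phi> e x * ?h e x) 
       + integral\<^sup>L (lebesgue_on {0..?l}) (\<lambda>x. K e x * ?\<eta> e x) = \<Phi> e ?l * ?\<eta> e ?l - \<Phi> e 0 * ?\<eta> e 0"
      using e a l W1inf_edge_hat[OF G e, of a] by (intro integral_by_parts_primitive p\<Phi> bK) (auto simp: W1inf_def Linf_iff)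
    moreover have "?\<eta> e ?l = 0" "?\<eta> e 0 = 0" using a l by (auto simp: edge_hat_def)
    moreover have "integral\<^sup>L (lebesgue_on {0..?l}) (\<lambda>x. \<Phi> e x * ?h e x) = Z e a - Z e 0 - a / ?l * (Z e ?l - Z e 0)"
      using integral_primitive_step[OF pZ[OF e] ess_bounded_continuous[OF c\<Phi>[OF e]], of a "a / ?l"] a 
      by (simp add: edge_hat_deriv_def)
    ultimately show ?thesis using l unfolding c_def Z0 by (simp add: field_simps)
  qed
  have solves: "solves_on_edges G q \<mu> U v" unfolding solves_on_edges_def
  proof (intro ballI conjI)
    fix e assume e: "e \<in> edges G"
    show "continuous_on {0..len G e} (v e)" unfolding v_def by (intro continuous_intros c\<Phi> e)
    show "primitive_on (len G e) (v e) (\<lambda>x. (q e x - \<mu>) * U e x)"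
      using ess_bounded_integral_primitive[OF bK[OF e], of "c e"] len[OF e] by (simp add: v_def \<Phi>_def K_def)
    fix x assume x: "x \<in> {0..len G e}"
    have "((\<lambda>x. U e 0 + c e * x + Z e x) has_real_derivative v e x) (at x within {0..len G e})"
      using primitive_on_has_derivative[OF pZ[OF e] c\<Phi>[OF e] x] by (auto simp: v_def intro!: derivative_eq_intros)
    then show "(U e has_real_derivative v e x) (at x within {0..len G e})"
      by (rule has_field_derivative_transform_within[where d=1]) (use x in \<open>simp_all only: Ueq[OF e, symmetric] zero_less_one\<close>)
  qed
  have WU: "W1inf G U v"
    using solves vU by (intro W1infI) (auto simp: solves_on_edges_def intro: ess_bounded_continuous primitive_on_C1)
  have "kirchhoff G v" unfolding kirchhoff_def
  proof
    fix z assume z: "z \<in> vertices G"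
    define f where "f = (\<lambda>y. if y = z then 1 else (0::real))"
    let ?\<eta> = "vertex_interpolant G f" and ?h = "vertex_slope G f"
    note H = W1inf_vertex_interpolant[OF G, of f]
    have "(\<lambda>n. inner_L2 G (D n) ?h) \<longlonglongrightarrow> inner_L2 G v ?h"
      unfolding W1inf_inner_slope[OF G V] W1inf_inner_slope[OF G WU]
      using len by (intro tendsto_sum tendsto_mult tendsto_diff tendsto_const pt) (auto simp: less_imp_le)
    from eq[OF H this] have "inner_L2 G v ?h + inner_L2 G K ?\<eta> = 0" .
    moreover have "inner_L2 G v ?h + inner_L2 G K ?\<eta> = (\<Sum>e\<in>edges G. v e (len G e) * ?\<eta> e (len G e) - v e 0 * ?\<eta> e 0)"
      unfolding inner_L2_def graph_integral_def edge_measure_def sum.distrib[symmetric]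
    proof (rule sum.cong)
      fix e assume e: "e \<in> edges G"
      show "integral\<^sup>L (lebesgue_on {0..len G e}) (\<lambda>x. v e x * ?h e x) 
          + integral\<^sup>L (lebesgue_on {0..len G e}) (\<lambda>x. K e x * ?\<eta> e x)
           = v e (len G e) * ?\<eta> e (len G e) - v e 0 * ?\<eta> e 0"
        using e H len[OF e] bK[OF e] solves by (intro integral_by_parts_primitive)
          (auto simp: solves_on_edges_def W1inf_def Linf_iff K_def)
    qed simp
    also have "\<dots> = - (\<Sum>y\<in>vertices G. f y * (\<Sum>d | d \<in> ends G \<and> vert G d = y. normal_derivative G v d))"
      by (intro boundary_sum_vertices G vertex_interpolant_end)
    also have "\<dots> = - (\<Sum>d | d \<in> ends G \<and> vert G d = z. normal_derivative G v d)"
      using z fin by (subst sum.remove[of _ z]) (auto simp: f_def vertices_def ends_def intro!: sum.neutral)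
    ultimately show "(\<Sum>d | d \<in> ends G \<and> vert G d = z. normal_derivative G v d) = 0" by simp
  qed
  then show ?thesis by (intro eigenspaceI[OF G q solves _ vU supp])
qed

section \<open>Compactness of sets of bounded energy\<close>

lemma primitive_on_increment_square:
  assumes "primitive_on l u g" "ess_bounded l g" "x \<in> {0..l}" "y \<in> {0..l}"
  shows "(u y - u x)\<^sup>2 \<le> \<bar>y - x\<bar> * integral\<^sup>L (lebesgue_on {0..l}) (\<lambda>t. g t * g t)"
proof -
  have *: "(u y - u x)\<^sup>2 \<le> (y - x) * integral\<^sup>L (lebesgue_on {0..l}) (\<lambda>t. g t * g t)"
    if xy: "0 \<le> x" "x < y" "y \<le> l" for x y
  proof -
    let ?M = "lebesgue_on {x..y}" and ?g2 = "\<lambda>t. g t * g t"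
    have sub: "{x..y} \<subseteq> {0..l}" using xy by auto
    have bg2: "ess_bounded l ?g2" by (rule ess_bounded_mult[OF assms(2,2)])
    \<comment> \<open>The nonnegative integral of \<open>(g - s)\<^sup>2\<close> for the mean value \<open>s\<close> of \<open>g\<close> gives the Cauchy-Schwarz inequality.\<close>
    define I J s where "I = integral\<^sup>L ?M g" and "J = integral\<^sup>L ?M ?g2" and "s = I / (y - x)"
    have i: "integrable ?M g" "integrable ?M ?g2" "integrable ?M (\<lambda>t. s * s)"
      by (intro ess_bounded_integrable_sub[OF _ sub] assms(2) bg2 ess_bounded_const)+
    have "0 \<le> integral\<^sup>L ?M (\<lambda>t. (g t - s) * (g t - s))" by (intro integral_nonneg_AE) simp
    also have "(\<lambda>t. (g t - s) * (g t - s)) = (\<lambda>t. ?g2 t - (2 * s) * g t + s * s)" by (simp add: algebra_simps)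
    also have "integral\<^sup>L ?M \<dots> = J - 2 * s * I + s * s * (y - x)"
      using i xy by (simp add: I_def J_def measure_restrict_space algebra_simps)
    finally have nn: "0 \<le> J - 2 * s * I + s * s * (y - x)" .
    have sI: "s * (y - x) = I" using xy by (simp add: s_def)
    have "s * s * (y - x) = s * I" using sI by (simp only: mult.assoc)
    then have "s * I \<le> J" using nn by linarith
    then have "(y - x) * (s * I) \<le> (y - x) * J" using xy by (intro mult_left_mono) auto
    moreover have "(y - x) * (s * I) = (s * (y - x)) * I" by (simp only: ac_simps)
    ultimately have "I\<^sup>2 \<le> (y - x) * J" unfolding sI power2_eq_square by (simp only:)
    moreover have "J \<le> integral\<^sup>L (lebesgue_on {0..l}) ?g2"
    proof -
      have "integral\<^sup>L (lebesgue_on {0..l}) ?g2 = integral\<^sup>L (lebesgue_on {0..x}) ?g2 + integral\<^sup>L (lebesgue_on {x..l}) ?g2"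
        using xy by (intro lebesgue_on_integral_combine ess_bounded_integrable[OF bg2]) auto
      moreover have "integral\<^sup>L (lebesgue_on {x..l}) ?g2 = J + integral\<^sup>L (lebesgue_on {y..l}) ?g2"
        unfolding J_def using xy by (intro lebesgue_on_integral_combine ess_bounded_integrable_sub[OF bg2]) auto
      moreover have "0 \<le> integral\<^sup>L (lebesgue_on {0..x}) ?g2" "0 \<le> integral\<^sup>L (lebesgue_on {y..l}) ?g2"
        by (intro integral_nonneg_AE; simp)+
      ultimately show ?thesis by simp
    qed
    ultimately have "I\<^sup>2 \<le> (y - x) * integral\<^sup>L (lebesgue_on {0..l}) ?g2"
      using xy by (meson diff_ge_0_iff_ge less_imp_le mult_left_mono order_trans)
    then show ?thesis using primitive_on_diff[OF assms(1,2), of x y] xy by (simp add: I_def)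
  qed
  show ?thesis using *[of x y] *[of y x] assms(3,4)
    by (cases x y rule: linorder_cases) (simp_all add: power2_commute[of "u y" "u x"])
qed

lemma edge_integral_le_inner_L2:
  assumes "finite (edges G)" "e \<in> edges G"
  shows "integral\<^sup>L (lebesgue_on {0..len G e}) (\<lambda>x. f e x * f e x) \<le> inner_L2 G f f"
  unfolding inner_L2_def graph_integral_def edge_measure_def
  by (rule member_le_sum[OF assms(2)]) (auto intro!: integral_nonneg_AE assms(1))

text \<open>
A bound on the derivative in \<open>L\<^sup>2\<close> gives the Hoelder exponent \<open>1/2\<close>, hence equicontinuity.
\<close>

lemma W1inf_increment_square:
  assumes "compact_metric_graph G" "W1inf G u g" "e \<in> edges G" "x \<in> {0..len G e}" "y \<in> {0..len G e}"
  shows "(u e y - u e x)\<^sup>2 \<le> \<bar>y - x\<bar> * inner_L2 G g g"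
proof -
  have "(u e y - u e x)\<^sup>2 \<le> \<bar>y - x\<bar> * integral\<^sup>L (lebesgue_on {0..len G e}) (\<lambda>t. g e t * g e t)"
    using assms by (intro primitive_on_increment_square) (auto simp: W1inf_def Linf_iff)
  also have "\<dots> \<le> \<bar>y - x\<bar> * inner_L2 G g g"
    using assms by (intro mult_left_mono edge_integral_le_inner_L2) (auto simp: compact_metric_graph_def)
  finally show ?thesis .
qed

text \<open>
Integrate \<open>u(x)\<^sup>2 \<le> 2 u(y)\<^sup>2 + 2 (u(x) - u(y))\<^sup>2\<close> over \<open>y\<close>, using the bound on the increments.
\<close>

lemma W1inf_pointwise_bound:
  assumes "compact_metric_graph G" "W1inf G u g" "e \<in> edges G" "x \<in> {0..len G e}"
    "inner_L2 G u u \<le> A" "inner_L2 G g g \<le> B"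
  shows "(u e x)\<^sup>2 \<le> 2 * A / len G e + 2 * len G e * B"
proof -
  let ?l = "len G e" let ?M = "lebesgue_on {0..?l}"
  have l: "0 < ?l" and fin: "finite (edges G)" using assms by (auto simp: compact_metric_graph_def)
  have B: "0 \<le> B" using inner_L2_nonneg[of G g] assms by linarith
  have bu: "ess_bounded ?l (u e)" using assms by (auto simp: W1inf_def Linf_iff)
  have "integral\<^sup>L ?M (\<lambda>y. (u e x)\<^sup>2) \<le> integral\<^sup>L ?M (\<lambda>y. 2 * (u e y * u e y) + 2 * ?l * B)"
  proof (rule integral_mono)
    show "integrable ?M (\<lambda>y. (u e x)\<^sup>2)" by (rule ess_bounded_integrable[OF ess_bounded_const])
    show "integrable ?M (\<lambda>y. 2 * (u e y * u e y) + 2 * ?l * B)"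
      by (intro ess_bounded_integrable ess_bounded_sum ess_bounded_mult ess_bounded_const bu)
    fix y assume "y \<in> space ?M"
    then have y: "y \<in> {0..?l}" by simp
    have "(u e x - u e y)\<^sup>2 \<le> \<bar>x - y\<bar> * inner_L2 G g g" using W1inf_increment_square[OF assms(1-3) y assms(4)] .
    also have "\<dots> \<le> ?l * B" using y assms(4,6) l by (intro mult_mono) (auto simp: inner_L2_nonneg)
    finally have "(u e x - u e y)\<^sup>2 \<le> ?l * B" .
    moreover have "(u e x)\<^sup>2 \<le> 2 * (u e y)\<^sup>2 + 2 * (u e x - u e y)\<^sup>2"
      using zero_le_power2[of "u e x - 2 * u e y"] by (simp add: power2_eq_square algebra_simps)
    ultimately show "(u e x)\<^sup>2 \<le> 2 * (u e y * u e y) + 2 * ?l * B" by (simp add: power2_eq_square)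
  qed
  also have "\<dots> = 2 * integral\<^sup>L ?M (\<lambda>y. u e y * u e y) + 2 * ?l * B * ?l"
    using ess_bounded_integrable[OF ess_bounded_mult[OF bu bu]] ess_bounded_integrable[OF ess_bounded_const[of ?l "2 * ?l * B"]] l
    by (simp add: measure_restrict_space)
  also have "integral\<^sup>L ?M (\<lambda>y. u e y * u e y) \<le> A"
    using edge_integral_le_inner_L2[OF fin assms(3), of u] assms(5) by simp
  finally have "(u e x)\<^sup>2 * ?l \<le> 2 * A + 2 * ?l * B * ?l" using l by (simp add: measure_restrict_space mult.commute)
  then show ?thesis using l by (simp add: field_simps)
qed

lemma W1inf_bounded_subsequence_edge:
  assumes G: "compact_metric_graph G" and V: "\<And>n::nat. W1inf G (V n) (D n)"
    and A: "\<And>n. inner_L2 G (V n) (V n) \<le> A" and B: "\<And>n. inner_L2 G (D n) (D n) \<le> B" and e: "e \<in> edges G"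
  obtains k U where "strict_mono k" "uniform_limit {0..len G e} (\<lambda>n. V (k n) e) U sequentially"
proof -
  let ?l = "len G e"
  have B0: "0 \<le> B" using inner_L2_nonneg[of G "D 0"] B[of 0] by linarith
  have bd: "norm (V n e x) \<le> sqrt (2 * A / ?l + 2 * ?l * B)" if "x \<in> {0..?l}" for n x
    using W1inf_pointwise_bound[OF G V e that A B] by (metis real_norm_def real_sqrt_abs real_sqrt_le_iff)
  have eq: "\<exists>d>0. \<forall>n y. y \<in> {0..?l} \<and> norm (x - y) < d \<longrightarrow> norm (V n e x - V n e y) < \<epsilon>"
    if x: "x \<in> {0..?l}" and \<epsilon>: "0 < \<epsilon>" for x \<epsilon>
  proof (intro exI[of _ "\<epsilon>\<^sup>2 / (B + 1)"] conjI allI impI)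
    show "0 < \<epsilon>\<^sup>2 / (B + 1)" using \<epsilon> B0 by simp
    fix n y assume y: "y \<in> {0..?l} \<and> norm (x - y) < \<epsilon>\<^sup>2 / (B + 1)"
    have "(V n e x - V n e y)\<^sup>2 \<le> \<bar>x - y\<bar> * inner_L2 G (D n) (D n)"
      using W1inf_increment_square[OF G V e, of y x] x y by blast
    also have "\<dots> \<le> \<bar>x - y\<bar> * (B + 1)" using B[of n] by (intro mult_left_mono) auto
    also have "\<dots> < \<epsilon>\<^sup>2" using y B0 by (simp add: field_simps)
    finally show "norm (V n e x - V n e y) < \<epsilon>" 
      using \<epsilon> power2_less_imp_less[of "\<bar>V n e x - V n e y\<bar>" \<epsilon>] by simp
  qed
  show ?thesis
  proof (rule Arzela_Ascoli[of "{0..?l}" "\<lambda>n. V n e", OF compact_Icc bd eq])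
    fix g and k :: "nat \<Rightarrow> nat"
    assume k: "strict_mono k"
      and gk: "\<And>\<epsilon>. 0 < \<epsilon> \<Longrightarrow> \<exists>N. \<forall>n x. n \<ge> N \<and> x \<in> {0..?l} \<longrightarrow> norm (V (k n) e x - g x) < \<epsilon>"
    have "uniform_limit {0..?l} (\<lambda>n. V (k n) e) g sequentially"
      unfolding uniform_limit_iff eventually_sequentially dist_norm using gk by meson
    then show ?thesis using that k by blast
  qed
qed

text \<open>
Subsequences are chosen edge by edge with the theorem of Arzela and Ascoli. The limit is extended by
zero off the graph, as members of eigenspaces are.
\<close>

lemma W1inf_compactness:
  assumes G: "compact_metric_graph G" and V: "\<And>n::nat. W1inf G (V n) (D n)"
    and A: "\<And>n. inner_L2 G (V n) (V n) \<le> A" and B: "\<And>n. inner_L2 G (D n) (D n) \<le> B"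
  obtains k U where "strict_mono k" "supported_on G U" "converges_uniformly G (\<lambda>n. V (k n)) U"
proof -
  have "finite (edges G)" using G by (simp add: compact_metric_graph_def)
  have "\<exists>k. strict_mono k \<and> (\<forall>e\<in>F. \<exists>U. uniform_limit {0..len G e} (\<lambda>n. V (k n) e) U sequentially)"
    if "F \<subseteq> edges G" for F
    using finite_subset[OF that \<open>finite (edges G)\<close>] that
  proof (induction F rule: finite_induct)
    case empty
    then show ?case by (intro exI[of _ id]) (simp add: strict_mono_def)
  next
    case (insert e F)
    then obtain k where k: "strict_mono k" "\<forall>e\<in>F. \<exists>U. uniform_limit {0..len G e} (\<lambda>n. V (k n) e) U sequentially" by auto
    obtain r U where r: "strict_mono r" "uniform_limit {0..len G e} (\<lambda>n. V (k (r n)) e) U sequentially"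
      using W1inf_bounded_subsequence_edge[OF G, of "\<lambda>n. V (k n)" "\<lambda>n. D (k n)" A B e] V A B insert.prems by auto
    define j where "j = (\<lambda>n. k (r n))"
    have "strict_mono j" using strict_mono_o[OF k(1) r(1)] by (simp add: j_def o_def)
    moreover have "\<exists>U. uniform_limit {0..len G e'} (\<lambda>n. V (j n) e') U sequentially" if e': "e' \<in> insert e F" for e'
    proof (cases "e' = e")
      case True
      then show ?thesis using r(2) by (auto simp: j_def)
    next
      case False
      then obtain U' where "uniform_limit {0..len G e'} (\<lambda>n. V (k n) e') U' sequentially" using k e' by blast
      from filterlim_compose[OF this filterlim_subseq[OF r(1)]] show ?thesis unfolding j_def by (rule exI[of _ U'])
    qed
    ultimately show ?case by (intro exI[of _ j] conjI ballI)
  qed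
  from this[OF order_refl] obtain k where k: "strict_mono k"
    "\<forall>e\<in>edges G. \<exists>U. uniform_limit {0..len G e} (\<lambda>n. V (k n) e) U sequentially" by blast
  from bchoice[OF k(2)] obtain U where U: "\<forall>e\<in>edges G. uniform_limit {0..len G e} (\<lambda>n. V (k n) e) (U e) sequentially" by blast
  define U' where "U' = (\<lambda>e x. if e \<in> edges G \<and> x \<in> {0..len G e} then U e x else 0)"
  have "supported_on G U'" by (auto simp: supported_on_def U'_def)
  moreover have "converges_uniformly G (\<lambda>n. V (k n)) U'"
    unfolding converges_uniformly_def
  proof
    fix e assume "e \<in> edges G"
    then show "uniform_limit {0..len G e} (\<lambda>n. V (k n) e) (U' e) sequentially"
      using U by (subst uniform_limit_cong'[where g="\<lambda>n. V (k n) e" and i="U e"]) (auto simp: U'_def)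
  qed
  ultimately show ?thesis using that k(1) by blast
qed

lemma inner_L2_self_uniform_limit:
  assumes "compact_metric_graph G" "\<And>n. W1inf G (V n) (D n)" "U \<in> Linf G" "\<And>e. e \<in> edges G \<Longrightarrow> continuous_on {0..len G e} (U e)"
    "converges_uniformly G V U"
  shows "(\<lambda>n. inner_L2 G (V n) (V n)) \<longlonglongrightarrow> inner_L2 G U U"
proof -
  have "converges_uniformly G (\<lambda>n e x. V n e x * V n e x) (\<lambda>e x. U e x * U e x)"
    unfolding converges_uniformly_def
  proof
    fix e assume e: "e \<in> edges G"
    have b: "bounded (U e ` {0..len G e})"
      by (intro compact_imp_bounded compact_continuous_image assms(4) e) auto
    show "uniform_limit {0..len G e} (\<lambda>n x. V n e x * V n e x) (\<lambda>x. U e x * U e x) sequentially"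
      using assms(5) e by (intro uniform_lim_mult b) (auto simp: converges_uniformly_def)
  qed
  then have "(\<lambda>n. inner_L2 G (\<lambda>e x. 1) (\<lambda>e x. V n e x * V n e x)) \<longlonglongrightarrow> inner_L2 G (\<lambda>e x. 1) (\<lambda>e x. U e x * U e x)"
    using assms(1-3) by (intro inner_L2_uniform_limit Linf_mult) (auto simp: W1inf_def Linf_iff ess_bounded_const)
  then show ?thesis by (simp add: inner_L2_def)
qed

section \<open>Constrained minimisers of the energy\<close>

lemma potential_form_bounded:
  assumes "compact_metric_graph G" "q \<in> Linf G"
  obtains K where "0 < K" "\<And>u. u \<in> Linf G \<Longrightarrow> \<bar>inner_L2 G (\<lambda>e x. q e x * u e x) u\<bar> \<le> K * inner_L2 G u u"
proof -
  have fin: "finite (edges G)" using assms(1) by (simp add: compact_metric_graph_def)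
  have "\<forall>e\<in>edges G. \<exists>B>0. AE x in lebesgue_on {0..len G e}. \<bar>q e x\<bar> \<le> B"
    using assms(2) ess_bounded_bound unfolding Linf_iff by metis
  from bchoice[OF this] obtain B where B: "\<And>e. e \<in> edges G \<Longrightarrow> 0 < B e"
    "\<And>e. e \<in> edges G \<Longrightarrow> AE x in lebesgue_on {0..len G e}. \<bar>q e x\<bar> \<le> B e" by blast
  define K where "K = 1 + sum B (edges G)"
  have BK: "B e \<le> K" if "e \<in> edges G" for e
  proof -
    have "B e \<le> sum B (edges G)" using B fin that by (intro member_le_sum) (auto intro: less_imp_le)
    then show ?thesis by (simp add: K_def)
  qed
  show ?thesis
  proof
    have "0 \<le> sum B (edges G)" using B by (intro sum_nonneg) (auto intro: less_imp_le)
    then show "0 < K" by (simp add: K_def)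
    fix u assume u: "u \<in> Linf G"
    have "\<bar>inner_L2 G (\<lambda>e x. q e x * u e x) u\<bar> \<le> (\<Sum>e\<in>edges G. \<bar>integral\<^sup>L (lebesgue_on {0..len G e}) (\<lambda>x. q e x * u e x * u e x)\<bar>)"
      unfolding inner_L2_def graph_integral_def edge_measure_def by (rule sum_abs)
    also have "\<dots> \<le> (\<Sum>e\<in>edges G. K * integral\<^sup>L (lebesgue_on {0..len G e}) (\<lambda>x. u e x * u e x))"
    proof (rule sum_mono)
      fix e assume e: "e \<in> edges G"
      let ?M = "lebesgue_on {0..len G e}"
      have bu: "ess_bounded (len G e) (u e)" and bq: "ess_bounded (len G e) (q e)" using u assms(2) e by (auto simp: Linf_iff)
      have i: "integrable ?M (\<lambda>x. q e x * u e x * u e x)" "integrable ?M (\<lambda>x. u e x * u e x)"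
        by (intro ess_bounded_integrable ess_bounded_mult bu bq)+
      have "\<bar>integral\<^sup>L ?M (\<lambda>x. q e x * u e x * u e x)\<bar> \<le> integral\<^sup>L ?M (\<lambda>x. \<bar>q e x * u e x * u e x\<bar>)"
        using integral_norm_bound[of ?M "\<lambda>x. q e x * u e x * u e x"] by simp
      also have "\<dots> \<le> integral\<^sup>L ?M (\<lambda>x. K * (u e x * u e x))"
      proof (rule integral_mono_AE)
        show "AE x in ?M. \<bar>q e x * u e x * u e x\<bar> \<le> K * (u e x * u e x)"
          using B(2)[OF e]
        proof eventually_elim
          case (elim x)
          have "\<bar>q e x * u e x * u e x\<bar> = \<bar>q e x\<bar> * (u e x * u e x)" by (simp add: abs_mult)
          also have "\<dots> \<le> K * (u e x * u e x)" using elim BK[OF e] by (intro mult_right_mono) auto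
          finally show ?case .
        qed
      qed (use i in auto)
      also have "\<dots> = K * integral\<^sup>L ?M (\<lambda>x. u e x * u e x)" by simp
      finally show "\<bar>integral\<^sup>L ?M (\<lambda>x. q e x * u e x * u e x)\<bar> \<le> K * integral\<^sup>L ?M (\<lambda>x. u e x * u e x)" .
    qed
    also have "\<dots> = K * inner_L2 G u u"
      by (simp add: inner_L2_def graph_integral_def edge_measure_def sum_distrib_left)
    finally show "\<bar>inner_L2 G (\<lambda>e x. q e x * u e x) u\<bar> \<le> K * inner_L2 G u u" .
  qed
qed

lemma nonneg_quadratic_discriminant:
  fixes A B C :: real
  assumes "\<And>s. 0 \<le> A + 2 * s * B + s\<^sup>2 * C" "0 \<le> C"
  shows "B\<^sup>2 \<le> A * C"
proof (cases "C = 0")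
  case True
  have "B = 0"
  proof (rule ccontr)
    assume "B \<noteq> 0"
    define s where "s = - (A + 1) / (2 * B)"
    have "s * B = - (A + 1) / 2" using \<open>B \<noteq> 0\<close> by (simp add: s_def)
    moreover have "0 \<le> A + 2 * (s * B)" using assms(1)[of s] True by (simp add: mult.assoc)
    ultimately show False by simp
  qed
  then show ?thesis using True by simp
next
  case False
  then have "C > 0" using assms(2) by simp
  then show ?thesis using assms(1)[of "- B / C"] by (simp add: field_simps power2_eq_square)
qed

definition shifted_form ::
    "('e, 'v) metric_graph \<Rightarrow> ('e \<Rightarrow> real \<Rightarrow> real) \<Rightarrow> real \<Rightarrow> ('e \<Rightarrow> real \<Rightarrow> real) \<Rightarrow> ('e \<Rightarrow> real \<Rightarrow> real) \<Rightarrow>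
     ('e \<Rightarrow> real \<Rightarrow> real) \<Rightarrow> ('e \<Rightarrow> real \<Rightarrow> real) \<Rightarrow> real" where
  "shifted_form G q \<mu> u g \<eta> h = energy G q u g \<eta> h - \<mu> * inner_L2 G u \<eta>"

lemma shifted_form_lincomb_square:
  assumes "q \<in> Linf G" "W1inf G u g" "W1inf G v k"
  shows "shifted_form G q \<mu> (lincomb c u d v) (lincomb c g d k) (lincomb c u d v) (lincomb c g d k)
           = c\<^sup>2 * shifted_form G q \<mu> u g u g + 2 * c * d * shifted_form G q \<mu> u g v k + d\<^sup>2 * shifted_form G q \<mu> v k v k"
  using energy_lincomb_square[OF assms, of c d] inner_L2_lincomb_square[OF W1inf_Linf(1)[OF assms(2)] W1inf_Linf(1)[OF assms(3)], of c d]
  by (simp add: shifted_form_def algebra_simps)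

lemma shifted_form_Cauchy_Schwarz:
  assumes "q \<in> Linf G" "W1inf G u g" "W1inf G \<eta> h"
    and "\<And>s. 0 \<le> shifted_form G q \<mu> (lincomb 1 u s \<eta>) (lincomb 1 g s h) (lincomb 1 u s \<eta>) (lincomb 1 g s h)"
    and "0 \<le> shifted_form G q \<mu> \<eta> h \<eta> h"
  shows "(shifted_form G q \<mu> u g \<eta> h)\<^sup>2 \<le> shifted_form G q \<mu> u g u g * shifted_form G q \<mu> \<eta> h \<eta> h"
proof (rule nonneg_quadratic_discriminant)
  fix s
  show "0 \<le> shifted_form G q \<mu> u g u g + 2 * s * shifted_form G q \<mu> u g \<eta> h + s\<^sup>2 * shifted_form G q \<mu> \<eta> h \<eta> h"
    using assms(4)[of s] shifted_form_lincomb_square[OF assms(1-3), of \<mu> 1 s] by simp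
qed (rule assms(5))

lemma tendsto_zero_of_squares:
  fixes a b :: "nat \<Rightarrow> real"
  assumes "\<And>n. (a n)\<^sup>2 \<le> b n * c" "b \<longlonglongrightarrow> 0"
  shows "a \<longlonglongrightarrow> 0"
proof -
  have "(\<lambda>n. sqrt (b n * c)) \<longlonglongrightarrow> sqrt (0 * c)" by (intro tendsto_intros assms(2))
  moreover have "norm (a n) \<le> sqrt (b n * c)" for n
    using real_sqrt_le_mono[OF assms(1)[of n]] by simp
  ultimately show ?thesis by (intro Lim_null_comparison[of a "\<lambda>n. sqrt (b n * c)"]) auto
qed

lemma eigenspace_supported: "u \<in> eigenspace G q \<mu> \<Longrightarrow> supported_on G u"
  by (simp add: eigenspace_def supported_on_def)

lemma zero_in_eigenspace:
  assumes "compact_metric_graph G" "q \<in> Linf G" shows "(\<lambda>e x. 0) \<in> eigenspace G q \<mu>"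
  by (rule eigenspaceI[OF assms, where v="\<lambda>e x. 0"])
    (auto simp: solves_on_edges_def primitive_on_def kirchhoff_def normal_derivative_def
      continuous_at_vertices_def supported_on_def intro!: sum.neutral)

lemma eigenspace_lincomb:
  assumes G: "compact_metric_graph G" and q: "q \<in> Linf G" and "u \<in> eigenspace G q \<mu>" "w \<in> eigenspace G q \<mu>"
  shows "lincomb c u d w \<in> eigenspace G q \<mu>"
proof -
  obtain u' where u: "solves_on_edges G q \<mu> u u'" "W1inf G u u'" "kirchhoff G u'" using eigenspaceD[OF G q assms(3)] .
  obtain w' where w: "solves_on_edges G q \<mu> w w'" "W1inf G w w'" "kirchhoff G w'" using eigenspaceD[OF G q assms(4)] .
  show ?thesis
  proof (rule eigenspaceI[OF G q, where v="lincomb c u' d w'"])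
    show "solves_on_edges G q \<mu> (lincomb c u d w) (lincomb c u' d w')"
      unfolding solves_on_edges_def
    proof (intro ballI conjI)
      fix e assume e: "e \<in> edges G"
      note eu = u(1)[unfolded solves_on_edges_def, rule_format, OF e] 
      note ew = w(1)[unfolded solves_on_edges_def, rule_format, OF e]
      show "continuous_on {0..len G e} (lincomb c u' d w' e)" unfolding lincomb_def
        using eu ew by (intro continuous_intros) auto
      have b: "ess_bounded (len G e) (\<lambda>x. (q e x - \<mu>) * u e x)" "ess_bounded (len G e) (\<lambda>x. (q e x - \<mu>) * w e x)"
        using Linf_shift_mult[OF q W1inf_Linf(1)[OF u(2)], of \<mu>] Linf_shift_mult[OF q W1inf_Linf(1)[OF w(2)], of \<mu>] e 
        by (auto simp: Linf_iff)
      have "primitive_on (len G e) (\<lambda>x. c * u' e x + d * w' e x) (\<lambda>x. c * ((q e x - \<mu>) * u e x) + d * ((q e x - \<mu>) * w e x))"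
        using eu ew by (intro primitive_on_lincomb b) auto
      then show "primitive_on (len G e) (lincomb c u' d w' e) (\<lambda>x. (q e x - \<mu>) * lincomb c u d w e x)"
        by (simp add: lincomb_def algebra_simps)
      fix x assume x: "x \<in> {0..len G e}"
      then show "(lincomb c u d w e has_real_derivative lincomb c u' d w' e x) (at x within {0..len G e})"
        using eu ew unfolding lincomb_def by (intro DERIV_add DERIV_cmult) auto
    qed
    have "normal_derivative G (lincomb c u' d w') x = c * normal_derivative G u' x + d * normal_derivative G w' x" for x
      by (simp add: normal_derivative_def lincomb_def)
    then show "kirchhoff G (lincomb c u' d w')" 
      using u(3) w(3) by (simp add: kirchhoff_def sum.distrib sum_distrib_left[symmetric])
    show "continuous_at_vertices G (lincomb c u d w)"
      using W1inf_lincomb[OF u(2) w(2)] by (simp add: W1inf_def)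
    show "supported_on G (lincomb c u d w)"
      using assms(3,4)[THEN eigenspace_supported] by (simp add: supported_on_def lincomb_def)
  qed
qed

text \<open>
The energy is minimised over the unit vectors orthogonal to \<open>\<phi>\<close>; taking \<open>\<phi> = 0\<close> there is no
constraint, and taking the normalised ground state gives the next eigenvalue.
Along a minimising sequence the form \<open>energy - \<mu> inner_L2\<close>, nonnegative on the orthogonal complement
of \<open>\<phi>\<close>, tends to zero, so by Cauchy-Schwarz it tends to zero against every test function orthogonal
to \<open>\<phi>\<close>. It vanishes against \<open>\<phi>\<close> itself since \<open>\<phi>\<close> is an eigenfunction. Hence the uniform limit of
a subsequence is an eigenfunction for \<open>\<mu>\<close>.
\<close>

lemma constrained_minimiser:
  assumes G: "compact_metric_graph G" and q: "q \<in> Linf G"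
    and \<phi>: "\<phi> \<in> eigenspace G q \<kappa>" "\<phi> = (\<lambda>e x. 0) \<or> inner_L2 G \<phi> \<phi> = 1"
    and ex: "W1inf G \<eta>0 h0" "inner_L2 G \<eta>0 \<phi> = 0" "inner_L2 G \<eta>0 \<eta>0 \<noteq> 0"
  obtains \<mu> u where "u \<in> eigenspace G q \<mu>" "inner_L2 G u u = 1" "inner_L2 G u \<phi> = 0"
    "\<And>\<eta> h. W1inf G \<eta> h \<Longrightarrow> inner_L2 G \<eta> \<phi> = 0 \<Longrightarrow> \<mu> * inner_L2 G \<eta> \<eta> \<le> energy G q \<eta> h \<eta> h"
proof -
  obtain \<phi>' where \<phi>': "solves_on_edges G q \<kappa> \<phi> \<phi>'" "W1inf G \<phi> \<phi>'" "kirchhoff G \<phi>'" using eigenspaceD[OF G q \<phi>(1)] .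
  have \<phi>L: "\<phi> \<in> Linf G" by (rule W1inf_Linf(1)[OF \<phi>'(2)])
  obtain K where K: "0 < K" "\<And>u. u \<in> Linf G \<Longrightarrow> \<bar>inner_L2 G (\<lambda>e x. q e x * u e x) u\<bar> \<le> K * inner_L2 G u u"
    using potential_form_bounded[OF G q] by blast
  have low: "inner_L2 G h h - K * inner_L2 G \<eta> \<eta> \<le> energy G q \<eta> h \<eta> h" if "W1inf G \<eta> h" for \<eta> h
    using K(2)[OF W1inf_Linf(1)[OF that]] by (simp add: energy_def abs_le_iff)
  define S where "S = {energy G q \<eta> h \<eta> h | \<eta> h. W1inf G \<eta> h \<and> inner_L2 G \<eta> \<phi> = 0 \<and> inner_L2 G \<eta> \<eta> = 1}"
  have normalise: "W1inf G (lincomb s \<eta> 0 \<eta>) (lincomb s h 0 h) \<and> inner_L2 G (lincomb s \<eta> 0 \<eta>) \<phi> = 0 \<and>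
     inner_L2 G (lincomb s \<eta> 0 \<eta>) (lincomb s \<eta> 0 \<eta>) = 1 \<and>
     energy G q (lincomb s \<eta> 0 \<eta>) (lincomb s h 0 h) (lincomb s \<eta> 0 \<eta>) (lincomb s h 0 h) = energy G q \<eta> h \<eta> h / inner_L2 G \<eta> \<eta>"
    if "W1inf G \<eta> h" "inner_L2 G \<eta> \<phi> = 0" "inner_L2 G \<eta> \<eta> \<noteq> 0" "s = 1 / sqrt (inner_L2 G \<eta> \<eta>)" for \<eta> h s
  proof -
    have L: "\<eta> \<in> Linf G" by (rule W1inf_Linf(1)[OF that(1)])
    have "s\<^sup>2 = 1 / inner_L2 G \<eta> \<eta>" using that(4) inner_L2_nonneg[of G \<eta>] by (simp add: power_divide)
    then show ?thesis using that L \<phi>L q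
      by (simp add: W1inf_lincomb inner_L2_lincomb_left[OF L L \<phi>L] inner_L2_lincomb_square energy_lincomb_square)
  qed
  have Sne: "S \<noteq> {}" unfolding S_def using normalise[OF ex refl] by blast
  have Sbd: "bdd_below S"
  proof (rule bdd_belowI)
    fix x assume "x \<in> S"
    then obtain \<eta> h where *: "x = energy G q \<eta> h \<eta> h" "W1inf G \<eta> h" "inner_L2 G \<eta> \<eta> = 1" by (auto simp: S_def)
    show "- K \<le> x" using low[OF *(2)] *(1,3) inner_L2_nonneg[of G h] by simp
  qed
  define \<mu> where "\<mu> = Inf S"
  have min: "\<mu> * inner_L2 G \<eta> \<eta> \<le> energy G q \<eta> h \<eta> h" if H: "W1inf G \<eta> h" "inner_L2 G \<eta> \<phi> = 0" for \<eta> h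
  proof (cases "inner_L2 G \<eta> \<eta> = 0")
    case True
    then show ?thesis using low[OF H(1)] inner_L2_nonneg[of G h] by simp
  next
    case False
    then have "energy G q \<eta> h \<eta> h / inner_L2 G \<eta> \<eta> \<in> S"
      unfolding S_def mem_Collect_eq
      by (intro exI[of _ "lincomb (1 / sqrt (inner_L2 G \<eta> \<eta>)) \<eta> 0 \<eta>"] exI[of _ "lincomb (1 / sqrt (inner_L2 G \<eta> \<eta>)) h 0 h"])
        (simp only: normalise[OF H False refl] simp_thms)
    then have "\<mu> \<le> energy G q \<eta> h \<eta> h / inner_L2 G \<eta> \<eta>" unfolding \<mu>_def by (rule cInf_lower[OF _ Sbd])
    then show ?thesis using False inner_L2_nonneg[of G \<eta>] by (simp add: le_divide_eq)
  qed
  have "\<exists>V D. W1inf G V D \<and> inner_L2 G V \<phi> = 0 \<and> inner_L2 G V V = 1 \<and> energy G q V D V D < \<mu> + 1 / real (Suc n)" for n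
  proof -
    have "Inf S < \<mu> + 1 / real (Suc n)" by (simp add: \<mu>_def)
    then obtain x where "x \<in> S" "x < \<mu> + 1 / real (Suc n)" using cInf_less_iff[OF Sne Sbd] by blast
    then show ?thesis by (auto simp: S_def)
  qed
  then have "\<forall>n. \<exists>V D. W1inf G V D \<and> inner_L2 G V \<phi> = 0 \<and> inner_L2 G V V = 1 \<and> energy G q V D V D < \<mu> + 1 / real (Suc n)"
    by blast
  then obtain V D where V: "\<And>n. W1inf G (V n) (D n)" "\<And>n. inner_L2 G (V n) \<phi> = 0" "\<And>n. inner_L2 G (V n) (V n) = 1"
    "\<And>n. energy G q (V n) (D n) (V n) (D n) < \<mu> + 1 / real (Suc n)" by metis
  have DB: "inner_L2 G (D n) (D n) \<le> \<mu> + 1 + K" for n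
  proof -
    have "1 / real (Suc n) \<le> 1" by simp
    then show ?thesis using low[OF V(1)[of n]] V(4)[of n] unfolding V(3) by linarith
  qed
  obtain k U where k: "strict_mono k" "supported_on G U" "converges_uniformly G (\<lambda>n. V (k n)) U"
    by (rule W1inf_compactness[OF G V(1) eq_refl[OF V(3)] DB]) (rule that)
  have form_nonneg: "0 \<le> shifted_form G q \<mu> \<eta> h \<eta> h" if "W1inf G \<eta> h" "inner_L2 G \<eta> \<phi> = 0" for \<eta> h
    using min[OF that] by (simp add: shifted_form_def)
  have V0: "(\<lambda>n. shifted_form G q \<mu> (V n) (D n) (V n) (D n)) \<longlonglongrightarrow> 0"
  proof (rule Lim_null_comparison)
    show "\<forall>\<^sub>F n in sequentially. norm (shifted_form G q \<mu> (V n) (D n) (V n) (D n)) \<le> 1 / real (Suc n)"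
    proof (intro always_eventually allI)
      fix n
      have "shifted_form G q \<mu> (V n) (D n) (V n) (D n) \<le> 1 / real (Suc n)"
        using V(4)[of n] unfolding shifted_form_def V(3) by linarith
      then show "norm (shifted_form G q \<mu> (V n) (D n) (V n) (D n)) \<le> 1 / real (Suc n)"
        unfolding real_norm_def abs_of_nonneg[OF form_nonneg[OF V(1)[of n] V(2)[of n]]] .
    qed
    show "(\<lambda>n. 1 / real (Suc n)) \<longlonglongrightarrow> 0" by (rule LIMSEQ_Suc[OF lim_1_over_n])
  qed
  have perp: "(\<lambda>n. shifted_form G q \<mu> (V n) (D n) \<eta> h) \<longlonglongrightarrow> 0" if H: "W1inf G \<eta> h" "inner_L2 G \<eta> \<phi> = 0" for \<eta> h
  proof (rule tendsto_zero_of_squares[OF _ V0])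
    fix n
    show "(shifted_form G q \<mu> (V n) (D n) \<eta> h)\<^sup>2 
       \<le> shifted_form G q \<mu> (V n) (D n) (V n) (D n) * shifted_form G q \<mu> \<eta> h \<eta> h"
    proof (rule shifted_form_Cauchy_Schwarz[OF q V(1) H(1) _ form_nonneg[OF H]], rule form_nonneg)
      show "W1inf G (lincomb 1 (V n) s \<eta>) (lincomb 1 (D n) s h)" for s by (rule W1inf_lincomb[OF V(1) H(1)])
      show "inner_L2 G (lincomb 1 (V n) s \<eta>) \<phi> = 0" for s
        using V(2) H(2) by (simp add: inner_L2_lincomb_left W1inf_Linf(1)[OF V(1)] W1inf_Linf(1)[OF H(1)] \<phi>L)
    qed
  qed
  have weak: "(\<lambda>n. energy G q (V n) (D n) \<eta> h - \<mu> * inner_L2 G (V n) \<eta>) \<longlonglongrightarrow> 0" if H: "W1inf G \<eta> h" for \<eta> h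
  proof -
    define c where "c = inner_L2 G \<eta> \<phi>"
    have LH: "\<eta> \<in> Linf G" by (rule W1inf_Linf(1)[OF H])
    have "inner_L2 G (lincomb 1 \<eta> (-c) \<phi>) \<phi> = 0"
      using \<phi>(2) by (auto simp: inner_L2_lincomb_left LH \<phi>L c_def) (simp add: inner_L2_def graph_integral_def)
    then have "(\<lambda>n. shifted_form G q \<mu> (V n) (D n) (lincomb 1 \<eta> (-c) \<phi>) (lincomb 1 h (-c) \<phi>')) \<longlonglongrightarrow> 0"
      by (rule perp[OF W1inf_lincomb[OF H \<phi>'(2)]])
    moreover have "shifted_form G q \<mu> (V n) (D n) (lincomb 1 \<eta> (-c) \<phi>) (lincomb 1 h (-c) \<phi>') 
        = energy G q (V n) (D n) \<eta> h - \<mu> * inner_L2 G (V n) \<eta>" for n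
    proof -
      have "energy G q (V n) (D n) \<phi> \<phi>' = 0"
        using weak_equation[OF G q \<phi>' V(1)[of n]] V(2)[of n] by (simp add: energy_commute inner_L2_commute[of G \<phi>])
      then show ?thesis 
        using V(2)[of n] by (simp add: shifted_form_def energy_lincomb_right[OF q H \<phi>'(2) V(1)] 
            inner_L2_lincomb_right[OF LH \<phi>L W1inf_Linf(1)[OF V(1)]])
    qed
    ultimately show ?thesis by simp
  qed
  have U: "U \<in> eigenspace G q \<mu>"
    by (rule weak_limit_in_eigenspace[OF G q V(1) k(3) k(2)]) (rule LIMSEQ_subseq_LIMSEQ[OF weak k(1), unfolded o_def])
  obtain U' where U': "W1inf G U U'" using eigenspaceD[OF G q U] by blast
  have UL: "U \<in> Linf G" by (rule W1inf_Linf(1)[OF U'])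
  have "(\<lambda>n. inner_L2 G (V (k n)) (V (k n))) \<longlonglongrightarrow> inner_L2 G U U"
    by (rule inner_L2_self_uniform_limit[OF G V(1) UL W1inf_continuous[OF U'] k(3)])
  then have 1: "inner_L2 G U U = 1" using V(3) by (simp add: LIMSEQ_const_iff)
  have "(\<lambda>n. inner_L2 G \<phi> (V (k n))) \<longlonglongrightarrow> inner_L2 G \<phi> U"
    by (rule inner_L2_uniform_limit[OF G \<phi>L W1inf_Linf(1)[OF V(1)] UL k(3)])
  then have 2: "inner_L2 G U \<phi> = 0" using V(2) by (simp add: LIMSEQ_const_iff inner_L2_commute[of G \<phi>])
  show ?thesis using that[OF U 1 2 min] .
qed

section \<open>Uniqueness for the initial value problem\<close>

text \<open>
With \<open>M\<close> the maximum of \<open>\<bar>u\<bar>\<close> within distance \<open>\<delta>\<close> of \<open>a\<close>, integrating twice gives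
\<open>M \<le> K \<delta>\<^sup>2 M\<close>.
\<close>

lemma ode_zero_local:
  fixes a l K \<delta> :: real
  assumes "primitive_on l u v" "continuous_on {0..l} v" "primitive_on l v (\<lambda>x. r x * u x)" "ess_bounded l r"
    and r: "AE x in lebesgue_on {0..l}. \<bar>r x\<bar> \<le> K" and "0 \<le> K" "0 < \<delta>" "K * \<delta>\<^sup>2 < 1"
    and a: "a \<in> {0..l}" "u a = 0" "v a = 0" and x: "x \<in> {0..l}" "\<bar>x - a\<bar> \<le> \<delta>"
  shows "u x = 0 \<and> v x = 0"
proof -
  let ?I = "{max 0 (a - \<delta>)..min l (a + \<delta>)}"
  have bv: "ess_bounded l v" by (rule ess_bounded_continuous[OF assms(2)])
  have cu: "continuous_on {0..l} u" by (rule primitive_on_continuous[OF assms(1) bv])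
  have bru: "ess_bounded l (\<lambda>x. r x * u x)" by (intro ess_bounded_mult assms(4) ess_bounded_continuous[OF cu])
  have "continuous_on ?I (\<lambda>x. \<bar>u x\<bar>)" by (intro continuous_intros continuous_on_subset[OF cu]) auto
  moreover have aI: "a \<in> ?I" using a \<open>0 < \<delta>\<close> by auto
  ultimately obtain y where y: "y \<in> ?I" "\<And>t. t \<in> ?I \<Longrightarrow> \<bar>u t\<bar> \<le> \<bar>u y\<bar>"
    using continuous_attains_sup[of ?I "\<lambda>x. \<bar>u x\<bar>"] by blast
  define M where "M = \<bar>u y\<bar>"
  have v: "\<bar>v t\<bar> \<le> K * M * \<bar>t - a\<bar>" if t: "t \<in> ?I" for t
  proof -
    have "\<bar>v t - v a\<bar> \<le> (K * M) * \<bar>t - a\<bar>"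
    proof (rule primitive_on_local_bound[OF assms(3) bru])
      show "AE s in lebesgue_on {0..l}. min a t \<le> s \<and> s \<le> max a t \<longrightarrow> \<bar>r s * u s\<bar> \<le> K * M"
        using r
      proof eventually_elim
        case (elim s)
        show ?case
        proof
          assume "min a t \<le> s \<and> s \<le> max a t"
          then have "s \<in> ?I" using t aI by auto
          then show "\<bar>r s * u s\<bar> \<le> K * M" unfolding abs_mult M_def
            using elim y(2) \<open>0 \<le> K\<close> by (intro mult_mono) auto
        qed
      qed
    qed (use a t in auto)
    then show ?thesis using a by simp
  qed
  have "\<bar>u y - u a\<bar> \<le> (K * M * \<delta>) * \<bar>y - a\<bar>"
  proof (rule primitive_on_local_bound[OF assms(1) bv])
    show "AE s in lebesgue_on {0..l}. min a y \<le> s \<and> s \<le> max a y \<longrightarrow> \<bar>v s\<bar> \<le> K * M * \<delta>"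
    proof (rule AE_I2, rule impI)
      fix s assume "min a y \<le> s \<and> s \<le> max a y"
      then have s: "s \<in> ?I" using y(1) aI by auto
      have "K * M * \<bar>s - a\<bar> \<le> K * M * \<delta>" using s \<open>0 \<le> K\<close> by (intro mult_left_mono) (auto simp: M_def)
      then show "\<bar>v s\<bar> \<le> K * M * \<delta>" using v[OF s] by linarith
    qed
  qed (use a y in auto)
  also have "\<dots> \<le> (K * M * \<delta>) * \<delta>" using y(1) \<open>0 \<le> K\<close> \<open>0 < \<delta>\<close> by (intro mult_left_mono) (auto simp: M_def)
  finally have "M \<le> K * \<delta>\<^sup>2 * M" using a by (simp add: M_def power2_eq_square algebra_simps)
  then have "(1 - K * \<delta>\<^sup>2) * M \<le> 0" by (simp add: algebra_simps)
  then have "M \<le> 0" using \<open>K * \<delta>\<^sup>2 < 1\<close> by (simp add: mult_le_0_iff)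
  moreover have xI: "x \<in> ?I" using x by (auto simp: abs_le_iff)
  ultimately have "u x = 0" "M = 0" using y(2)[OF xI] by (auto simp: M_def)
  then show ?thesis using v[OF xI] by simp
qed

text \<open>
The local step has a length \<open>\<delta>\<close> independent of the point, so finitely many steps reach every \<open>x\<close>.
\<close>

lemma ode_zero:
  assumes "primitive_on l u v" "continuous_on {0..l} v" "primitive_on l v (\<lambda>x. r x * u x)" "ess_bounded l r"
    and a: "a \<in> {0..l}" "u a = 0" "v a = 0" and x: "x \<in> {0..l}"
  shows "u x = 0"
proof -
  obtain K where K: "K > 0" "AE x in lebesgue_on {0..l}. \<bar>r x\<bar> \<le> K" using ess_bounded_bound[OF assms(4)] .
  define \<delta> where "\<delta> = 1 / (K + 1)"
  have \<delta>: "0 < \<delta>" using K by (simp add: \<delta>_def)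
  have "K < (K + 1)\<^sup>2" using K by (simp add: power2_eq_square algebra_simps add_strict_increasing)
  then have K\<delta>: "K * \<delta>\<^sup>2 < 1" using K by (simp add: \<delta>_def power_divide)
  have "\<forall>x\<in>{0..l}. \<bar>x - a\<bar> \<le> real n * \<delta> \<longrightarrow> u x = 0 \<and> v x = 0" for n
  proof (induction n)
    case 0
    then show ?case using a by auto
  next
    case (Suc n)
    show ?case
    proof (intro ballI impI)
      fix x assume x: "x \<in> {0..l}" "\<bar>x - a\<bar> \<le> real (Suc n) * \<delta>"
      \<comment> \<open>The point \<open>b\<close> divides the segment from \<open>a\<close> to \<open>x\<close> so that \<open>b\<close> is within \<open>n\<close> steps of \<open>a\<close> and one step of \<open>x\<close>.\<close>
      define t where "t = real n / real (Suc n)"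
      have t: "0 \<le> t" "t \<le> 1" "t * real (Suc n) = real n" by (simp_all add: t_def)
      define b where "b = a + t * (x - a)"
      have "b = (1 - t) * a + t * x" by (simp add: b_def algebra_simps)
      then have b: "b \<in> {0..l}" using convexD_alt[of "{0..l}" a x t] a(1) x(1) t by simp
      have "\<bar>b - a\<bar> = t * \<bar>x - a\<bar>" using t by (simp add: b_def abs_mult)
      also have "\<dots> \<le> t * (real (Suc n) * \<delta>)" using x t by (intro mult_left_mono) auto
      also have "\<dots> = real n * \<delta>" using t(3) by (metis mult.assoc)
      finally have uvb: "u b = 0 \<and> v b = 0" using Suc b by blast
      have "x - b = (1 - t) * (x - a)" by (simp add: b_def algebra_simps)
      then have "\<bar>x - b\<bar> = (1 - t) * \<bar>x - a\<bar>" using t by (simp add: abs_mult)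
      also have "\<dots> \<le> (1 - t) * (real (Suc n) * \<delta>)" using x t by (intro mult_left_mono) auto
      also have "\<dots> = \<delta>" by (simp add: t_def field_simps)
      finally have "\<bar>x - b\<bar> \<le> \<delta>" .
      then show "u x = 0 \<and> v x = 0"
        using ode_zero_local[OF assms(1-4) K(2) _ \<delta> K\<delta> b _ _ x(1)] uvb K(1) by simp
    qed
  qed
  moreover obtain n where "\<bar>x - a\<bar> / \<delta> \<le> real n" using real_arch_simple by blast
  then have "\<bar>x - a\<bar> \<le> real n * \<delta>" using \<delta> by (simp add: pos_divide_le_eq)
  ultimately show ?thesis using x by blast
qed

lemma solves_on_edges_zero:
  assumes "q \<in> Linf G" "solves_on_edges G q \<mu> u v" "e \<in> edges G" 
    and "a \<in> {0..len G e}" "u e a = 0" "v e a = 0" "x \<in> {0..len G e}"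
  shows "u e x = 0"
proof (rule ode_zero[where a=a and r="\<lambda>x. q e x - \<mu>" and u="u e" and v="v e" and x=x and l="len G e"])
  note s = assms(2)[unfolded solves_on_edges_def, rule_format, OF assms(3)]
  show "primitive_on (len G e) (u e) (v e)" using s by (intro primitive_on_C1) auto
  show "continuous_on {0..len G e} (v e)" "primitive_on (len G e) (v e) (\<lambda>x. (q e x - \<mu>) * u e x)" using s by auto
  have "ess_bounded (len G e) (\<lambda>x. q e x + (- \<mu>))"
    using assms(1,3) by (intro ess_bounded_sum ess_bounded_const) (simp add: Linf_iff)
  then show "ess_bounded (len G e) (\<lambda>x. q e x - \<mu>)" by simp
qed (use assms in auto)

section \<open>Simplicity of the ground state\<close>

lemma inner_L2_mono_abs:
  assumes "f \<in> Linf G" "g \<in> Linf G"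
    and "\<And>e x. e \<in> edges G \<Longrightarrow> x \<in> {0..len G e} \<Longrightarrow> (f e x)\<^sup>2 \<le> (g e x)\<^sup>2"
  shows "inner_L2 G f f \<le> inner_L2 G g g"
  unfolding inner_L2_def graph_integral_def edge_measure_def
proof (rule sum_mono)
  fix e assume e: "e \<in> edges G"
  show "integral\<^sup>L (lebesgue_on {0..len G e}) (\<lambda>x. f e x * f e x) \<le> integral\<^sup>L (lebesgue_on {0..len G e}) (\<lambda>x. g e x * g e x)"
  proof (rule integral_mono)
    show "f e x * f e x \<le> g e x * g e x" if "x \<in> space (lebesgue_on {0..len G e})" for x
      using assms(3)[OF e] that by (simp add: power2_eq_square)
  qed (use assms(1,2) e in \<open>auto simp: Linf_iff intro!: ess_bounded_integrable ess_bounded_mult\<close>)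
qed

text \<open>
The function \<open>sqrt (u\<^sup>2 + \<epsilon>)\<close> is a continuously differentiable substitute for \<open>\<bar>u\<bar>\<close>.
\<close>

lemma smoothed_abs_W1inf:
  assumes "compact_metric_graph G" "solves_on_edges G q \<mu> u v" "W1inf G u v" "0 < \<epsilon>"
  shows "W1inf G (\<lambda>e x. sqrt ((u e x)\<^sup>2 + \<epsilon>)) (\<lambda>e x. u e x * v e x / sqrt ((u e x)\<^sup>2 + \<epsilon>))"
proof (rule W1infI)
  fix e assume e: "e \<in> edges G"
  note s = assms(2)[unfolded solves_on_edges_def, rule_format, OF e]
  have pos: "0 < (u e x)\<^sup>2 + \<epsilon>" for x using assms(4) by (simp add: add_nonneg_pos)
  then have ne: "(u e x)\<^sup>2 + \<epsilon> \<noteq> 0" for x by (metis less_irrefl)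
  have c: "continuous_on {0..len G e} (\<lambda>x. u e x * v e x / sqrt ((u e x)\<^sup>2 + \<epsilon>))"
    using ne s W1inf_continuous[OF assms(3) e] by (intro continuous_intros) auto
  show "ess_bounded (len G e) (\<lambda>x. u e x * v e x / sqrt ((u e x)\<^sup>2 + \<epsilon>))" by (rule ess_bounded_continuous[OF c])
  show "primitive_on (len G e) (\<lambda>x. sqrt ((u e x)\<^sup>2 + \<epsilon>)) (\<lambda>x. u e x * v e x / sqrt ((u e x)\<^sup>2 + \<epsilon>))"
  proof (rule primitive_on_C1[OF _ c])
    fix x assume x: "x \<in> {0..len G e}"
    have d: "(u e has_real_derivative v e x) (at x within {0..len G e})" using s x by blast
    show "((\<lambda>x. sqrt ((u e x)\<^sup>2 + \<epsilon>)) has_real_derivative u e x * v e x / sqrt ((u e x)\<^sup>2 + \<epsilon>)) (at x within {0..len G e})"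
    proof -
      have "((\<lambda>x. (u e x)\<^sup>2 + \<epsilon>) has_real_derivative 2 * u e x * v e x) (at x within {0..len G e})"
        by (auto intro!: derivative_eq_intros d)
      from DERIV_chain2[OF DERIV_real_sqrt[OF pos] this] show ?thesis by (simp add: field_simps)
    qed
  qed
next
  show "continuous_at_vertices G (\<lambda>e x. sqrt ((u e x)\<^sup>2 + \<epsilon>))"
    using assms(3) unfolding W1inf_def continuous_at_vertices_def by metis
qed

text \<open>
The functions \<open>V n = sqrt (u\<^sup>2 + \<epsilon> n)\<close> have derivatives bounded by that of \<open>u\<close>, so their shifted
energy exceeds that of \<open>u\<close>, which is zero, by at most a multiple of \<open>\<epsilon> n\<close>. They thus form a
minimising sequence, and their uniform limit \<open>\<bar>u\<bar>\<close> is an eigenfunction.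
\<close>

lemma abs_ground_state:
  assumes G: "compact_metric_graph G" and q: "q \<in> Linf G" and u: "u \<in> eigenspace G q \<mu>"
    and min: "\<And>\<eta> h. W1inf G \<eta> h \<Longrightarrow> \<mu> * inner_L2 G \<eta> \<eta> \<le> energy G q \<eta> h \<eta> h"
  shows "(\<lambda>e x. \<bar>u e x\<bar>) \<in> eigenspace G q \<mu>"
proof -
  obtain v where v: "solves_on_edges G q \<mu> u v" "W1inf G u v" "kirchhoff G v" using eigenspaceD[OF G q u] .
  have uL: "u \<in> Linf G" "v \<in> Linf G" using W1inf_Linf[OF v(2)] by auto
  define \<epsilon> where "\<epsilon> = (\<lambda>n. 1 / (real (Suc n))\<^sup>2)"
  have \<epsilon>: "0 < \<epsilon> n" for n by (simp add: \<epsilon>_def)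
  define V where "V = (\<lambda>n e x. sqrt ((u e x)\<^sup>2 + \<epsilon> n))"
  define D where "D = (\<lambda>n e x. u e x * v e x / sqrt ((u e x)\<^sup>2 + \<epsilon> n))"
  have H: "W1inf G (V n) (D n)" for n unfolding V_def D_def by (rule smoothed_abs_W1inf[OF G v(1,2) \<epsilon>])
  have nn: "0 \<le> shifted_form G q \<mu> \<eta> h \<eta> h" if "W1inf G \<eta> h" for \<eta> h
    using min[OF that] by (simp add: shifted_form_def)
  define C where "C = \<bar>inner_L2 G (\<lambda>e x. q e x - \<mu>) (\<lambda>e x. 1)\<bar>"
  have "shifted_form G q \<mu> (V n) (D n) (V n) (D n) \<le> \<epsilon> n * C" for n
  proof -
    have L: "V n \<in> Linf G" "D n \<in> Linf G" "(\<lambda>e x. 1) \<in> Linf G" using W1inf_Linf[OF H[of n]] by (auto simp: Linf_iff ess_bounded_const)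
    have qL: "(\<lambda>e x. q e x - \<mu>) \<in> Linf G" using Linf_shift_mult[OF q L(3), of \<mu>] by simp
    have "inner_L2 G (D n) (D n) \<le> inner_L2 G v v"
    proof (rule inner_L2_mono_abs[OF L(2) uL(2)])
      fix e x
      have "(u e x)\<^sup>2 * (v e x)\<^sup>2 \<le> (v e x)\<^sup>2 * ((u e x)\<^sup>2 + \<epsilon> n)"
        using \<epsilon>[of n] by (simp add: distrib_left mult.commute)
      moreover have "0 < (u e x)\<^sup>2 + \<epsilon> n" using \<epsilon>[of n] by (simp add: add_nonneg_pos)
      ultimately show "(D n e x)\<^sup>2 \<le> (v e x)\<^sup>2"
        by (simp add: D_def power_divide power_mult_distrib pos_divide_le_eq)
    qed
    moreover have "inner_L2 G (\<lambda>e x. (q e x - \<mu>) * V n e x) (V n)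
      = inner_L2 G (\<lambda>e x. (q e x - \<mu>) * u e x) u + \<epsilon> n * inner_L2 G (\<lambda>e x. q e x - \<mu>) (\<lambda>e x. 1)"
    proof -
      have "V n e x * V n e x = u e x * u e x + \<epsilon> n" for e x
        using \<epsilon>[of n] by (simp add: V_def power2_eq_square)
      then have "(\<lambda>e x. (q e x - \<mu>) * V n e x * V n e x) = (\<lambda>e x. (q e x - \<mu>) * lincomb 1 (\<lambda>e x. u e x * u e x) (\<epsilon> n) (\<lambda>e x. 1) e x)"
        by (simp add: lincomb_def mult.assoc)
      then have "inner_L2 G (\<lambda>e x. (q e x - \<mu>) * V n e x) (V n) 
        = inner_L2 G (\<lambda>e x. q e x - \<mu>) (lincomb 1 (\<lambda>e x. u e x * u e x) (\<epsilon> n) (\<lambda>e x. 1))"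
        by (simp add: inner_L2_def)
      also have "\<dots> = inner_L2 G (\<lambda>e x. q e x - \<mu>) (\<lambda>e x. u e x * u e x) + \<epsilon> n * inner_L2 G (\<lambda>e x. q e x - \<mu>) (\<lambda>e x. 1)"
        using inner_L2_lincomb_right[OF Linf_mult[OF uL(1) uL(1)] L(3) qL, of 1 "\<epsilon> n"] by simp
      finally show ?thesis by (simp add: inner_L2_def mult.assoc)
    qed
    moreover have "energy G q u v u v = \<mu> * inner_L2 G u u" by (rule weak_equation[OF G q v v(2)])
    moreover have "\<epsilon> n * inner_L2 G (\<lambda>e x. q e x - \<mu>) (\<lambda>e x. 1) \<le> \<epsilon> n * C"
      unfolding C_def using \<epsilon>[of n] by (intro mult_left_mono) auto
    ultimately show ?thesis
      by (simp add: shifted_form_def energy_def inner_L2_shifted_potential q uL L)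
  qed
  then have bd: "norm (shifted_form G q \<mu> (V n) (D n) (V n) (D n)) \<le> \<epsilon> n * C" for n
    using nn[OF H[of n]] by simp
  have \<epsilon>0: "\<epsilon> \<longlonglongrightarrow> 0"
  proof -
    have "(\<lambda>n. (1 / real (Suc n))\<^sup>2) \<longlonglongrightarrow> 0\<^sup>2" by (intro tendsto_power LIMSEQ_Suc[OF lim_1_over_n])
    then show ?thesis by (simp add: \<epsilon>_def power_divide)
  qed
  have form0: "(\<lambda>n. shifted_form G q \<mu> (V n) (D n) (V n) (D n)) \<longlonglongrightarrow> 0"
    by (rule Lim_null_comparison[OF always_eventually[OF allI[OF bd]]]) (use tendsto_mult_left_zero[OF \<epsilon>0] in simp)
  have "converges_uniformly G V (\<lambda>e x. \<bar>u e x\<bar>)" unfolding converges_uniformly_def uniform_limit_iff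
  proof (intro ballI allI impI)
    fix e and r :: real assume r: "0 < r"
    have "(\<lambda>n. 1 / real (Suc n)) \<longlonglongrightarrow> 0" by (rule LIMSEQ_Suc[OF lim_1_over_n])
    then have "\<forall>\<^sub>F n in sequentially. 1 / real (Suc n) < r" by (rule order_tendstoD(2)[OF _ r])
    then show "\<forall>\<^sub>F n in sequentially. \<forall>x\<in>{0..len G e}. dist (V n e x) \<bar>u e x\<bar> < r"
    proof eventually_elim
      case (elim n)
      have "dist (V n e x) \<bar>u e x\<bar> \<le> 1 / real (Suc n)" for x
      proof -
        have "\<bar>u e x\<bar> \<le> V n e x" unfolding V_def by (rule real_le_rsqrt) (use \<epsilon>[of n] in simp)
        moreover have "V n e x \<le> \<bar>u e x\<bar> + 1 / real (Suc n)" unfolding V_def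
          by (rule real_le_lsqrt) (simp_all add: \<epsilon>_def power2_sum power_divide)
        ultimately show ?thesis by (simp add: dist_real_def)
      qed
      then show ?case using elim by (meson le_less_trans)
    qed
  qed
  moreover have "supported_on G (\<lambda>e x. \<bar>u e x\<bar>)" using eigenspace_supported[OF u] by (simp add: supported_on_def)
  moreover have "(\<lambda>n. energy G q (V n) (D n) \<eta> h - \<mu> * inner_L2 G (V n) \<eta>) \<longlonglongrightarrow> 0" if Hh: "W1inf G \<eta> h" for \<eta> h
    unfolding shifted_form_def[symmetric]
    by (rule tendsto_zero_of_squares[OF shifted_form_Cauchy_Schwarz[OF q H Hh nn nn] form0]) 
      (rule W1inf_lincomb[OF H Hh], rule Hh)
  ultimately show ?thesis by (intro weak_limit_in_eigenspace[OF G q H])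
qed

lemma nonneg_derivative_left_end:
  fixes p :: "real \<Rightarrow> real"
  assumes "0 < l" "(p has_real_derivative D) (at 0 within {0..l})" "p 0 = 0" "\<And>x. x \<in> {0..l} \<Longrightarrow> 0 \<le> p x"
  shows "0 \<le> D"
proof (rule tendsto_lowerbound)
  show "((\<lambda>y. (p y - p 0) / (y - 0)) \<longlongrightarrow> D) (at 0 within {0..l})"
    using assms(2) by (simp add: has_field_derivative_iff)
  show "\<forall>\<^sub>F y in at 0 within {0..l}. 0 \<le> (p y - p 0) / (y - 0)"
    unfolding eventually_at using assms by (intro exI[of _ 1]) auto
  show "at 0 within {0..l} \<noteq> bot" using assms(1) by (simp add: at_within_Icc_at_right)
qed

lemma nonpos_derivative_right_end:
  fixes p :: "real \<Rightarrow> real"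
  assumes "0 < l" "(p has_real_derivative D) (at l within {0..l})" "p l = 0" "\<And>x. x \<in> {0..l} \<Longrightarrow> 0 \<le> p x"
  shows "D \<le> 0"
proof (rule tendsto_upperbound)
  show "((\<lambda>y. (p y - p l) / (y - l)) \<longlongrightarrow> D) (at l within {0..l})"
    using assms(2) by (simp add: has_field_derivative_iff)
  show "\<forall>\<^sub>F y in at l within {0..l}. (p y - p l) / (y - l) \<le> 0"
    unfolding eventually_at using assms by (intro exI[of _ 1]) (auto intro!: divide_nonneg_nonpos)
  show "at l within {0..l} \<noteq> bot" using assms(1) by (simp add: at_within_Icc_at_left)
qed

text \<open>
At a zero of a nonnegative function all derivatives into the incident edges are nonnegative; their
sum is zero, so each of them is, and the initial value problem on each edge has only the zero
solution.
\<close>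

lemma nonneg_eigenfunction_zero_at_vertex:
  assumes G: "compact_metric_graph G" and q: "q \<in> Linf G" and p: "p \<in> eigenspace G q \<mu>"
    and nonneg: "\<And>e x. 0 \<le> p e x" and z: "z \<in> vertices G"
    and zero: "\<And>d. d \<in> ends G \<Longrightarrow> vert G d = z \<Longrightarrow> p (fst d) (end_pos G d) = 0"
    and d: "d \<in> ends G" "vert G d = z" and x: "x \<in> {0..len G (fst d)}"
  shows "p (fst d) x = 0"
proof -
  obtain v where v: "solves_on_edges G q \<mu> p v" "W1inf G p v" "kirchhoff G v" using eigenspaceD[OF G q p] .
  have fin: "finite (ends G)" using G by (simp add: compact_metric_graph_def ends_def)
  have nd: "0 \<le> normal_derivative G v d" if d: "d \<in> ends G" "vert G d = z" for d
  proof -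
    obtain e b where eb: "d = (e, b)" by (cases d)
    have e: "e \<in> edges G" using d eb by (auto simp: ends_def)
    then have l: "0 < len G e" using G by (simp add: compact_metric_graph_def)
    have dv: "(p e has_real_derivative v e x) (at x within {0..len G e})" if "x \<in> {0..len G e}" for x
      using v(1) e that by (simp add: solves_on_edges_def)
    show ?thesis
    proof (cases b)
      case True
      then show ?thesis using nonpos_derivative_right_end[OF l dv _ nonneg] zero[OF d] l eb
        by (simp add: normal_derivative_def end_pos_def)
    next
      case False
      then show ?thesis using nonneg_derivative_left_end[OF l dv _ nonneg] zero[OF d] l eb
        by (simp add: normal_derivative_def end_pos_def)
    qed
  qed
  have "(\<Sum>d | d \<in> ends G \<and> vert G d = z. normal_derivative G v d) = 0"
    using v(3) z by (simp add: kirchhoff_def)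
  then have "\<forall>d\<in>{d. d \<in> ends G \<and> vert G d = z}. normal_derivative G v d = 0"
    using fin nd by (subst (asm) sum_nonneg_eq_0_iff) auto
  then have "normal_derivative G v d = 0" using d by blast
  then have "v (fst d) (end_pos G d) = 0" by (simp add: normal_derivative_def split: if_splits)
  moreover have "end_pos G d \<in> {0..len G (fst d)}" "fst d \<in> edges G"
    using d(1) G by (auto simp: ends_def end_pos_def compact_metric_graph_def less_imp_le)
  ultimately show ?thesis using solves_on_edges_zero[OF q v(1)] zero[OF d] x by blast
qed

text \<open>
Zeros at a vertex spread over the incident edges to the neighbouring vertices.
\<close>

lemma nonneg_eigenfunction_zero:
  assumes G: "compact_metric_graph G" "connected_graph G" and q: "q \<in> Linf G" and p: "p \<in> eigenspace G q \<mu>"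
    and nonneg: "\<And>e x. 0 \<le> p e x" and d0: "d0 \<in> ends G" "p (fst d0) (end_pos G d0) = 0"
  shows "p = (\<lambda>e x. 0)"
proof -
  obtain v where v: "W1inf G p v" using eigenspaceD[OF G(1) q p] .
  then have cont: "continuous_at_vertices G p" by (simp add: W1inf_def)
  define van where "van = (\<lambda>z. \<forall>d\<in>ends G. vert G d = z \<longrightarrow> p (fst d) (end_pos G d) = 0)"
  have vanI: "van (vert G d)" if "d \<in> ends G" "p (fst d) (end_pos G d) = 0" for d
    unfolding van_def using cont that unfolding continuous_at_vertices_def by metis
  have edge: "p (fst d) x = 0" if "d \<in> ends G" "van (vert G d)" "x \<in> {0..len G (fst d)}" for d x
  proof (rule nonneg_eigenfunction_zero_at_vertex[OF G(1) q p nonneg _ _ that(1) refl that(3)])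
    show "vert G d \<in> vertices G" using that(1) by (simp add: vertices_def)
    show "p (fst d') (end_pos G d') = 0" if "d' \<in> ends G" "vert G d' = vert G d" for d'
      using \<open>van (vert G d)\<close> that unfolding van_def by blast
  qed
  have step: "van y" if "(x, y) \<in> adjacency G" "van x" for x y
  proof -
    obtain e a b where e: "e \<in> edges G" "x = vert G (e, a)" "y = vert G (e, b)" using \<open>(x, y) \<in> _\<close> by (auto simp: adjacency_def)
    have "0 \<le> len G e" using G e by (auto simp: compact_metric_graph_def less_imp_le)
    then have "p e (end_pos G (e, b)) = 0"
      using edge[of "(e, a)" "end_pos G (e, b)"] e that by (auto simp: ends_def end_pos_def)
    then show ?thesis using vanI[of "(e, b)"] e by (simp add: ends_def)
  qed
  have "van y" if "(vert G d0, y) \<in> (adjacency G)\<^sup>*" for y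
    using that by (induction rule: rtrancl_induct) (use vanI[OF d0] step in auto)
  then have "van (vert G d)" if "d \<in> ends G" for d
    using G(2) d0(1) that by (simp add: connected_graph_def vertices_def)
  then have "p e x = 0" if "e \<in> edges G" "x \<in> {0..len G e}" for e x
    using edge[of "(e, False)" x] that by (simp add: ends_def)
  then show ?thesis using eigenspace_supported[OF p] by (auto simp: supported_on_def fun_eq_iff)
qed

text \<open>
By the previous lemma, applied to the modulus, a ground state that vanishes at a vertex is zero.
This is used for the combination of \<open>u\<close> and \<open>w\<close> that vanishes at a chosen vertex.
\<close>

lemma ground_state_simple:
  assumes G: "compact_metric_graph G" "connected_graph G" and q: "q \<in> Linf G" 
    and min: "\<And>\<eta> h. W1inf G \<eta> h \<Longrightarrow> \<mu> * inner_L2 G \<eta> \<eta> \<le> energy G q \<eta> h \<eta> h"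
    and u: "u \<in> eigenspace G q \<mu>" "u \<noteq> (\<lambda>e x. 0)" and w: "w \<in> eigenspace G q \<mu>"
  obtains c where "w = lincomb c u 0 u"
proof -
  have zero: "\<phi> = (\<lambda>e x. 0)" if "\<phi> \<in> eigenspace G q \<mu>" "d \<in> ends G" "\<phi> (fst d) (end_pos G d) = 0" for \<phi> d
    using nonneg_eigenfunction_zero[OF G q abs_ground_state[OF G(1) q that(1) min] _ that(2)] that(3)
    by (simp add: fun_eq_iff)
  obtain e x where "u e x \<noteq> 0" using u(2) by (auto simp: fun_eq_iff)
  then have "e \<in> edges G" using eigenspace_supported[OF u(1)] by (auto simp: supported_on_def)
  then have d: "(e, False) \<in> ends G" by (simp add: ends_def)
  define a b where "a = u e 0" and "b = w e 0"
  have "a \<noteq> 0" using zero[OF u(1) d] u(2) by (auto simp: a_def end_pos_def)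
  have "lincomb 1 w (- (b / a)) u = (\<lambda>e x. 0)"
    using \<open>a \<noteq> 0\<close> by (intro zero[OF eigenspace_lincomb[OF G(1) q w u(1)] d]) (simp add: lincomb_def end_pos_def a_def b_def)
  then have "w = lincomb (b / a) u 0 u" by (auto simp: lincomb_def fun_eq_iff)
  then show ?thesis by (rule that)
qed

section \<open>Multiplicities and the two lowest eigenvalues\<close>

interpretation edge_fun: vector_space scale_fun by (rule vector_space_scale_fun)

lemma zero_function: "(0 :: 'e \<Rightarrow> real \<Rightarrow> real) = (\<lambda>e x. 0)" by (simp add: fun_eq_iff)

text \<open>
Induction on \<open>I\<close>: the kernel of one functional has codimension at most one.
The functionals need to be linear on \<open>V\<close> only; this matters for derivatives at a point.
\<close>

lemma finite_dimensional_of_functionals: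
  fixes f :: "'i \<Rightarrow> ('e \<Rightarrow> real \<Rightarrow> real) \<Rightarrow> real"
  assumes "finite I"
    and "\<And>u w c d. u \<in> V \<Longrightarrow> w \<in> V \<Longrightarrow> lincomb c u d w \<in> V"
    and "\<And>i u w c d. i \<in> I \<Longrightarrow> u \<in> V \<Longrightarrow> w \<in> V \<Longrightarrow> f i (lincomb c u d w) = c * f i u + d * f i w"
    and "\<And>u. u \<in> V \<Longrightarrow> (\<And>i. i \<in> I \<Longrightarrow> f i u = 0) \<Longrightarrow> u = 0"
  shows "\<exists>B. finite B \<and> V \<subseteq> edge_fun.span B"
  using assms
proof (induction I arbitrary: V rule: finite_induct)
  case empty
  then have "V \<subseteq> edge_fun.span {}" unfolding edge_fun.span_empty by blast
  then show ?case by blast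
next
  case (insert i I)
  define V0 where "V0 = {u\<in>V. f i u = 0}"
  have "\<exists>B. finite B \<and> V0 \<subseteq> edge_fun.span B"
  proof (rule insert.IH)
    show "lincomb c u d w \<in> V0" if "u \<in> V0" "w \<in> V0" for u w c d
      using that insert.prems(1) by (auto simp: V0_def insert.prems(2))
    show "f j (lincomb c u d w) = c * f j u + d * f j w" if "j \<in> I" "u \<in> V0" "w \<in> V0" for j u w c d
      using that by (intro insert.prems(2)) (auto simp: V0_def)
    show "u = 0" if "u \<in> V0" "\<And>j. j \<in> I \<Longrightarrow> f j u = 0" for u
      using that by (intro insert.prems(3)) (auto simp: V0_def)
  qed
  then obtain B where B: "finite B" "V0 \<subseteq> edge_fun.span B" by blast
  show ?case
  proof (cases "\<exists>u0\<in>V. f i u0 \<noteq> 0")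
    case False
    then have "V \<subseteq> V0" by (auto simp: V0_def)
    then show ?thesis using B by blast
  next
    case True
    then obtain u0 where u0: "u0 \<in> V" "f i u0 \<noteq> 0" by blast
    have "u \<in> edge_fun.span (insert u0 B)" if u: "u \<in> V" for u
    proof -
      define c where "c = f i u / f i u0"
      have "f i (lincomb 1 u (-c) u0) = 0" using u u0 by (simp add: insert.prems(2) c_def)
      then have "lincomb 1 u (-c) u0 \<in> edge_fun.span B"
        using B(2) insert.prems(1)[OF u u0(1)] by (auto simp: V0_def)
      then have "lincomb 1 u (-c) u0 \<in> edge_fun.span (insert u0 B)"
        using edge_fun.span_mono[of B "insert u0 B"] by blast
      moreover have "u = lincomb 1 u (-c) u0 + scale_fun c u0"
        by (simp add: lincomb_def scale_fun_def fun_eq_iff)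
      moreover have "scale_fun c u0 \<in> edge_fun.span (insert u0 B)"
        by (intro edge_fun.span_scale edge_fun.span_base) simp
      ultimately show ?thesis by (metis edge_fun.span_add)
    qed
    then show ?thesis using B(1) by (intro exI[of _ "insert u0 B"]) auto
  qed
qed

lemma one_le_dim:
  assumes "finite B" "V \<subseteq> edge_fun.span B" "u \<in> V" "u \<noteq> 0"
  shows "1 \<le> edge_fun.dim V"
proof -
  obtain A where A: "A \<subseteq> V" "edge_fun.independent A" "V \<subseteq> edge_fun.span A" "card A = edge_fun.dim V"
    using edge_fun.basis_exists by blast
  have "finite A" using edge_fun.independent_span_bound[OF assms(1) A(2)] A(1) assms(2) by blast
  moreover have "A \<noteq> {}" using A(3) assms(3,4) by auto
  ultimately show ?thesis using A(4) card_gt_0_iff[of A] by linarith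
qed

text \<open>
An infinite-dimensional space would have \<open>dim = 0\<close>, so the content is that eigenspaces are
finite-dimensional: an eigenfunction is determined by its values and slopes at the left ends of the
edges.
\<close>

lemma eigenvalue_mult_pos:
  assumes G: "compact_metric_graph G" and q: "q \<in> Linf G" and u: "u \<in> eigenspace G q \<mu>" "u \<noteq> 0"
  shows "1 \<le> eigenvalue_mult G q \<mu>"
proof -
  define slope where "slope = (\<lambda>e (u :: 'a \<Rightarrow> real \<Rightarrow> real). Lim (at 0 within {0..len G e}) (\<lambda>y. (u e y - u e 0) / (y - 0)))"
  have slope: "slope e u = v e 0" if "solves_on_edges G q \<mu> u v" "e \<in> edges G" for u v e
    unfolding slope_def
  proof (rule tendsto_Lim)
    have l: "0 < len G e" using G that(2) by (simp add: compact_metric_graph_def)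
    show "at 0 within {0..len G e} \<noteq> bot" using l by (simp add: at_within_Icc_at_right)
    have "(u e has_real_derivative v e 0) (at 0 within {0..len G e})"
      using that l by (simp add: solves_on_edges_def)
    then show "((\<lambda>y. (u e y - u e 0) / (y - 0)) \<longlongrightarrow> v e 0) (at 0 within {0..len G e})"
      by (simp add: has_field_derivative_iff)
  qed
  define f where "f = (\<lambda>(e, b) u. if b then slope e u else u e (0::real))"
  have "\<exists>B. finite B \<and> eigenspace G q \<mu> \<subseteq> edge_fun.span B"
  proof (rule finite_dimensional_of_functionals[where I="edges G \<times> (UNIV :: bool set)" and f=f])
    show "finite (edges G \<times> (UNIV :: bool set))" using G by (simp add: compact_metric_graph_def)
    show "lincomb c u d w \<in> eigenspace G q \<mu>" if "u \<in> eigenspace G q \<mu>" "w \<in> eigenspace G q \<mu>" for u w c d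
      by (rule eigenspace_lincomb[OF G q that])
    show "u = 0" if u: "u \<in> eigenspace G q \<mu>" and f0: "\<And>i. i \<in> edges G \<times> UNIV \<Longrightarrow> f i u = 0" for u
    proof -
      obtain v where v: "solves_on_edges G q \<mu> u v" using eigenspaceD[OF G q u] by blast
      have "u e x = 0" if e: "e \<in> edges G" and x: "x \<in> {0..len G e}" for e x
      proof (rule solves_on_edges_zero[OF q v e, of 0])
        show "u e 0 = 0" using f0[of "(e, False)"] e by (simp add: f_def)
        show "v e 0 = 0" using f0[of "(e, True)"] e slope[OF v e] by (simp add: f_def)
      qed (use x in auto)
      then show ?thesis using eigenspace_supported[OF u] by (auto simp: supported_on_def fun_eq_iff)
    qed
    show "f i (lincomb c u d w) = c * f i u + d * f i w"
      if i: "i \<in> edges G \<times> UNIV" and uw: "u \<in> eigenspace G q \<mu>" "w \<in> eigenspace G q \<mu>" for i u w c d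
    proof -
      obtain e b where eb: "i = (e, b)" "e \<in> edges G" using i by auto
      obtain v where v: "solves_on_edges G q \<mu> u v" using eigenspaceD[OF G q uw(1)] by blast
      obtain k where k: "solves_on_edges G q \<mu> w k" using eigenspaceD[OF G q uw(2)] by blast
      have l: "0 < len G e" using G eb by (simp add: compact_metric_graph_def)
      have "(u e has_real_derivative v e 0) (at 0 within {0..len G e})" "(w e has_real_derivative k e 0) (at 0 within {0..len G e})"
        using v k l eb by (auto simp: solves_on_edges_def)
      then have "((\<lambda>x. c * u e x + d * w e x) has_real_derivative c * v e 0 + d * k e 0) (at 0 within {0..len G e})"
        by (intro DERIV_add DERIV_cmult)
      then have "((\<lambda>y. (lincomb c u d w e y - lincomb c u d w e 0) / (y - 0)) \<longlongrightarrow> c * v e 0 + d * k e 0) (at 0 within {0..len G e})"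
        by (simp add: has_field_derivative_iff lincomb_def)
      moreover have "at 0 within {0..len G e} \<noteq> bot" using l by (simp add: at_within_Icc_at_right)
      ultimately have "slope e (lincomb c u d w) = c * v e 0 + d * k e 0"
        unfolding slope_def by (intro tendsto_Lim)
      then show ?thesis using slope[OF v eb(2)] slope[OF k eb(2)] by (simp add: f_def eb lincomb_def)
    qed
  qed
  then obtain B where "finite B" "eigenspace G q \<mu> \<subseteq> edge_fun.span B" by blast
  then show ?thesis unfolding eigenvalue_mult_def using u by (rule one_le_dim)
qed

lemma vertex_interpolant_const: "vertex_interpolant G (\<lambda>z. c) = (\<lambda>e x. c)"
  by (simp add: vertex_interpolant_def)

lemma inner_L2_W1inf_ne_0:
  assumes "compact_metric_graph G" "W1inf G u g" "e \<in> edges G" "x \<in> {0..len G e}" "u e x \<noteq> 0"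
  shows "inner_L2 G u u \<noteq> 0"
  using inner_L2_eq_0_imp[OF assms(1) W1inf_continuous[OF assms(2)] _ assms(3,4)] assms(5) by blast

lemma eigenfunction_norm_pos:
  assumes "compact_metric_graph G" "q \<in> Linf G" "u \<in> eigenspace G q \<mu>" "u \<noteq> 0"
  shows "0 < inner_L2 G u u"
proof -
  obtain v where v: "W1inf G u v" using eigenspaceD[OF assms(1-3)] by blast
  obtain e x where x: "u e x \<noteq> 0" using assms(4) by (auto simp: fun_eq_iff)
  then have "e \<in> edges G" "x \<in> {0..len G e}" using eigenspace_supported[OF assms(3)] unfolding supported_on_def by blast+
  then have "inner_L2 G u u \<noteq> 0" using inner_L2_W1inf_ne_0[OF assms(1) v _ _ x] by blast
  then show ?thesis using inner_L2_nonneg[of G u] by linarith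
qed

text \<open>
The second minimisation needs a vector orthogonal to \<open>\<phi>1\<close>; it is found in the span of the constant
function and a hat. If both minima coincided, simplicity would make \<open>\<phi>2\<close> a multiple of \<open>\<phi>1\<close>,
contrary to orthogonality.
\<close>

lemma first_two_eigenpairs:
  assumes G: "compact_metric_graph G" "connected_graph G" "edges G \<noteq> {}" and q: "q \<in> Linf G"
  obtains \<mu>1 \<phi>1 \<mu>2 \<phi>2 where "\<mu>1 < \<mu>2"
    "\<phi>1 \<in> eigenspace G q \<mu>1" "inner_L2 G \<phi>1 \<phi>1 = 1" "\<phi>2 \<in> eigenspace G q \<mu>2" "inner_L2 G \<phi>2 \<phi>2 = 1"
    "\<And>\<eta> h. W1inf G \<eta> h \<Longrightarrow> \<mu>1 * inner_L2 G \<eta> \<eta> \<le> energy G q \<eta> h \<eta> h"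
    "\<And>\<eta> h. W1inf G \<eta> h \<Longrightarrow> inner_L2 G \<eta> \<phi>1 = 0 \<Longrightarrow> \<mu>2 * inner_L2 G \<eta> \<eta> \<le> energy G q \<eta> h \<eta> h"
proof -
  obtain e where e: "e \<in> edges G" using G(3) by blast
  have l: "0 < len G e" using G(1) e by (simp add: compact_metric_graph_def)
  define one where "one = vertex_interpolant G (\<lambda>z. 1)"
  define one' where "one' = (vertex_slope G (\<lambda>z. 1) :: _ \<Rightarrow> real \<Rightarrow> real)"
  have one: "W1inf G one one'" unfolding one_def one'_def by (rule W1inf_vertex_interpolant[OF G(1)])
  have one_val: "one e' x = 1" for e' x by (simp add: one_def vertex_interpolant_const)
  have norm_one: "inner_L2 G one one \<noteq> 0"
    by (rule inner_L2_W1inf_ne_0[OF G(1) one e, of 0]) (use l in \<open>auto simp: one_val\<close>)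
  have z: "inner_L2 G f (\<lambda>e x. 0) = 0" for f by (simp add: inner_L2_def graph_integral_def)
  obtain \<mu>1 \<phi>1 where \<phi>1: "\<phi>1 \<in> eigenspace G q \<mu>1" "inner_L2 G \<phi>1 \<phi>1 = 1"
    and min0: "\<And>\<eta> h. W1inf G \<eta> h \<Longrightarrow> inner_L2 G \<eta> (\<lambda>e x. 0) = 0 \<Longrightarrow> \<mu>1 * inner_L2 G \<eta> \<eta> \<le> energy G q \<eta> h \<eta> h"
    by (rule constrained_minimiser[OF G(1) q zero_in_eigenspace[OF G(1) q] disjI1[OF refl] one z norm_one]) (rule that)
  have min1: "\<mu>1 * inner_L2 G \<eta> \<eta> \<le> energy G q \<eta> h \<eta> h" if "W1inf G \<eta> h" for \<eta> h by (rule min0[OF that z])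
  obtain \<phi>1' where \<phi>1': "W1inf G \<phi>1 \<phi>1'" using eigenspaceD[OF G(1) q \<phi>1(1)] by blast
  have \<phi>1L: "\<phi>1 \<in> Linf G" by (rule W1inf_Linf(1)[OF \<phi>1'])
  have "\<exists>\<eta> h. W1inf G \<eta> h \<and> inner_L2 G \<eta> \<phi>1 = 0 \<and> inner_L2 G \<eta> \<eta> \<noteq> 0"
  proof (cases "inner_L2 G one \<phi>1 = 0")
    case True
    then show ?thesis using one norm_one by blast
  next
    case False
    define a where "a = len G e / 2"
    have a: "0 \<le> a" "a \<le> len G e" using l by (simp_all add: a_def)
    define hat where "hat = edge_hat G e a"
    define hat' where "hat' = edge_hat_deriv G e a"
    have hat: "W1inf G hat hat'" unfolding hat_def hat'_def by (rule W1inf_edge_hat[OF G(1) e a])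
    have hat0: "hat e 0 = 0" using a by (simp add: hat_def edge_hat_def)
    have hata: "hat e a = len G e / 4" using l by (simp add: hat_def edge_hat_def a_def)
    define \<eta> where "\<eta> = lincomb (inner_L2 G hat \<phi>1) one (- inner_L2 G one \<phi>1) hat"
    have H: "W1inf G \<eta> (lincomb (inner_L2 G hat \<phi>1) one' (- inner_L2 G one \<phi>1) hat')"
      unfolding \<eta>_def by (rule W1inf_lincomb[OF one hat])
    have "inner_L2 G \<eta> \<phi>1 = 0"
      unfolding \<eta>_def inner_L2_lincomb_left[OF W1inf_Linf(1)[OF one] W1inf_Linf(1)[OF hat] \<phi>1L] by simp
    moreover have "inner_L2 G \<eta> \<eta> \<noteq> 0"
    proof
      assume n: "inner_L2 G \<eta> \<eta> = 0"
      have "\<eta> e 0 = 0" "\<eta> e a = 0" 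
        using inner_L2_eq_0_imp[OF G(1) W1inf_continuous[OF H] n e, of 0] inner_L2_eq_0_imp[OF G(1) W1inf_continuous[OF H] n e, of a] a l by auto
      then show False using False l by (simp add: \<eta>_def lincomb_def one_val hat0 hata)
    qed
    ultimately show ?thesis using H by blast
  qed
  then obtain \<eta>0 h0 where \<eta>0: "W1inf G \<eta>0 h0" "inner_L2 G \<eta>0 \<phi>1 = 0" "inner_L2 G \<eta>0 \<eta>0 \<noteq> 0" by blast
  obtain \<mu>2 \<phi>2 where \<phi>2: "\<phi>2 \<in> eigenspace G q \<mu>2" "inner_L2 G \<phi>2 \<phi>2 = 1" "inner_L2 G \<phi>2 \<phi>1 = 0"
    and min2: "\<And>\<eta> h. W1inf G \<eta> h \<Longrightarrow> inner_L2 G \<eta> \<phi>1 = 0 \<Longrightarrow> \<mu>2 * inner_L2 G \<eta> \<eta> \<le> energy G q \<eta> h \<eta> h"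
    by (rule constrained_minimiser[OF G(1) q \<phi>1(1) disjI2[OF \<phi>1(2)] \<eta>0]) (rule that)
  obtain \<phi>2' where \<phi>2': "solves_on_edges G q \<mu>2 \<phi>2 \<phi>2'" "W1inf G \<phi>2 \<phi>2'" "kirchhoff G \<phi>2'" using eigenspaceD[OF G(1) q \<phi>2(1)] .
  have "\<mu>1 \<le> \<mu>2"
    using min1[OF \<phi>2'(2)] weak_equation[OF G(1) q \<phi>2' \<phi>2'(2)] \<phi>2(2) by simp
  moreover have "\<mu>1 \<noteq> \<mu>2"
  proof
    assume eq: "\<mu>1 = \<mu>2"
    have "\<phi>1 \<noteq> (\<lambda>e x. 0)" using \<phi>1(2) z by auto
    then obtain c where c: "\<phi>2 = lincomb c \<phi>1 0 \<phi>1"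
      using ground_state_simple[OF G(1,2) q min1 \<phi>1(1) _ \<phi>2(1)[folded eq]] by blast
    have "inner_L2 G \<phi>2 \<phi>1 = c" unfolding c by (simp add: inner_L2_lincomb_left \<phi>1L \<phi>1(2))
    then have "\<phi>2 = (\<lambda>e x. 0)" using \<phi>2(3) c by (simp add: lincomb_def)
    then show False using \<phi>2(2) z by simp
  qed
  ultimately have "\<mu>1 < \<mu>2" by simp
  then show ?thesis using \<phi>1 \<phi>2(1,2) min1 min2 by (rule that)
qed

text \<open>
An eigenfunction for an eigenvalue other than \<open>\<mu>1\<close> is orthogonal to \<open>\<phi>1\<close>, so that eigenvalue is at
least \<open>\<mu>2\<close>. Therefore the set of eigenvalues up to \<open>\<mu>2\<close> is \<open>{\<mu>1, \<mu>2}\<close>, and since \<open>\<mu>1\<close> is simple the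
counting function is at most one below \<open>\<mu>2\<close> and at least two at \<open>\<mu>2\<close>.
\<close>

lemma eigenvalue_nth_low:
  assumes G: "compact_metric_graph G" "connected_graph G" and q: "q \<in> Linf G"
    and \<mu>: "\<mu>1 < \<mu>2"
    and \<phi>1: "\<phi>1 \<in> eigenspace G q \<mu>1" "inner_L2 G \<phi>1 \<phi>1 = 1" and \<phi>2: "\<phi>2 \<in> eigenspace G q \<mu>2" "inner_L2 G \<phi>2 \<phi>2 = 1"
    and min1: "\<And>\<eta> h. W1inf G \<eta> h \<Longrightarrow> \<mu>1 * inner_L2 G \<eta> \<eta> \<le> energy G q \<eta> h \<eta> h"
    and min2: "\<And>\<eta> h. W1inf G \<eta> h \<Longrightarrow> inner_L2 G \<eta> \<phi>1 = 0 \<Longrightarrow> \<mu>2 * inner_L2 G \<eta> \<eta> \<le> energy G q \<eta> h \<eta> h"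
  shows "eigenvalue_nth G 1 q = \<mu>1" "eigenvalue_nth G 2 q = \<mu>2"
proof -
  have ne: "\<phi>1 \<noteq> 0" "\<phi>2 \<noteq> 0" using \<phi>1(2) \<phi>2(2) by (auto simp: inner_L2_def graph_integral_def)
  have ev: "is_eigenvalue G q \<mu>1" "is_eigenvalue G q \<mu>2" unfolding is_eigenvalue_def using \<phi>1(1) \<phi>2(1) ne by blast+
  have gap: "\<mu>2 \<le> \<mu>" if "is_eigenvalue G q \<mu>" "\<mu> \<noteq> \<mu>1" for \<mu>
  proof -
    obtain u where u: "u \<in> eigenspace G q \<mu>" "u \<noteq> 0" using \<open>is_eigenvalue G q \<mu>\<close> by (auto simp: is_eigenvalue_def)
    obtain v where v: "solves_on_edges G q \<mu> u v" "W1inf G u v" "kirchhoff G v" using eigenspaceD[OF G(1) q u(1)] .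
    have "inner_L2 G u \<phi>1 = 0" by (rule inner_L2_eigenfunctions_orthogonal[OF G(1) q u(1) \<phi>1(1) \<open>\<mu> \<noteq> \<mu>1\<close>])
    then have "\<mu>2 * inner_L2 G u u \<le> \<mu> * inner_L2 G u u"
      using min2[OF v(2)] weak_equation[OF G(1) q v v(2)] by simp
    then show ?thesis using eigenfunction_norm_pos[OF G(1) q u] by simp
  qed
  have mult1: "1 \<le> eigenvalue_mult G q \<mu>1" and mult2: "1 \<le> eigenvalue_mult G q \<mu>2"
    using eigenvalue_mult_pos[OF G(1) q] \<phi>1(1) \<phi>2(1) ne by blast+
  have mult1_le: "eigenvalue_mult G q \<mu>1 \<le> 1"
  proof -
    have "eigenspace G q \<mu>1 \<subseteq> edge_fun.span {\<phi>1}"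
    proof
      fix w assume w: "w \<in> eigenspace G q \<mu>1"
      obtain c where "w = lincomb c \<phi>1 0 \<phi>1"
        using ground_state_simple[OF G q min1 \<phi>1(1) ne(1)[unfolded zero_function] w] by blast
      then have "w = scale_fun c \<phi>1" by (simp add: lincomb_def scale_fun_def)
      then show "w \<in> edge_fun.span {\<phi>1}" by (simp add: edge_fun.span_scale edge_fun.span_base)
    qed
    then show ?thesis unfolding eigenvalue_mult_def using edge_fun.dim_le_card[of "eigenspace G q \<mu>1" "{\<phi>1}"] by simp
  qed
  have set_low: "{\<mu>. is_eigenvalue G q \<mu> \<and> \<mu> \<le> t} \<subseteq> {\<mu>1}" if "t < \<mu>2" for t using gap that by force
  have set1: "{\<mu>. is_eigenvalue G q \<mu> \<and> \<mu> \<le> \<mu>1} = {\<mu>1}" using set_low[OF \<mu>] ev by auto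
  have set2: "{\<mu>. is_eigenvalue G q \<mu> \<and> \<mu> \<le> \<mu>2} = {\<mu>1, \<mu>2}" using gap ev \<mu> by force
  have count_low: "eigenvalue_count G q t \<le> 1" if "t < \<mu>2" for t
  proof -
    have "eigenvalue_count G q t \<le> (\<Sum>\<mu>\<in>{\<mu>1}. eigenvalue_mult G q \<mu>)"
      unfolding eigenvalue_count_def by (rule sum_mono2) (use set_low[OF that] in auto)
    then show ?thesis using mult1_le by simp
  qed
  show "eigenvalue_nth G 1 q = \<mu>1" unfolding eigenvalue_nth_def
  proof (rule cInf_eq_minimum)
    show "\<mu>1 \<in> {t. 1 \<le> eigenvalue_count G q t}" using mult1 by (simp add: eigenvalue_count_def set1)
    fix t assume "t \<in> {t. 1 \<le> eigenvalue_count G q t}"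
    then have "eigenvalue_count G q t \<noteq> 0" by simp
    then obtain \<nu> where "is_eigenvalue G q \<nu>" "\<nu> \<le> t" unfolding eigenvalue_count_def by (metis (mono_tags, lifting) mem_Collect_eq sum.neutral)
    then show "\<mu>1 \<le> t" using gap[of \<nu>] \<mu> by (cases "\<nu> = \<mu>1") auto
  qed
  show "eigenvalue_nth G 2 q = \<mu>2" unfolding eigenvalue_nth_def
  proof (rule cInf_eq_minimum)
    show "\<mu>2 \<in> {t. 2 \<le> eigenvalue_count G q t}" using mult1 mult2 \<mu> by (simp add: eigenvalue_count_def set2)
    fix t assume "t \<in> {t. 2 \<le> eigenvalue_count G q t}"
    then show "\<mu>2 \<le> t" using count_low[of t] by (cases "t < \<mu>2") auto
  qed
qed

lemma low_spectrum:
  assumes G: "compact_metric_graph G" "connected_graph G" "edges G \<noteq> {}" and q: "q \<in> Linf G"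
  obtains \<phi>1 \<phi>2 where "eigenvalue_nth G 1 q < eigenvalue_nth G 2 q"
    "\<phi>1 \<in> eigenspace G q (eigenvalue_nth G 1 q)" "inner_L2 G \<phi>1 \<phi>1 = 1"
    "\<And>\<eta> h. W1inf G \<eta> h \<Longrightarrow> eigenvalue_nth G 1 q * inner_L2 G \<eta> \<eta> \<le> energy G q \<eta> h \<eta> h"
    "\<And>\<eta> h. W1inf G \<eta> h \<Longrightarrow> inner_L2 G \<eta> \<phi>1 = 0 \<Longrightarrow> eigenvalue_nth G 2 q * inner_L2 G \<eta> \<eta> \<le> energy G q \<eta> h \<eta> h"
proof (rule first_two_eigenpairs[OF G q])
  fix \<mu>1 \<phi>1 \<mu>2 \<phi>2
  assume a: "\<mu>1 < \<mu>2"
    "\<phi>1 \<in> eigenspace G q \<mu>1" "inner_L2 G \<phi>1 \<phi>1 = 1" "\<phi>2 \<in> eigenspace G q \<mu>2" "inner_L2 G \<phi>2 \<phi>2 = 1"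
    and min1: "\<And>\<eta> h. W1inf G \<eta> h \<Longrightarrow> \<mu>1 * inner_L2 G \<eta> \<eta> \<le> energy G q \<eta> h \<eta> h"
    and min2: "\<And>\<eta> h. W1inf G \<eta> h \<Longrightarrow> inner_L2 G \<eta> \<phi>1 = 0 \<Longrightarrow> \<mu>2 * inner_L2 G \<eta> \<eta> \<le> energy G q \<eta> h \<eta> h"
  have n: "eigenvalue_nth G 1 q = \<mu>1" "eigenvalue_nth G 2 q = \<mu>2"
    by (rule eigenvalue_nth_low[OF G(1,2) q a min1 min2]; assumption)+
  show thesis
  proof (rule that[of \<phi>1])
    show "eigenvalue_nth G 1 q < eigenvalue_nth G 2 q" "\<phi>1 \<in> eigenspace G q (eigenvalue_nth G 1 q)"
      unfolding n by (rule a)+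
    show "inner_L2 G \<phi>1 \<phi>1 = 1" by (rule a)
    show "eigenvalue_nth G 1 q * inner_L2 G \<eta> \<eta> \<le> energy G q \<eta> h \<eta> h" if "W1inf G \<eta> h" for \<eta> h
      unfolding n by (rule min1[OF that])
    show "eigenvalue_nth G 2 q * inner_L2 G \<eta> \<eta> \<le> energy G q \<eta> h \<eta> h" if "W1inf G \<eta> h" "inner_L2 G \<eta> \<phi>1 = 0" for \<eta> h
      unfolding n by (rule min2[OF that])
  qed
qed

text \<open>
The normalised ground state is unique up to a sign, so the minimum over the complement of one
ground state is the minimum over the complement of any other.
\<close>

lemma orthogonal_to_ground_state_bound:
  assumes G: "compact_metric_graph G" "connected_graph G" "edges G \<noteq> {}" and q: "q \<in> Linf G"
    and u1: "u1 \<in> eigenspace G q (eigenvalue_nth G 1 q)" "inner_L2 G u1 u1 = 1"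
    and \<eta>: "W1inf G \<eta> h" "inner_L2 G \<eta> u1 = 0"
  shows "eigenvalue_nth G 2 q * inner_L2 G \<eta> \<eta> \<le> energy G q \<eta> h \<eta> h"
proof (rule low_spectrum[OF G q])
  fix \<phi>1
  assume \<phi>1: "\<phi>1 \<in> eigenspace G q (eigenvalue_nth G 1 q)"
    and min1: "\<And>\<eta> h. W1inf G \<eta> h \<Longrightarrow> eigenvalue_nth G 1 q * inner_L2 G \<eta> \<eta> \<le> energy G q \<eta> h \<eta> h"
    and min2: "\<And>\<eta> h. W1inf G \<eta> h \<Longrightarrow> inner_L2 G \<eta> \<phi>1 = 0 \<Longrightarrow> eigenvalue_nth G 2 q * inner_L2 G \<eta> \<eta> \<le> energy G q \<eta> h \<eta> h"
  have "u1 \<noteq> (\<lambda>e x. 0)" using u1(2) by (auto simp: inner_L2_def graph_integral_def)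
  then obtain c where c: "\<phi>1 = lincomb c u1 0 u1"
    using ground_state_simple[OF G(1,2) q min1 u1(1) _ \<phi>1] by blast
  obtain v where v: "W1inf G u1 v" using eigenspaceD[OF G(1) q u1(1)] by blast
  have "inner_L2 G \<eta> \<phi>1 = 0" unfolding c
    using \<eta>(2) by (simp add: inner_L2_lincomb_right W1inf_Linf(1)[OF v] W1inf_Linf(1)[OF \<eta>(1)])
  then show ?thesis by (rule min2[OF \<eta>(1)])
qed

section \<open>Perturbation of the fundamental gap\<close>

lemma energy_perturbed:
  assumes "q \<in> Linf G" "P \<in> Linf G" "W1inf G u g" "W1inf G \<eta> h"
  shows "energy G (\<lambda>e x. q e x + t * P e x) u g \<eta> h = energy G q u g \<eta> h + t * inner_L2 G (\<lambda>e x. P e x * u e x) \<eta>"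
proof -
  have "(\<lambda>e x. (q e x + t * P e x) * u e x) = lincomb 1 (\<lambda>e x. q e x * u e x) t (\<lambda>e x. P e x * u e x)"
    by (simp add: lincomb_def algebra_simps)
  then show ?thesis using assms
    by (simp add: energy_def inner_L2_lincomb_left Linf_mult W1inf_Linf)
qed

lemma Linf_perturbed:
  assumes "q \<in> Linf G" "P \<in> Linf G" shows "(\<lambda>e x. q e x + t * P e x) \<in> Linf G"
  using Linf_lincomb[OF assms, of 1 t] by (simp add: lincomb_def)

lemma inner_L2_weighted_lincomb_square:
  assumes "P \<in> Linf G" "f \<in> Linf G" "g \<in> Linf G"
  shows "inner_L2 G (\<lambda>e x. P e x * lincomb c f d g e x) (lincomb c f d g)
    = c\<^sup>2 * inner_L2 G (\<lambda>e x. P e x * f e x) f + 2 * c * d * inner_L2 G (\<lambda>e x. P e x * f e x) g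
      + d\<^sup>2 * inner_L2 G (\<lambda>e x. P e x * g e x) g"
proof -
  have "(\<lambda>e x. P e x * lincomb c f d g e x) = lincomb c (\<lambda>e x. P e x * f e x) d (\<lambda>e x. P e x * g e x)"
    by (simp add: lincomb_def algebra_simps)
  moreover have "inner_L2 G (\<lambda>e x. P e x * g e x) f = inner_L2 G (\<lambda>e x. P e x * f e x) g"
    by (simp add: inner_L2_def mult_ac)
  ultimately show ?thesis using assms
    by (simp add: inner_L2_lincomb_left inner_L2_lincomb_right Linf_lincomb Linf_mult power2_eq_square algebra_simps)
qed

lemma two_mult_le_weighted_squares:
  fixes x y \<gamma> :: real assumes "0 < \<gamma>"
  shows "2 * x * y \<le> \<gamma> / 2 * x\<^sup>2 + 2 / \<gamma> * y\<^sup>2"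
proof -
  have "0 \<le> (\<gamma> * x - 2 * y)\<^sup>2" by simp
  then have "4 * \<gamma> * x * y \<le> \<gamma>\<^sup>2 * x\<^sup>2 + 4 * y\<^sup>2" by (simp add: power2_diff power_mult_distrib)
  then show ?thesis using assms by (simp add: field_simps power2_eq_square)
qed

text \<open>
The normalised ground state of the perturbed potential is written as \<open>\<phi> = c u1 + w\<close> with \<open>w\<close>
orthogonal to \<open>u1\<close>. Then the perturbed eigenvalue is at least
\<open>\<lambda>\<^sub>1 + \<gamma> W + t \<integral> P \<phi>\<^sup>2\<close>, where \<open>W\<close> is the squared norm of \<open>w\<close> and \<open>\<gamma>\<close> the gap. One half of
\<open>\<gamma> W\<close> absorbs the terms of order \<open>t W\<close>; the other half absorbs the cross term \<open>2 t c \<integral> P u1 w\<close> up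
to an error of order \<open>t\<^sup>2\<close>.
\<close>

lemma first_eigenvalue_perturbation_lower:
  assumes G: "compact_metric_graph G" "connected_graph G" "edges G \<noteq> {}" and q: "q \<in> Linf G" and P: "P \<in> Linf G"
    and u1: "u1 \<in> eigenspace G q (eigenvalue_nth G 1 q)" "inner_L2 G u1 u1 = 1"
  obtains C \<delta> where "0 < \<delta>" "\<And>t. \<bar>t\<bar> < \<delta> \<Longrightarrow>
     eigenvalue_nth G 1 q + t * inner_L2 G (\<lambda>e x. P e x * u1 e x) u1 - C * t\<^sup>2
       \<le> eigenvalue_nth G 1 (\<lambda>e x. q e x + t * P e x)"
proof -
  define ev1 ev2 \<gamma> where "ev1 = eigenvalue_nth G 1 q" and "ev2 = eigenvalue_nth G 2 q" and "\<gamma> = ev2 - ev1"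
  have \<gamma>: "0 < \<gamma>" unfolding \<gamma>_def ev1_def ev2_def by (rule low_spectrum[OF G q]) simp
  obtain v where v: "solves_on_edges G q ev1 u1 v" "W1inf G u1 v" "kirchhoff G v"
    using eigenspaceD[OF G(1) q u1(1)] unfolding ev1_def .
  note u1L = W1inf_Linf(1)[OF v(2)]
  obtain K where K: "0 < K" "\<And>u. u \<in> Linf G \<Longrightarrow> \<bar>inner_L2 G (\<lambda>e x. P e x * u e x) u\<bar> \<le> K * inner_L2 G u u"
    using potential_form_bounded[OF G(1) P] by blast
  define p where "p = inner_L2 G (\<lambda>e x. P e x * u1 e x) u1"
  define R where "R = inner_L2 G (\<lambda>e x. P e x * u1 e x) (\<lambda>e x. P e x * u1 e x)"
  define \<delta> where "\<delta> = \<gamma> / (2 * (\<bar>p\<bar> + K))"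
  have pK: "0 < \<bar>p\<bar> + K" using K by simp
  have "ev1 + t * p - 2 / \<gamma> * R * t\<^sup>2 \<le> eigenvalue_nth G 1 (\<lambda>e x. q e x + t * P e x)" if t: "\<bar>t\<bar> < \<delta>" for t
  proof -
    let ?q = "\<lambda>e x. q e x + t * P e x"
    have q': "?q \<in> Linf G" by (rule Linf_perturbed[OF q P])
    define \<mu> where "\<mu> = eigenvalue_nth G 1 ?q"
    obtain \<phi> where \<phi>: "\<phi> \<in> eigenspace G ?q \<mu>" "inner_L2 G \<phi> \<phi> = 1"
      unfolding \<mu>_def by (rule low_spectrum[OF G q'])
    obtain \<phi>' where \<phi>': "solves_on_edges G ?q \<mu> \<phi> \<phi>'" "W1inf G \<phi> \<phi>'" "kirchhoff G \<phi>'" using eigenspaceD[OF G(1) q' \<phi>(1)] .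
    note \<phi>L = W1inf_Linf(1)[OF \<phi>'(2)]
    define c where "c = inner_L2 G \<phi> u1"
    define w where "w = lincomb 1 \<phi> (-c) u1"
    define w' where "w' = lincomb 1 \<phi>' (-c) v"
    have w: "W1inf G w w'" unfolding w_def w'_def by (rule W1inf_lincomb[OF \<phi>'(2) v(2)])
    note wL = W1inf_Linf(1)[OF w]
    have wu: "inner_L2 G w u1 = 0" unfolding w_def by (simp add: inner_L2_lincomb_left \<phi>L u1L u1(2) c_def)
    have uw: "inner_L2 G u1 w = 0" using wu by (simp add: inner_L2_commute)
    have \<phi>_eq: "\<phi> = lincomb c u1 1 w" "\<phi>' = lincomb c v 1 w'"
      by (simp_all add: w_def w'_def lincomb_def fun_eq_iff)
    define W x y where "W = inner_L2 G w w" and "x = inner_L2 G (\<lambda>e x. P e x * u1 e x) w"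
      and "y = inner_L2 G (\<lambda>e x. P e x * w e x) w"
    have W0: "0 \<le> W" unfolding W_def by (rule inner_L2_nonneg)
    have cW: "c\<^sup>2 + W = 1"
      using \<phi>(2) inner_L2_lincomb_square[OF u1L wL, of c 1] uw u1(2) by (simp add: \<phi>_eq(1)[symmetric] W_def)
    have y: "\<bar>y\<bar> \<le> K * W" unfolding y_def W_def by (rule K(2)[OF wL])
    have "energy G q u1 v u1 v = ev1" "energy G q u1 v w w' = 0"
      using weak_equation[OF G(1) q v v(2)] weak_equation[OF G(1) q v w] uw u1(2) by auto
    then have Eq: "energy G q \<phi> \<phi>' \<phi> \<phi>' = c\<^sup>2 * ev1 + energy G q w w' w w'"
      using energy_lincomb_square[OF q v(2) w, of c 1] by (simp add: \<phi>_eq[symmetric])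
    have "ev2 * W \<le> energy G q w w' w w'"
      unfolding ev2_def W_def by (rule orthogonal_to_ground_state_bound[OF G q u1 w wu])
    moreover have "\<mu> = energy G q \<phi> \<phi>' \<phi> \<phi>' + t * inner_L2 G (\<lambda>e x. P e x * \<phi> e x) \<phi>"
      using weak_equation[OF G(1) q' \<phi>' \<phi>'(2)] energy_perturbed[OF q P \<phi>'(2) \<phi>'(2), of t] \<phi>(2) by simp
    moreover have "inner_L2 G (\<lambda>e x. P e x * \<phi> e x) \<phi> = c\<^sup>2 * p + 2 * c * x + y"
      using inner_L2_weighted_lincomb_square[OF P u1L wL, of c 1] by (simp add: \<phi>_eq(1)[symmetric] p_def x_def y_def)
    ultimately have "c\<^sup>2 * ev1 + ev2 * W + t * (c\<^sup>2 * p + 2 * c * x + y) \<le> \<mu>" using Eq by simp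
    moreover have "c\<^sup>2 * ev1 + ev2 * W + t * (c\<^sup>2 * p + 2 * c * x + y)
      = ev1 + t * p + \<gamma> * W + t * (y - W * p) + 2 * t * c * x"
    proof -
      have c2: "c\<^sup>2 = 1 - W" using cW by simp
      show ?thesis unfolding c2 \<gamma>_def by (simp add: algebra_simps)
    qed
    moreover have "- (\<gamma> / 2 * W) \<le> t * (y - W * p)"
    proof -
      have "\<bar>t * (y - W * p)\<bar> \<le> \<bar>t\<bar> * (\<bar>y\<bar> + W * \<bar>p\<bar>)"
        unfolding abs_mult using W0 abs_triangle_ineq4[of y "W * p"] by (intro mult_left_mono) (simp_all add: abs_mult)
      also have "\<dots> \<le> \<bar>t\<bar> * ((\<bar>p\<bar> + K) * W)" using y by (intro mult_left_mono) (simp_all add: algebra_simps)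
      also have "\<dots> = (\<bar>t\<bar> * (\<bar>p\<bar> + K)) * W" by (simp add: mult.assoc)
      also have "\<dots> \<le> \<gamma> / 2 * W" using t pK W0 by (intro mult_right_mono) (simp_all add: \<delta>_def field_simps)
      finally show ?thesis by linarith
    qed
    moreover have "- (\<gamma> / 2 * W) - 2 / \<gamma> * R * t\<^sup>2 \<le> 2 * t * c * x"
    proof -
      \<comment> \<open>With this \<open>s\<close> the linear term becomes the cross term after scaling by \<open>\<gamma> / 2\<close>.\<close>
      define s where "s = 2 * t * c / \<gamma>"
      have PL: "(\<lambda>e x. P e x * u1 e x) \<in> Linf G" by (rule Linf_mult[OF P u1L])
      have "0 \<le> inner_L2 G (lincomb 1 w s (\<lambda>e x. P e x * u1 e x)) (lincomb 1 w s (\<lambda>e x. P e x * u1 e x))"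
        by (rule inner_L2_nonneg)
      also have "\<dots> = W + 2 * s * x + s\<^sup>2 * R"
        using inner_L2_lincomb_square[OF wL PL, of 1 s] by (simp add: W_def x_def R_def inner_L2_commute[of G w "\<lambda>e x. P e x * u1 e x"])
      finally have "0 \<le> \<gamma> / 2 * (W + 2 * s * x + s\<^sup>2 * R)" using \<gamma> by simp
      also have "\<dots> = \<gamma> / 2 * W + 2 * t * c * x + 2 / \<gamma> * R * t\<^sup>2 * c\<^sup>2"
        using \<gamma> by (simp add: s_def field_simps power2_eq_square)
      also have "2 / \<gamma> * R * t\<^sup>2 * c\<^sup>2 \<le> 2 / \<gamma> * R * t\<^sup>2 * 1"
        using \<gamma> cW W0 inner_L2_nonneg[of G "\<lambda>e x. P e x * u1 e x"] by (intro mult_left_mono) (auto simp: R_def)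
      finally show ?thesis by simp
    qed
    ultimately show ?thesis unfolding \<mu>_def by linarith
  qed
  moreover have "0 < \<delta>" using \<gamma> pK by (simp add: \<delta>_def)
  ultimately show ?thesis using that[of \<delta> "2 / \<gamma> * R"] unfolding ev1_def p_def by blast
qed

text \<open>
The trial function is \<open>f = c u1 + d u2\<close>, normalised and orthogonal to the perturbed ground state.
Its component along \<open>u1\<close> lowers the energy by \<open>\<gamma> c\<^sup>2\<close>, which absorbs the terms \<open>t c\<^sup>2\<close> and \<open>t c d\<close>
up to an error of order \<open>t\<^sup>2\<close>.
\<close>

lemma second_eigenvalue_perturbation_upper:
  assumes G: "compact_metric_graph G" "connected_graph G" "edges G \<noteq> {}" and q: "q \<in> Linf G" and P: "P \<in> Linf G"
    and u1: "u1 \<in> eigenspace G q (eigenvalue_nth G 1 q)" "inner_L2 G u1 u1 = 1"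
    and u2: "u2 \<in> eigenspace G q (eigenvalue_nth G 2 q)" "inner_L2 G u2 u2 = 1"
  obtains C \<delta> where "0 < \<delta>" "\<And>t. \<bar>t\<bar> < \<delta> \<Longrightarrow>
     eigenvalue_nth G 2 (\<lambda>e x. q e x + t * P e x)
       \<le> eigenvalue_nth G 2 q + t * inner_L2 G (\<lambda>e x. P e x * u2 e x) u2 + C * t\<^sup>2"
proof -
  define ev1 ev2 \<gamma> where "ev1 = eigenvalue_nth G 1 q" and "ev2 = eigenvalue_nth G 2 q" and "\<gamma> = ev2 - ev1"
  have \<gamma>: "0 < \<gamma>" unfolding \<gamma>_def ev1_def ev2_def by (rule low_spectrum[OF G q]) simp
  obtain v1 where v1: "solves_on_edges G q ev1 u1 v1" "W1inf G u1 v1" "kirchhoff G v1"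
    using eigenspaceD[OF G(1) q u1(1)] unfolding ev1_def .
  obtain v2 where v2: "solves_on_edges G q ev2 u2 v2" "W1inf G u2 v2" "kirchhoff G v2"
    using eigenspaceD[OF G(1) q u2(1)] unfolding ev2_def .
  note uL = W1inf_Linf(1)[OF v1(2)] W1inf_Linf(1)[OF v2(2)]
  have orth: "inner_L2 G u1 u2 = 0"
    using inner_L2_eigenfunctions_orthogonal[OF G(1) q u1(1) u2(1)] \<gamma> by (simp add: \<gamma>_def ev1_def ev2_def)
  define p1 p2 r where "p1 = inner_L2 G (\<lambda>e x. P e x * u1 e x) u1" and "p2 = inner_L2 G (\<lambda>e x. P e x * u2 e x) u2"
    and "r = inner_L2 G (\<lambda>e x. P e x * u1 e x) u2"
  define \<delta> where "\<delta> = \<gamma> / (2 * (\<bar>p1 - p2\<bar> + 1))"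
  have "eigenvalue_nth G 2 (\<lambda>e x. q e x + t * P e x) \<le> ev2 + t * p2 + 2 / \<gamma> * r\<^sup>2 * t\<^sup>2" if t: "\<bar>t\<bar> < \<delta>" for t
  proof -
    let ?q = "\<lambda>e x. q e x + t * P e x"
    have q': "?q \<in> Linf G" by (rule Linf_perturbed[OF q P])
    obtain \<phi> where \<phi>: "\<phi> \<in> eigenspace G ?q (eigenvalue_nth G 1 ?q)" "inner_L2 G \<phi> \<phi> = 1" by (rule low_spectrum[OF G q'])
    obtain \<phi>' where \<phi>': "W1inf G \<phi> \<phi>'" using eigenspaceD[OF G(1) q' \<phi>(1)] by blast
    note \<phi>L = W1inf_Linf(1)[OF \<phi>']
    obtain c d where cd: "c\<^sup>2 + d\<^sup>2 = 1" "c * inner_L2 G u1 \<phi> + d * inner_L2 G u2 \<phi> = 0"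
    proof -
      define a b n where "a = inner_L2 G u1 \<phi>" and "b = inner_L2 G u2 \<phi>" and "n = sqrt (a\<^sup>2 + b\<^sup>2)"
      show ?thesis
      proof (cases "n = 0")
        case True
        then have "b = 0" by (simp add: n_def add_nonneg_eq_0_iff)
        then show ?thesis using that[of 0 1] by (simp add: b_def)
      next
        case False
        have n2: "n\<^sup>2 = a\<^sup>2 + b\<^sup>2" by (simp add: n_def)
        have "(b / n)\<^sup>2 + (- a / n)\<^sup>2 = (b\<^sup>2 + a\<^sup>2) / n\<^sup>2" by (simp add: power_divide add_divide_distrib)
        also have "b\<^sup>2 + a\<^sup>2 = n\<^sup>2" by (simp add: n2)
        also have "n\<^sup>2 / n\<^sup>2 = 1" using False by simp
        finally show ?thesis using that[of "b / n" "- a / n"] False by (simp add: a_def b_def)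
      qed
    qed
    define f f' where "f = lincomb c u1 d u2" and "f' = lincomb c v1 d v2"
    have f: "W1inf G f f'" unfolding f_def f'_def by (rule W1inf_lincomb[OF v1(2) v2(2)])
    have "inner_L2 G f \<phi> = 0" unfolding f_def using cd(2) by (simp add: inner_L2_lincomb_left uL \<phi>L)
    moreover have "inner_L2 G f f = 1"
      unfolding f_def inner_L2_lincomb_square[OF uL] using cd(1) orth u1(2) u2(2) by simp
    ultimately have "eigenvalue_nth G 2 ?q \<le> energy G ?q f f' f f'"
      using orthogonal_to_ground_state_bound[OF G q' \<phi> f] by simp
    also have "\<dots> = energy G q f f' f f' + t * inner_L2 G (\<lambda>e x. P e x * f e x) f"
      by (rule energy_perturbed[OF q P f f])
    also have "energy G q f f' f f' = c\<^sup>2 * ev1 + d\<^sup>2 * ev2"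
      unfolding f_def f'_def energy_lincomb_square[OF q v1(2) v2(2)]
      using weak_equation[OF G(1) q v1 v1(2)] weak_equation[OF G(1) q v1 v2(2)] weak_equation[OF G(1) q v2 v2(2)] orth u1(2) u2(2)
      by simp
    also have "inner_L2 G (\<lambda>e x. P e x * f e x) f = c\<^sup>2 * p1 + 2 * c * d * r + d\<^sup>2 * p2"
      unfolding f_def p1_def p2_def r_def by (rule inner_L2_weighted_lincomb_square[OF P uL])
    also have "c\<^sup>2 * ev1 + d\<^sup>2 * ev2 + t * (c\<^sup>2 * p1 + 2 * c * d * r + d\<^sup>2 * p2)
      = ev2 + t * p2 - \<gamma> * c\<^sup>2 + t * (p1 - p2) * c\<^sup>2 + 2 * c * (t * d * r)"
    proof -
      have d2: "d\<^sup>2 = 1 - c\<^sup>2" using cd(1) by simp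
      show ?thesis unfolding d2 \<gamma>_def by (simp add: algebra_simps)
    qed
    also have "\<dots> \<le> ev2 + t * p2 - \<gamma> * c\<^sup>2 + \<gamma> / 2 * c\<^sup>2 + (\<gamma> / 2 * c\<^sup>2 + 2 / \<gamma> * (t * d * r)\<^sup>2)"
    proof (intro add_mono order_refl)
      have "t * (p1 - p2) \<le> \<bar>t\<bar> * \<bar>p1 - p2\<bar>" by (metis abs_ge_self abs_mult)
      also have "\<dots> \<le> \<bar>t\<bar> * (\<bar>p1 - p2\<bar> + 1)" by (intro mult_left_mono) auto
      also have "\<dots> \<le> \<gamma> / 2"
      proof -
        have pos: "0 < 2 * (\<bar>p1 - p2\<bar> + 1)" by (intro mult_pos_pos add_nonneg_pos) auto
        have "\<bar>t\<bar> * (2 * (\<bar>p1 - p2\<bar> + 1)) < \<gamma>"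
          using t by (simp only: \<delta>_def pos_less_divide_eq[OF pos])
        then show ?thesis by linarith
      qed
      finally show "t * (p1 - p2) * c\<^sup>2 \<le> \<gamma> / 2 * c\<^sup>2" by (intro mult_right_mono) auto
      show "2 * c * (t * d * r) \<le> \<gamma> / 2 * c\<^sup>2 + 2 / \<gamma> * (t * d * r)\<^sup>2" by (rule two_mult_le_weighted_squares[OF \<gamma>])
    qed
    also have "\<dots> = ev2 + t * p2 + 2 / \<gamma> * r\<^sup>2 * t\<^sup>2 * d\<^sup>2" by (simp add: power_mult_distrib)
    also have "\<dots> \<le> ev2 + t * p2 + 2 / \<gamma> * r\<^sup>2 * t\<^sup>2 * 1"
      using \<gamma> cd(1) zero_le_power2[of c] by (intro add_mono mult_left_mono order_refl) (linarith | simp)+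
    finally show ?thesis by simp
  qed
  moreover have "0 < \<delta>" using \<gamma> by (simp add: \<delta>_def add_nonneg_pos)
  ultimately show ?thesis using that[of \<delta> "2 / \<gamma> * r\<^sup>2"] unfolding ev2_def p2_def by blast
qed

lemma fundamental_gap_perturbation_upper:
  assumes G: "compact_metric_graph G" "connected_graph G" "edges G \<noteq> {}" and q: "q \<in> Linf G" and P: "P \<in> Linf G"
    and u1: "u1 \<in> eigenspace G q (eigenvalue_nth G 1 q)" "inner_L2 G u1 u1 = 1"
    and u2: "u2 \<in> eigenspace G q (eigenvalue_nth G 2 q)" "inner_L2 G u2 u2 = 1"
  obtains C \<delta> where "\<And>t. \<bar>t\<bar> < \<delta> \<Longrightarrow>
     fundamental_gap G (\<lambda>e x. q e x + t * P e x)
       \<le> fundamental_gap G q + t * graph_integral G (\<lambda>e x. P e x * ((u2 e x)\<^sup>2 - (u1 e x)\<^sup>2)) + C * t\<^sup>2"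
     "0 < \<delta>" "0 < C"
proof -
  obtain C1 \<delta>1 where \<delta>1: "0 < \<delta>1" and low: "\<And>t. \<bar>t\<bar> < \<delta>1 \<Longrightarrow>
     eigenvalue_nth G 1 q + t * inner_L2 G (\<lambda>e x. P e x * u1 e x) u1 - C1 * t\<^sup>2
       \<le> eigenvalue_nth G 1 (\<lambda>e x. q e x + t * P e x)"
    by (rule first_eigenvalue_perturbation_lower[OF G q P u1]) (rule that)
  obtain C2 \<delta>2 where \<delta>2: "0 < \<delta>2" and up: "\<And>t. \<bar>t\<bar> < \<delta>2 \<Longrightarrow>
     eigenvalue_nth G 2 (\<lambda>e x. q e x + t * P e x)
       \<le> eigenvalue_nth G 2 q + t * inner_L2 G (\<lambda>e x. P e x * u2 e x) u2 + C2 * t\<^sup>2"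
    by (rule second_eigenvalue_perturbation_upper[OF G q P u1 u2]) (rule that)
  obtain v1 where v1: "W1inf G u1 v1" using eigenspaceD[OF G(1) q u1(1)] by blast
  obtain v2 where v2: "W1inf G u2 v2" using eigenspaceD[OF G(1) q u2(1)] by blast
  have sq: "(\<lambda>e x. u1 e x * u1 e x) \<in> Linf G" "(\<lambda>e x. u2 e x * u2 e x) \<in> Linf G"
    by (intro Linf_mult W1inf_Linf(1)[OF v1] W1inf_Linf(1)[OF v2])+
  define I where "I = graph_integral G (\<lambda>e x. P e x * ((u2 e x)\<^sup>2 - (u1 e x)\<^sup>2))"
  have "I = inner_L2 G P (lincomb 1 (\<lambda>e x. u2 e x * u2 e x) (-1) (\<lambda>e x. u1 e x * u1 e x))"
    by (simp add: I_def inner_L2_def lincomb_def power2_eq_square)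
  also have "\<dots> = inner_L2 G (\<lambda>e x. P e x * u2 e x) u2 - inner_L2 G (\<lambda>e x. P e x * u1 e x) u1"
    unfolding inner_L2_lincomb_right[OF sq(2,1) P] by (simp add: inner_L2_def mult.assoc)
  finally have I: "I = inner_L2 G (\<lambda>e x. P e x * u2 e x) u2 - inner_L2 G (\<lambda>e x. P e x * u1 e x) u1" .
  show ?thesis
  proof (rule that[of "min \<delta>1 \<delta>2" "\<bar>C1\<bar> + \<bar>C2\<bar> + 1"], goal_cases)
    case (1 t)
    have "fundamental_gap G (\<lambda>e x. q e x + t * P e x) \<le> fundamental_gap G q + t * I + (C1 + C2) * t\<^sup>2"
      using low[of t] up[of t] 1 unfolding fundamental_gap_def I by (simp add: algebra_simps)
    also have "(C1 + C2) * t\<^sup>2 \<le> (\<bar>C1\<bar> + \<bar>C2\<bar> + 1) * t\<^sup>2" by (intro mult_right_mono) auto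
    finally show ?case by (simp add: I_def)
  qed (use \<delta>1 \<delta>2 in auto)
qed

theorem corollary2p15:
  fixes G :: "('e, 'v) metric_graph"
    and C :: "('e \<Rightarrow> real \<Rightarrow> real) set"
    and q P u1 u2 :: "'e \<Rightarrow> real \<Rightarrow> real"
  assumes "compact_metric_graph G" and "connected_graph G"
    and "C \<subseteq> Linf G" and "q \<in> C"
    and "is_eigenfunction G q (eigenvalue_nth G 1 q) u1" and "L2_norm_graph G u1 = 1"
    and "is_eigenfunction G q (eigenvalue_nth G 2 q) u2" and "L2_norm_graph G u2 = 1"
    and "((\<forall>\<^sub>F t in at_right 0. (\<lambda>e x. q e x + t * P e x) \<in> C) \<and>
            graph_integral G (\<lambda>e x. P e x * ((u2 e x)\<^sup>2 - (u1 e x)\<^sup>2)) < 0) \<or>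
         ((\<forall>\<^sub>F t in at_left 0. (\<lambda>e x. q e x + t * P e x) \<in> C) \<and>
            graph_integral G (\<lambda>e x. P e x * ((u2 e x)\<^sup>2 - (u1 e x)\<^sup>2)) > 0)"
  shows "\<not> is_arg_min (fundamental_gap G) (\<lambda>p. p \<in> C) q"
proof -
  define I where "I = graph_integral G (\<lambda>e x. P e x * ((u2 e x)\<^sup>2 - (u1 e x)\<^sup>2))"
  have admissible: "\<exists>t. t \<noteq> 0 \<and> \<bar>t\<bar> < r \<and> t * I = - \<bar>t\<bar> * \<bar>I\<bar> \<and> (\<lambda>e x. q e x + t * P e x) \<in> C" if r: "0 < r" for r
    using assms(9)
  proof
    assume a: "(\<forall>\<^sub>F t in at_right 0. (\<lambda>e x. q e x + t * P e x) \<in> C) \<and>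
            graph_integral G (\<lambda>e x. P e x * ((u2 e x)\<^sup>2 - (u1 e x)\<^sup>2)) < 0"
    have "\<forall>\<^sub>F t in at_right (0::real). 0 < t \<and> t < r"
      using r by (auto simp: eventually_at_right[of 0 1] intro!: exI[of _ r])
    with a have "\<forall>\<^sub>F t in at_right 0. (0 < t \<and> t < r) \<and> (\<lambda>e x. q e x + t * P e x) \<in> C"
      by (auto elim: eventually_elim2)
    then obtain t where "(0 < t \<and> t < r) \<and> (\<lambda>e x. q e x + t * P e x) \<in> C"
      using eventually_happens'[OF trivial_limit_at_right_real] by blast
    then show ?thesis using a by (intro exI[of _ t]) (auto simp: I_def)
  next
    assume a: "(\<forall>\<^sub>F t in at_left 0. (\<lambda>e x. q e x + t * P e x) \<in> C) \<and>
            graph_integral G (\<lambda>e x. P e x * ((u2 e x)\<^sup>2 - (u1 e x)\<^sup>2)) > 0"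
    have "\<forall>\<^sub>F t in at_left (0::real). t < 0 \<and> - r < t"
      using r by (auto simp: eventually_at_left[of "-1" 0] intro!: exI[of _ "- r"])
    with a have "\<forall>\<^sub>F t in at_left 0. (t < 0 \<and> - r < t) \<and> (\<lambda>e x. q e x + t * P e x) \<in> C"
      by (auto elim: eventually_elim2)
    then obtain t where "(t < 0 \<and> - r < t) \<and> (\<lambda>e x. q e x + t * P e x) \<in> C"
      using eventually_happens'[OF trivial_limit_at_left_real] by blast
    then show ?thesis using a by (intro exI[of _ t]) (auto simp: I_def)
  qed
  have q: "q \<in> Linf G" using assms(3,4) by blast
  have u: "u1 \<in> eigenspace G q (eigenvalue_nth G 1 q)" "inner_L2 G u1 u1 = 1"
    "u2 \<in> eigenspace G q (eigenvalue_nth G 2 q)" "inner_L2 G u2 u2 = 1"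
    using assms(5-8) by (auto simp: is_eigenfunction_def L2_norm_graph_eq_1_iff)
  have edges: "edges G \<noteq> {}" using u(2) by (auto simp: inner_L2_def graph_integral_def)
  \<comment> \<open>The perturbation is a multiple of the difference of two potentials in the class.\<close>
  have P: "P \<in> Linf G"
  proof -
    obtain t where t: "t \<noteq> 0" "(\<lambda>e x. q e x + t * P e x) \<in> C" using admissible[of 1] by auto
    then have "lincomb (1 / t) (\<lambda>e x. q e x + t * P e x) (- 1 / t) q \<in> Linf G"
      using assms(3) by (intro Linf_lincomb q) auto
    moreover have "lincomb (1 / t) (\<lambda>e x. q e x + t * P e x) (- 1 / t) q = P"
      using t(1) by (simp add: lincomb_def fun_eq_iff field_simps)
    ultimately show ?thesis by simp
  qed
  have I: "0 < \<bar>I\<bar>" using assms(9) by (auto simp: I_def)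
  obtain K \<delta> where gap: "\<And>t. \<bar>t\<bar> < \<delta> \<Longrightarrow>
     fundamental_gap G (\<lambda>e x. q e x + t * P e x) \<le> fundamental_gap G q + t * I + K * t\<^sup>2"
    and K: "0 < \<delta>" "0 < K"
    by (rule fundamental_gap_perturbation_upper[OF assms(1,2) edges q P u, folded I_def]) (rule that)
  obtain t where t: "t \<noteq> 0" "\<bar>t\<bar> < min \<delta> (\<bar>I\<bar> / K)" "t * I = - \<bar>t\<bar> * \<bar>I\<bar>" "(\<lambda>e x. q e x + t * P e x) \<in> C"
    using admissible[of "min \<delta> (\<bar>I\<bar> / K)"] K(1,2) I by auto
  have "K * \<bar>t\<bar> < \<bar>I\<bar>" using t(2) K(2) by (simp add: field_simps)
  then have "\<bar>t\<bar> * (K * \<bar>t\<bar>) < \<bar>t\<bar> * \<bar>I\<bar>" using t(1) by (intro mult_strict_left_mono) auto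
  then have "t * I + K * t\<^sup>2 < 0" using t(3) by (simp add: power2_eq_square algebra_simps)
  then have "fundamental_gap G (\<lambda>e x. q e x + t * P e x) < fundamental_gap G q" using gap[of t] t(2) by simp
  then show ?thesis using t(4) unfolding is_arg_min_def by blast
qed

end
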